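(* Let $g>0$ and let $N$ be a positive integer. The resolvent $W_1(x)$ of the Gaussian orthogonal ensemble (see context) satisfies, for $x\in\mathbb{C}\setminus\mathbb{R}$, the fifth order linear inhomogeneous ordinary differential equation $$-4\frac{g^4}{N^4}W_1^{(V)}+5\left[x^2-(4N-2)\frac gN\right]\frac{g^2}{N^2}W_1'''-6\frac{g^2}{N^2}xW_1''$$ $$+\left[-x^4+(8N-4)\frac gN x^2+(-16N^2+16N+2)\frac{g^2}{N^2}\right]W_1'+x\left[x^2-(4N-2)\frac gN\right]W_1=2N(x^2-4g)+10g,$$ subject to the boundary condition, for fixed $g,N$, $$W_1(x)\sim\frac{m_0}{x}+\frac{g\,m_2}{N x^3}+\frac{g^2m_4}{N^2x^5}+\frac{g^3m_6}{N^3x^7}+\cdots\qquad(x\to\infty),$$ where the moments $m_{2p}$ (the GOE moments of the context) are given by $m_0=N$, $m_2=N^2+N$, $m_4=2N^3+5N^2+5N$, $m_6=5N^4+22N^3+52N^2+41N$, $m_8=14N^5+93N^4+374N^3+690N^2+509N$, $m_{10}=42N^6+386N^5+2290N^4+7150N^3+12143N^2+8229N$, $m_{12}=132N^7+1586N^6+12798N^5+58760N^4+167148N^3+258479N^2+166377N$.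
   Context: Consider the probability law on $(\lambda_1,\dots,\lambda_N)\in\mathbb{R}^N$ with density proportional to $\prod_{l=1}^Ne^{-N\lambda_l^2/(4g)}\prod_{1\le j<k\le N}|\lambda_k-\lambda_j|$ (the GOE, $\kappa=1/2$, with the scaling parameter $g$). The resolvent is $W_1(x)=\left\langle\sum_{j=1}^N\frac{1}{x-\lambda_j}\right\rangle$. The moments $m_{2p}=m_{2p}(N,1/2)$ are $\left\langle\sum_j\lambda_j^{2p}\right\rangle$ for the unscaled law with density proportional to $\prod_le^{-\lambda_l^2/4}\prod_{j<k}|\lambda_k-\lambda_j|$. The expansion as $x\to\infty$ is an asymptotic expansion (in closed sectors avoiding the real axis), not a convergent one. *)

theory Defs
  imports "HOL-Analysis.Analysis" "HOL-Library.Landau_Symbols"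
begin

text \<open>A point of \<open>\<real>\<^sup>N\<close> is a function on \<open>{1..N}\<close>, so that \<open>N\<close> can be an ordinary natural
  number.  The parameter \<open>a\<close> is \<open>N / (4 * g)\<close> for the law scaled by \<open>g\<close> and \<open>1 / 4\<close> for the
  unscaled law.\<close>

definition goe_weight :: "real \<Rightarrow> nat \<Rightarrow> (nat \<Rightarrow> real) \<Rightarrow> real" where
  "goe_weight a N y =
     (\<Prod>l\<in>{1..N}. exp (- a * (y l)\<^sup>2)) * (\<Prod>k\<in>{1..N}. \<Prod>j\<in>{1..<k}. \<bar>y k - y j\<bar>)"

definition goe_law :: "real \<Rightarrow> nat \<Rightarrow> (nat \<Rightarrow> real) measure" where
  "goe_law a N =
     (let M = (\<Pi>\<^sub>M l\<in>{1..N}. (lborel :: real measure))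
      in density M (\<lambda>y. ennreal (goe_weight a N y / integral\<^sup>L M (goe_weight a N))))"

definition goe_resolvent :: "real \<Rightarrow> nat \<Rightarrow> complex \<Rightarrow> complex" where
  "goe_resolvent g N x =
     (LINT y|goe_law (real N / (4 * g)) N. (\<Sum>j\<in>{1..N}. 1 / (x - of_real (y j))))"

definition goe_moment :: "nat \<Rightarrow> nat \<Rightarrow> real" where
  "goe_moment N k = (LINT y|goe_law (1 / 4) N. (\<Sum>j\<in>{1..N}. y j ^ k))"

text \<open>The points, in both half-planes, at angular distance at least \<open>\<delta>\<close> from the real axis.\<close>

definition sector_off_reals :: "real \<Rightarrow> complex set" where
  "sector_off_reals \<delta> = {x. x \<noteq> 0 \<and> \<delta> \<le> \<bar>Arg x\<bar> \<and> \<bar>Arg x\<bar> \<le> pi - \<delta>}"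

text \<open>Poincare asymptotic expansion \<open>f x ~ c 0 / x + c 1 / x ^ 3 + c 2 / x ^ 5 + ...\<close> as \<open>x\<close> tends to
  infinity inside \<open>S\<close>: every partial sum approximates \<open>f\<close> up to little-o of its last power.\<close>

definition has_odd_expansion_at_infinity ::
    "(complex \<Rightarrow> complex) \<Rightarrow> (nat \<Rightarrow> complex) \<Rightarrow> complex set \<Rightarrow> bool" where
  "has_odd_expansion_at_infinity f c S \<longleftrightarrow>
     (\<forall>n. (\<lambda>x. f x - (\<Sum>p\<le>n. c p / x ^ (2 * p + 1)))
            \<in> o[inf at_infinity (principal S)](\<lambda>x. 1 / x ^ (2 * n + 1)))"

end

theory Submission
  imports Defs "HOL-Combinatorics.Permutations" "HOL-Probability.Sinc_Integral"
begin

text \<open>Everything is read off the one-point density \<open>\<rho>\<close> of the eigenvalues. De Bruijn's device replaces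
  the sign of the Vandermonde product by a product of signs over disjoint pairs of variables, because
  both have the same antisymmetrization up to a factor; integrals of linear statistics then factor over
  the pairs, and only permutations preserving the pairs survive in a skew-orthogonal basis built from
  Hermite functions. The resulting sum telescopes: with \<open>\<phi>\<close> the Hermite function of index \<open>N - 1\<close> for the
  weight \<open>exp (- t\<^sup>2 / 4)\<close>, \<open>\<rho>\<close> is a multiple of \<open>\<phi>'\<^sup>2 - \<phi> \<phi>'' + \<phi> \<theta>\<close> with \<open>\<theta>' = t \<phi> / 4\<close>, and the parity
  of \<open>N\<close> enters only through the constant of integration of \<open>\<theta>\<close>.

  The derivatives of \<open>\<rho>\<close> are polynomial combinations of \<open>\<phi> \<theta>\<close>, \<open>\<phi>' \<theta>\<close>, \<open>\<phi>\<^sup>2\<close>, \<open>\<phi> \<phi>'\<close> and \<open>\<phi>'\<^sup>2\<close>, in which the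
  fifth order operator visibly annihilates \<open>\<rho>\<close>. Integrating by parts against \<open>1 / (x - t)\<close> gives the
  equation for the resolvent, whose right-hand side collects the boundary terms \<open>m\<^sub>0\<close> and \<open>m\<^sub>2\<close>;
  integrating by parts against powers of \<open>t\<close> gives the recurrence for the moments.\<close>

section \<open>Alternants, the Vandermonde product and pairings\<close>

text \<open>The absolute value of the Vandermonde product is the obstacle: it keeps the weight from
  expanding into products of one-variable functions. It is traded away at the price of a constant
  that is never evaluated. One constant \<open>K\<close> serves all admissible test functions
  \<open>h\<close>, and \<open>h = 1\<close> shows that \<open>K\<close> times the partition
  function is \<open>pairing_sum M > 0\<close>. The same calibration proves that the partition
  function is nonzero, so integrability of the weight comes out of the argument instead of entering
  it.

  Both parities of \<open>N\<close> are treated together, with \<open>M = N div 2\<close> pairs and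
  at most one unpaired variable. The parameter \<open>g\<close> returns only at the end, through the
  dilation by \<open>sqrt (N / g)\<close>.

  The second moment needs a source of its own. The first useful instance of the recurrence already
  expresses the fourth moment through \<open>m_0\<close> and \<open>m_2\<close>, and the right-hand
  side of the resolvent equation contains \<open>m_2\<close> as well. An explicit antiderivative
  supplies it: up to a multiple of the square of \<phi>, the density times
  \<open>t^2 - (4 * N - 2)\<close> is a derivative.\<close>

abbreviation swap :: "nat \<Rightarrow> nat \<Rightarrow> nat \<Rightarrow> nat" where
  "swap \<equiv> Transposition.transpose"

lemmas swap_def = Transposition.transpose_def

abbreviation rsign :: "(nat \<Rightarrow> nat) \<Rightarrow> real" where
  "rsign \<sigma> \<equiv> real_of_int (sign \<sigma>)"

definition vdm :: "nat \<Rightarrow> (nat \<Rightarrow> real) \<Rightarrow> real" where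
  "vdm N y = (\<Prod>k<N. \<Prod>j<k. y k - y j)"

lemma vdm_pairs: "vdm N y = (\<Prod>(j, k)\<in>{(j, k). j < k \<and> k < N}. y k - y j)"
proof -
  have "vdm N y = (\<Prod>(k, j)\<in>(SIGMA k:{..<N}. {..<k}). y k - y j)"
    unfolding vdm_def by (rule prod.Sigma) auto
  also have "\<dots> = (\<Prod>(j, k)\<in>{(j, k). j < k \<and> k < N}. y k - y j)"
    by (rule prod.reindex_bij_witness[of _ "\<lambda>(a, b). (b, a)" "\<lambda>(a, b). (b, a)"]) auto
  finally show ?thesis .
qed

text \<open>The pairs put out of order are \<open>(a, b)\<close> itself and, for every index
  strictly between, one pair with \<open>a\<close> and one with \<open>b\<close>: an odd
  number.\<close>

lemma prod_transpose_signs: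
  fixes a b N :: nat
  assumes ab: "a < b" "b < N"
  shows "(\<Prod>(j, k)\<in>{(j, k). j < k \<and> k < N}.
           if swap a b j < swap a b k then 1 else -1 :: real) = -1"
proof -
  define P where "P = {(j, k). j < k \<and> k < N}"
  define A where "A = {(j, k). j = a \<and> a < k \<and> k < b}"
  define B where "B = {(j, k). k = b \<and> a < j \<and> j < b}"
  have P: "P = (SIGMA j:{..<N}. {j<..<N})"
    by (auto simp: P_def)
  have finP: "finite P"
    unfolding P by (intro finite_SigmaI) auto
  have A: "A = (\<lambda>k. (a, k)) ` {a<..<b}" and B: "B = (\<lambda>j. (j, b)) ` {a<..<b}"
    by (auto simp: A_def B_def)
  have cA: "card A = b - Suc a" and cB: "card B = b - Suc a"
    unfolding A B by (subst card_image; auto simp: inj_on_def)+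
  have fin: "finite A" "finite B"
    by (simp_all add: A B)
  have card: "card (insert (a, b) (A \<union> B)) = Suc (2 * (b - Suc a))"
    using cA cB fin by (subst card_insert_disjoint) (auto simp: card_Un_disjoint A_def B_def disjoint_iff)
  have inv: "insert (a, b) (A \<union> B) = P \<inter> {(j, k). \<not> swap a b j < swap a b k}"
    using ab by (auto simp: A_def B_def P_def swap_def split: if_splits)
  have "(\<Prod>(j, k)\<in>P. if swap a b j < swap a b k then 1 else -1 :: real)
        = (\<Prod>p\<in>P. if \<not> swap a b (fst p) < swap a b (snd p) then -1 else 1)"
    by (intro prod.cong) auto
  also have "\<dots> = (\<Prod>p\<in>insert (a, b) (A \<union> B). -1)"
    unfolding inv using finP
    by (simp add: prod.If_cases case_prod_unfold)
  also have "\<dots> = (-1) ^ Suc (2 * (b - Suc a))"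
    using card by (simp only: prod_constant)
  also have "\<dots> = (-1 :: real)"
    by simp
  finally show ?thesis by (simp add: P_def)
qed

lemma vdm_transpose:
  assumes ab: "a < N" "b < N" "a \<noteq> b"
  shows "vdm N (y \<circ> swap a b) = - vdm N y"
proof -
  have *: "vdm N (y \<circ> swap a b) = - vdm N y" if ab: "a < b" "b < N" for a b
  proof -
    define t where "t = swap a b"
    define P where "P = {(j, k). j < k \<and> k < N}"
    have tt: "t (t i) = i" and tN: "t i < N \<longleftrightarrow> i < N" and tinj: "t i = t j \<longleftrightarrow> i = j" for i j
      using ab by (auto simp: t_def swap_def split: if_splits)
    \<comment> \<open>\<open>m\<close> sorts the transposed pair. It is an involution of
      \<open>P\<close>, so the differences are merely permuted, and what remains is the product of
      the signs lost in sorting.\<close>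
    define m where "m = (\<lambda>(j, k). (min (t j) (t k), max (t j) (t k)))"
    have tlt: "t j < t i" if "\<not> t i < t j" "i < j" for i j
      using that tinj[of i j] by auto
    have mm: "m p \<in> P \<and> m (m p) = p" if "p \<in> P" for p
      using that tlt by (cases p) (auto simp: m_def P_def tt tN tinj min_def max_def not_le le_less)
    have "vdm N (y \<circ> t) = (\<Prod>(j, k)\<in>P. y (t k) - y (t j))"
      by (simp add: vdm_pairs P_def)
    also have "\<dots> = (\<Prod>p\<in>P. (if t (fst p) < t (snd p) then 1 else -1)
                                * (y (snd (m p)) - y (fst (m p))))"
      by (intro prod.cong) (auto simp: m_def P_def min_def max_def)
    also have "\<dots> = (\<Prod>(j, k)\<in>P. if t j < t k then 1 else -1)
                        * (\<Prod>p\<in>P. y (snd (m p)) - y (fst (m p)))"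
      by (simp add: prod.distrib case_prod_unfold)
    also have "(\<Prod>p\<in>P. y (snd (m p)) - y (fst (m p))) = (\<Prod>p\<in>P. y (snd p) - y (fst p))"
      by (rule prod.reindex_bij_witness[of _ m m]) (use mm in auto)
    also have "(\<Prod>(j, k)\<in>P. if t j < t k then 1 else -1 :: real) = -1"
      using prod_transpose_signs[OF ab] by (simp add: P_def t_def)
    finally show ?thesis by (simp add: vdm_pairs P_def t_def case_prod_unfold)
  qed
  show ?thesis
    using *[of a b] *[of b a] ab by (cases "a < b") (auto simp: transpose_commute)
qed

lemma vdm_permute:
  assumes "\<sigma> permutes {..<N}"
  shows "vdm N (y \<circ> \<sigma>) = rsign \<sigma> * vdm N y"
  using assms finite_lessThan[of N]
proof (induction arbitrary: y rule: permutes_induct)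
  case id
  then show ?case by simp
next
  case (swap a b p)
  have "vdm N (y \<circ> (swap a b \<circ> p)) = rsign p * vdm N (y \<circ> swap a b)"
    using swap.IH[of "y \<circ> swap a b"] unfolding comp_assoc[symmetric] by (simp add: comp_def)
  also have "\<dots> = rsign (swap a b \<circ> p) * vdm N y"
    using swap permutes_imp_permutation[of "{..<N}" p]
    by (simp add: vdm_transpose sign_compose permutation_swap_id sign_swap_id)
  finally show ?case .
qed

lemma vdm_pos: "strict_mono_on {..<N} y \<Longrightarrow> vdm N y > 0"
  unfolding vdm_def by (intro prod_pos) (auto simp: strict_mono_on_def)

lemma vdm_cong: "(\<And>j. j < N \<Longrightarrow> y j = z j) \<Longrightarrow> vdm N y = vdm N z"
  unfolding vdm_def by (intro prod.cong) auto

lemma vdm_eq_0: "a < N \<Longrightarrow> b < N \<Longrightarrow> a \<noteq> b \<Longrightarrow> y a = y b \<Longrightarrow> vdm N y = 0"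
  using vdm_transpose[of a N b y] vdm_cong[of N "y \<circ> swap a b" y]
  by (simp add: swap_def)

lemma sgn_prod: "sgn (\<Prod>i\<in>A. f i) = (\<Prod>i\<in>A. sgn (f i :: real))"
  by (induction A rule: infinite_finite_induct) (auto simp: sgn_mult)

lemma sgn_vdm: "sgn (vdm N y) = (\<Prod>k<N. \<Prod>j<k. sgn (y k - y j))"
  by (simp add: vdm_def sgn_prod)

text \<open>Alternation of the Vandermonde product, read off at the increasing point
  \<open>y j = j\<close>, where the product is positive.\<close>

lemma sign_eq_prod_sgn:
  assumes "\<sigma> permutes {..<N}"
  shows "rsign \<sigma> = (\<Prod>k<N. \<Prod>j<k. sgn (real (\<sigma> k) - real (\<sigma> j)))"
proof -
  have pos: "vdm N real > 0"
    by (rule vdm_pos) (auto simp: strict_mono_on_def)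
  have "vdm N (real \<circ> \<sigma>) = rsign \<sigma> * vdm N real"
    by (rule vdm_permute[OF assms])
  then have "sgn (vdm N (real \<circ> \<sigma>)) = sgn (rsign \<sigma>)"
    using pos by (simp add: sgn_mult)
  also have "\<dots> = rsign \<sigma>"
    by (auto simp: sign_def)
  finally show ?thesis by (simp add: sgn_vdm)
qed

definition alternant :: "nat \<Rightarrow> (nat \<Rightarrow> real \<Rightarrow> real) \<Rightarrow> (nat \<Rightarrow> real) \<Rightarrow> real" where
  "alternant N e y = (\<Sum>\<sigma> | \<sigma> permutes {..<N}. rsign \<sigma> * (\<Prod>j<N. e (\<sigma> j) (y j)))"

lemma alternant_permute:
  assumes "\<tau> permutes {..<N}"
  shows "alternant N e (y \<circ> \<tau>) = rsign \<tau> * alternant N e y"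
proof -
  have p: "permutation \<tau>" "permutation (inv \<tau>)"
    using assms permutes_imp_permutation permutes_inv by (auto simp: permutation_inverse)
  have "alternant N e (y \<circ> \<tau>)
        = (\<Sum>\<sigma> | \<sigma> permutes {..<N}. rsign (\<sigma> \<circ> \<tau>) * (\<Prod>j<N. e ((\<sigma> \<circ> \<tau>) j) ((y \<circ> \<tau>) j)))"
    unfolding alternant_def by (rule sum_permutations_compose_right[OF assms])
  also have "\<dots> = (\<Sum>\<sigma> | \<sigma> permutes {..<N}. rsign \<tau> * (rsign \<sigma> * (\<Prod>j<N. e (\<sigma> j) (y j))))"
  proof (rule sum.cong[OF refl])
    fix \<sigma> assume "\<sigma> \<in> {\<sigma>. \<sigma> permutes {..<N}}"
    then have "rsign (\<sigma> \<circ> \<tau>) = rsign \<tau> * rsign \<sigma>"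
      using p permutes_imp_permutation[of "{..<N}" \<sigma>] by (simp add: sign_compose)
    moreover have "(\<Prod>j<N. e ((\<sigma> \<circ> \<tau>) j) ((y \<circ> \<tau>) j)) = (\<Prod>j<N. e (\<sigma> j) (y j))"
      using prod.permute[OF assms, of "\<lambda>j. e (\<sigma> j) (y j)"] by (simp add: comp_def)
    ultimately show "rsign (\<sigma> \<circ> \<tau>) * (\<Prod>j<N. e ((\<sigma> \<circ> \<tau>) j) ((y \<circ> \<tau>) j))
        = rsign \<tau> * (rsign \<sigma> * (\<Prod>j<N. e (\<sigma> j) (y j)))"
      by simp
  qed
  finally show ?thesis by (simp add: alternant_def sum_distrib_left)
qed

lemma alternant_cong: "(\<And>j. j < N \<Longrightarrow> y j = z j) \<Longrightarrow> alternant N e y = alternant N e z"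
  unfolding alternant_def by (intro sum.cong prod.cong arg_cong2[where f="(*)"]) auto

lemma alternant_eq_0:
  assumes "a < N" "b < N" "a \<noteq> b" "y a = y b"
  shows "alternant N e y = 0"
proof -
  have "swap a b permutes {..<N}"
    using assms by (intro permutes_swap_id) auto
  then have "alternant N e (y \<circ> swap a b) = - alternant N e y"
    using assms by (simp add: alternant_permute sign_swap_id)
  moreover have "alternant N e (y \<circ> swap a b) = alternant N e y"
    using assms by (intro alternant_cong) (auto simp: swap_def)
  ultimately show ?thesis by simp
qed

text \<open>Coordinates leave the grid one at a time: in the coordinate being released, the function
  is a polynomial of degree below \<open>N\<close> with the \<open>N\<close> zeros \<open>0\<close>,
  ..., \<open>N - 1\<close>.\<close>

lemma separately_poly_eq_0:
  fixes F :: "(nat \<Rightarrow> real) \<Rightarrow> real"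
  assumes poly: "\<And>j y. j < N \<Longrightarrow> \<exists>p. degree p < N \<and> (\<forall>s. F (y(j := s)) = poly p s)"
    and grid: "\<And>y. (\<And>j. j < N \<Longrightarrow> \<exists>k<N. y j = real k) \<Longrightarrow> F y = 0"
  shows "F y = 0"
proof -
  \<comment> \<open>Coordinates below \<open>m\<close> are arbitrary; the remaining ones still lie
    on the grid.\<close>
  have "F y = 0" if "m \<le> N" "\<And>j. m \<le> j \<Longrightarrow> j < N \<Longrightarrow> \<exists>k<N. y j = real k" for m y
    using that
  proof (induction m arbitrary: y)
    case 0
    then show ?case by (intro grid) auto
  next
    case (Suc m)
    obtain p where p: "degree p < N" "\<And>s. F (y(m := s)) = poly p s"
      using poly[of m y] Suc.prems by auto
    have zero: "poly p (real k) = 0" if "k < N" for k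
      unfolding p(2)[symmetric] using Suc.prems that by (intro Suc.IH) (auto simp: Suc_le_eq)
    have "p = 0"
    proof (rule ccontr)
      assume "p \<noteq> 0"
      then have "finite {x. poly p x = 0}" "card {x. poly p x = 0} \<le> degree p"
        by (auto simp: poly_roots_finite card_poly_roots_bound)
      moreover have "real ` {..<N} \<subseteq> {x. poly p x = 0}"
        using zero by auto
      ultimately have "card (real ` {..<N}) \<le> degree p"
        using card_mono order_trans by blast
      then show False
        using p(1) by (simp add: card_image)
    qed
    then show ?case
      using p(2)[of "y m"] by simp
  qed
  from this[of N y] show ?thesis by simp
qed

text \<open>Coordinate \<open>j\<close> occurs in \<open>j\<close> factors as the larger index and
  in \<open>N - 1 - j\<close> factors as the smaller one, so the degree is at most
  \<open>N - 1\<close>.\<close>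

lemma vdm_separately_poly:
  assumes "j < N"
  shows "\<exists>p. degree p < N \<and> (\<forall>s. vdm N (y(j := s)) = poly p s)"
proof -
  define f where "f k i = (if k = j then [:- y i, 1:] else if i = j then [:y k, -1:] else [:y k - y i:])" for k i
  define p where "p = (\<Prod>k<N. \<Prod>i<k. f k i)"
  have deg: "degree (\<Prod>i<k. f k i) \<le> (if k = j then j else if j < k then 1 else 0)" for k
  proof -
    have "degree (\<Prod>i<k. f k i) \<le> (\<Sum>i<k. degree (f k i))"
      using degree_prod_sum_le[of "{..<k}" "f k"] by (simp add: comp_def)
    also have "\<dots> = (\<Sum>i<k. if k = j then 1 else if i = j then 1 else 0)"
      by (intro sum.cong) (auto simp: f_def)
    also have "\<dots> = (if k = j then j else if j < k then 1 else 0)"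
      by (auto simp: sum.delta)
    finally show ?thesis .
  qed
  have "degree p \<le> (\<Sum>k<N. degree (\<Prod>i<k. f k i))"
    unfolding p_def using degree_prod_sum_le[of "{..<N}" "\<lambda>k. \<Prod>i<k. f k i"] by (simp add: comp_def)
  also have "\<dots> \<le> (\<Sum>k<N. if k = j then j else if j < k then 1 else 0)"
    by (intro sum_mono deg)
  also have "\<dots> = (\<Sum>k<N. (if k = j then j else 0) + (if j < k then 1 else 0))"
    by (intro sum.cong) auto
  also have "\<dots> = j + card {j<..<N}"
  proof -
    have "(\<Sum>k<N. if j < k then 1 else 0 :: nat) = card {k\<in>{..<N}. j < k}"
      by (subst card_eq_sum, subst sum.inter_filter) auto
    also have "{k\<in>{..<N}. j < k} = {j<..<N}" by auto
    finally show ?thesis using assms by (simp add: sum.distrib)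
  qed
  also have "\<dots> < N" using assms by simp
  finally have "degree p < N" .
  moreover have "vdm N (y(j := s)) = poly p s" for s
    unfolding vdm_def p_def poly_prod by (intro prod.cong) (auto simp: f_def)
  ultimately show ?thesis by blast
qed

lemma alternant_separately_poly:
  assumes "j < N" and p: "\<And>i. i < N \<Longrightarrow> degree (p i) < N"
  shows "\<exists>r. degree r < N \<and> (\<forall>s. alternant N (\<lambda>i. poly (p i)) (y(j := s)) = poly r s)"
proof -
  define c where "c \<sigma> = rsign \<sigma> * (\<Prod>i\<in>{..<N} - {j}. poly (p (\<sigma> i)) (y i))" for \<sigma>
  define r where "r = (\<Sum>\<sigma> | \<sigma> permutes {..<N}. smult (c \<sigma>) (p (\<sigma> j)))"
  have "degree r < N"
    unfolding r_def
  proof (rule degree_sum_less)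
    fix \<sigma> assume "\<sigma> \<in> {\<sigma>. \<sigma> permutes {..<N}}"
    then have "\<sigma> j < N"
      using assms(1) permutes_in_image[of \<sigma> "{..<N}" j] by simp
    then show "degree (smult (c \<sigma>) (p (\<sigma> j))) < N"
      using p degree_smult_le order.strict_trans1 by blast
  qed (use assms in auto)
  moreover have "alternant N (\<lambda>i. poly (p i)) (y(j := s)) = poly r s" for s
    unfolding alternant_def r_def poly_sum
  proof (rule sum.cong[OF refl])
    fix \<sigma>
    have "(\<Prod>i<N. poly (p (\<sigma> i)) ((y(j := s)) i))
          = poly (p (\<sigma> j)) s * (\<Prod>i\<in>{..<N} - {j}. poly (p (\<sigma> i)) (y i))"
      using assms(1) by (subst prod.remove[of _ j]) (auto intro!: prod.cong)
    then show "rsign \<sigma> * (\<Prod>i<N. poly (p (\<sigma> i)) ((y(j := s)) i)) = poly (smult (c \<sigma>) (p (\<sigma> j))) s"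
      by (simp add: c_def mult_ac)
  qed
  ultimately show ?thesis by blast
qed

text \<open>Both sides are alternating and of degree below \<open>N\<close> in each variable, and such a function is
  determined by its value at the single point \<open>(0, 1, \<dots>, N - 1)\<close>: interpolation reduces it to the
  grid \<open>{0..<N}\<^sup>N\<close>, and antisymmetry reduces the grid to that point.\<close>

lemma alternant_poly:
  assumes p: "\<And>i. i < N \<Longrightarrow> degree (p i) < N"
  shows "\<exists>\<kappa>. \<forall>y. alternant N (\<lambda>i. poly (p i)) y = \<kappa> * vdm N y"
proof -
  define \<kappa> where "\<kappa> = alternant N (\<lambda>i. poly (p i)) real / vdm N real"
  define F where "F y = alternant N (\<lambda>i. poly (p i)) y - \<kappa> * vdm N y" for y
  have pos: "vdm N real > 0"
    by (rule vdm_pos) (auto simp: strict_mono_on_def)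
  have "F y = 0" for y
  proof (rule separately_poly_eq_0[of N F])
    fix j y assume j: "j < N"
    obtain r where r: "degree r < N" "\<And>s. alternant N (\<lambda>i. poly (p i)) (y(j := s)) = poly r s"
      using alternant_separately_poly[OF j, of p y] p by blast
    obtain r' where r': "degree r' < N" "\<And>s. vdm N (y(j := s)) = poly r' s"
      using vdm_separately_poly[OF j] by blast
    have "degree (r - smult \<kappa> r') < N"
      using r(1) r'(1) degree_smult_le[of \<kappa> r'] by (intro degree_diff_less) auto
    then show "\<exists>p. degree p < N \<and> (\<forall>s. F (y(j := s)) = poly p s)"
      by (intro exI[of _ "r - smult \<kappa> r'"]) (simp add: F_def r(2) r'(2))
  next
    fix y assume grid: "\<And>j. j < N \<Longrightarrow> \<exists>k<N. y j = real k"
    then obtain k where k: "\<And>j. j < N \<Longrightarrow> k j < N" "\<And>j. j < N \<Longrightarrow> y j = real (k j)"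
      by metis
    show "F y = 0"
    proof (cases "inj_on k {..<N}")
      case False
      then obtain a b where "a < N" "b < N" "a \<noteq> b" "y a = y b"
        using k by (auto simp: inj_on_def)
      then show ?thesis
        by (simp add: F_def alternant_eq_0[of a N b] vdm_eq_0[of a N b])
    next
      case True
      define \<tau> where "\<tau> j = (if j < N then k j else j)" for j
      have "k ` {..<N} = {..<N}"
        using True k(1) by (intro endo_inj_surj) auto
      with True have "bij_betw k {..<N} {..<N}"
        by (simp add: bij_betw_def)
      then have "bij_betw \<tau> {..<N} {..<N}"
        by (subst bij_betw_cong[of _ _ k]) (auto simp: \<tau>_def)
      then have \<tau>: "\<tau> permutes {..<N}"
        by (rule bij_imp_permutes) (auto simp: \<tau>_def)
      have y: "y j = (real \<circ> \<tau>) j" if "j < N" for j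
        using that k by (simp add: \<tau>_def)
      have "F y = F (real \<circ> \<tau>)"
        unfolding F_def using y alternant_cong[of N y "real \<circ> \<tau>"] vdm_cong[of N y "real \<circ> \<tau>"] by presburger
      also have "\<dots> = rsign \<tau> * F real"
        by (simp add: F_def alternant_permute[OF \<tau>] vdm_permute[OF \<tau>] algebra_simps)
      also have "F real = 0"
        using pos by (simp add: F_def \<kappa>_def)
      finally show ?thesis by simp
    qed
  qed
  then show ?thesis by (auto simp: F_def)
qed

section \<open>Sign products over disjoint pairs and block-preserving permutations\<close>

definition pair_sgn :: "nat \<Rightarrow> (nat \<Rightarrow> real) \<Rightarrow> real" where
  "pair_sgn M y = (\<Prod>i<M. sgn (y (2 * i + 1) - y (2 * i)))"

lemma ex_sorting_permutation:
  fixes y :: "nat \<Rightarrow> real"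
  assumes "inj_on y {..<N}"
  obtains \<tau> where "\<tau> permutes {..<N}" "strict_mono_on {..<N} (y \<circ> \<tau>)"
proof -
  define z where "z = sorted_list_of_set (y ` {..<N})"
  have len: "length z = N"
    using assms by (simp add: z_def card_image)
  have set: "set z = y ` {..<N}" and dist: "distinct z" and srt: "sorted_wrt (<) z"
    by (simp_all add: z_def)
  have bz: "bij_betw (\<lambda>i. z ! i) {..<N} (y ` {..<N})"
    using bij_betw_nth[OF dist] len set by (simp add: lessThan_def)
  have yb: "bij_betw y {..<N} (y ` {..<N})"
    using assms by (simp add: bij_betw_def)
  define \<tau> where "\<tau> i = (if i < N then inv_into {..<N} y (z ! i) else i)" for i
  have "bij_betw (inv_into {..<N} y \<circ> (\<lambda>i. z ! i)) {..<N} {..<N}"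
    by (rule bij_betw_trans[OF bz bij_betw_inv_into[OF yb]])
  then have "bij_betw \<tau> {..<N} {..<N}"
    by (subst bij_betw_cong[where g = "inv_into {..<N} y \<circ> (\<lambda>i. z ! i)"]) (auto simp: \<tau>_def)
  then have "\<tau> permutes {..<N}"
    by (rule bij_imp_permutes) (auto simp: \<tau>_def)
  moreover have "strict_mono_on {..<N} (y \<circ> \<tau>)"
  proof (rule strict_mono_onI)
    fix i j assume "i \<in> {..<N}" "j \<in> {..<N}" "i < j"
    moreover have "y (inv_into {..<N} y (z ! i)) = z ! i" if "i < N" for i
      using that set len by (intro f_inv_into_f) (metis nth_mem)
    ultimately show "(y \<circ> \<tau>) i < (y \<circ> \<tau>) j"
      using srt len by (simp add: \<tau>_def sorted_wrt_iff_nth_less)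
  qed
  ultimately show thesis by (rule that)
qed

text \<open>\<open>pair_sgn\<close> depends only on the relative order of the coordinates. Sorting
  \<open>y\<close> therefore reduces the sum to its value at \<open>0, 1, ...\<close>, and the
  sorting permutation contributes its sign, which is that of the Vandermonde product. That the
  constant does not vanish emerges only implicitly, from \<open>pairing_sum_pos\<close> in
  \<open>goe_linear_statistic\<close>.\<close>

lemma antisymmetrize_pair_sgn:
  assumes "2 * M \<le> N"
  shows "\<exists>c. \<forall>y. inj_on y {..<N} \<longrightarrow>
           (\<Sum>\<tau> | \<tau> permutes {..<N}. rsign \<tau> * pair_sgn M (y \<circ> \<tau>)) = c * sgn (vdm N y)"
proof (intro exI allI impI)
  fix y :: "nat \<Rightarrow> real"
  assume "inj_on y {..<N}"
  then obtain \<tau>0 where \<tau>0: "\<tau>0 permutes {..<N}" "strict_mono_on {..<N} (y \<circ> \<tau>0)"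
    using ex_sorting_permutation by blast
  have sgn: "sgn (vdm N y) = rsign \<tau>0"
  proof -
    have "vdm N y * rsign \<tau>0 > 0"
      using vdm_pos[OF \<tau>0(2)] vdm_permute[OF \<tau>0(1), of y] by (simp add: mult.commute)
    then show ?thesis
      by (cases \<tau>0 rule: sign_cases) auto
  qed
  have "(\<Sum>\<tau> | \<tau> permutes {..<N}. rsign \<tau> * pair_sgn M (y \<circ> \<tau>))
        = (\<Sum>\<tau> | \<tau> permutes {..<N}. rsign (\<tau>0 \<circ> \<tau>) * pair_sgn M (y \<circ> (\<tau>0 \<circ> \<tau>)))"
    by (rule setum_permutations_compose_left[OF \<tau>0(1)])
  also have "\<dots> = (\<Sum>\<tau> | \<tau> permutes {..<N}. rsign \<tau>0 * (rsign \<tau> * pair_sgn M (real \<circ> \<tau>)))"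
  proof (rule sum.cong[OF refl])
    fix \<tau> assume \<tau>: "\<tau> \<in> {\<tau>. \<tau> permutes {..<N}}"
    have "rsign (\<tau>0 \<circ> \<tau>) = rsign \<tau>0 * rsign \<tau>"
      using \<tau> \<tau>0(1) permutes_imp_permutation[of "{..<N}"] by (simp add: sign_compose)
    moreover have "pair_sgn M (y \<circ> (\<tau>0 \<circ> \<tau>)) = pair_sgn M (real \<circ> \<tau>)"
      unfolding pair_sgn_def
    proof (rule prod.cong[OF refl])
      fix i assume "i \<in> {..<M}"
      then have "\<tau> (2 * i + 1) < N" "\<tau> (2 * i) < N"
        using \<tau> assms permutes_in_image[of \<tau> "{..<N}"] by auto
      then show "sgn ((y \<circ> (\<tau>0 \<circ> \<tau>)) (2 * i + 1) - (y \<circ> (\<tau>0 \<circ> \<tau>)) (2 * i))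
               = sgn ((real \<circ> \<tau>) (2 * i + 1) - (real \<circ> \<tau>) (2 * i))"
        using \<tau>0(2) strict_mono_on_less[OF \<tau>0(2)]
        by (cases "\<tau> (2 * i + 1)" "\<tau> (2 * i)" rule: linorder_cases)
           (auto simp: strict_mono_on_def)
    qed
    ultimately show "rsign (\<tau>0 \<circ> \<tau>) * pair_sgn M (y \<circ> (\<tau>0 \<circ> \<tau>))
        = rsign \<tau>0 * (rsign \<tau> * pair_sgn M (real \<circ> \<tau>))"
      by simp
  qed
  also have "\<dots> = (\<Sum>\<tau> | \<tau> permutes {..<N}. rsign \<tau> * pair_sgn M (real \<circ> \<tau>)) * sgn (vdm N y)"
    by (simp add: sgn sum_distrib_left mult.commute)
  finally show "(\<Sum>\<tau> | \<tau> permutes {..<N}. rsign \<tau> * pair_sgn M (y \<circ> \<tau>)) = \<dots>" .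
qed


text \<open>The Gram matrix of the skew form in the normalised basis: diagonal blocks with rows
  \<open>(0, 1)\<close> and \<open>(- 1, 0)\<close>, the block of \<open>i\<close> being
  \<open>i div 2\<close>.\<close>

definition pairing :: "nat \<Rightarrow> nat \<Rightarrow> real" where
  "pairing i j = (if i div 2 = j div 2 then sgn (real j - real i) else 0)"

lemma same_block_cases:
  fixes x y z :: nat
  assumes "x div 2 = y div 2" "x div 2 = z div 2" "x \<noteq> y" "x \<noteq> z"
  shows "y = z"
proof -
  have "x mod 2 \<noteq> y mod 2" "x mod 2 \<noteq> z mod 2"
    using assms by (metis div_mult_mod_eq)+
  then have "y mod 2 = z mod 2"
    by (metis not_mod_2_eq_1_eq_0)
  then show ?thesis
    using assms by (metis div_mult_mod_eq)
qed

text \<open>The partner of \<open>\<sigma> (2 * i0)\<close> in its block has a preimage. Were this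
  in another pair, the whole of that pair would go into the same block, and its other element would
  collide with \<open>2 * i0\<close>. Consequently, dropping one factor from a product of pairings
  admits no new permutations.\<close>

lemma last_pair_preserved:
  fixes \<sigma> :: "nat \<Rightarrow> nat"
  assumes \<sigma>: "\<sigma> permutes {..<2 * M}" and i0: "i0 < M"
    and pairs: "\<And>i. i < M \<Longrightarrow> i \<noteq> i0 \<Longrightarrow> \<sigma> (2 * i) div 2 = \<sigma> (2 * i + 1) div 2"
  shows "\<sigma> (2 * i0) div 2 = \<sigma> (2 * i0 + 1) div 2"
proof -
  have inj: "\<sigma> x = \<sigma> y \<longleftrightarrow> x = y" for x y
    using permutes_inj[OF \<sigma>] by (auto simp: inj_def)
  define x where "x = \<sigma> (2 * i0)"
  have "x < 2 * M"
    using permutes_in_image[OF \<sigma>, of "2 * i0"] i0 by (simp add: x_def)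
  define u where "u = (if even x then x + 1 else x - 1)"
  have u: "u < 2 * M" "u \<noteq> x" "u div 2 = x div 2"
    using \<open>x < 2 * M\<close> by (auto simp: u_def elim!: evenE oddE)
  obtain p where p: "\<sigma> p = u"
    using permutes_surj[OF \<sigma>] by (metis surjD)
  then have "p < 2 * M"
    using permutes_in_image[OF \<sigma>, of p] u by simp
  have "p \<noteq> 2 * i0" using p u by (auto simp: x_def)
  show ?thesis
  proof (cases "p div 2 = i0")
    case True
    then have "p = 2 * i0 + 1" using \<open>p \<noteq> 2 * i0\<close> by presburger
    then show ?thesis using p u by (simp add: x_def)
  next
    case False
    define p' where "p' = (if even p then p + 1 else p - 1)"
    have p': "p' \<noteq> p" "p' div 2 = p div 2"
      by (auto simp: p'_def elim!: evenE oddE)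
    have "\<sigma> p' div 2 = \<sigma> p div 2"
      using pairs[of "p div 2"] False \<open>p < 2 * M\<close>
      by (cases "even p") (auto simp: p'_def elim!: evenE oddE)
    then have "\<sigma> p' = x"
      using same_block_cases[of u "\<sigma> p'" x] p u p' inj[of p' p] by auto
    then have "p' = 2 * i0"
      using inj by (simp add: x_def)
    then show ?thesis using False p' by auto
  qed
qed

text \<open>Two pairs sent into one block would give it more than two elements.\<close>

lemma pair_preserving_bij:
  fixes \<sigma> :: "nat \<Rightarrow> nat"
  assumes \<sigma>: "\<sigma> permutes {..<2 * M}"
    and pairs: "\<And>i. i < M \<Longrightarrow> \<sigma> (2 * i) div 2 = \<sigma> (2 * i + 1) div 2"
  shows "bij_betw (\<lambda>i. \<sigma> (2 * i) div 2) {..<M} {..<M}"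
proof -
  have inj: "\<sigma> x = \<sigma> y \<longleftrightarrow> x = y" for x y
    using permutes_inj[OF \<sigma>] by (auto simp: inj_def)
  have "inj_on (\<lambda>i. \<sigma> (2 * i) div 2) {..<M}"
  proof (rule inj_onI)
    fix i j assume ij: "i \<in> {..<M}" "j \<in> {..<M}" "\<sigma> (2 * i) div 2 = \<sigma> (2 * j) div 2"
    show "i = j"
    proof (rule ccontr)
      assume "i \<noteq> j"
      then have A: "\<sigma> (2 * i) \<noteq> \<sigma> (2 * j)"
        by (simp add: inj)
      have B: "\<sigma> (2 * i) \<noteq> \<sigma> (2 * i + 1)"
        using inj by simp
      have "\<sigma> (2 * i + 1) = \<sigma> (2 * j)"
        by (rule same_block_cases[OF _ ij(3) B A]) (use ij pairs in blast)
      then have "2 * i + 1 = 2 * j" by (simp only: inj)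
      then show False by presburger
    qed
  qed
  moreover have "(\<lambda>i. \<sigma> (2 * i) div 2) ` {..<M} \<subseteq> {..<M}"
  proof (rule image_subsetI)
    fix i assume "i \<in> {..<M}"
    then have "\<sigma> (2 * i) < 2 * M"
      using permutes_in_image[OF \<sigma>, of "2 * i"] by simp
    then show "\<sigma> (2 * i) div 2 \<in> {..<M}"
      by (simp add: less_mult_imp_div_less mult.commute)
  qed
  ultimately show ?thesis
    unfolding bij_betw_def by (simp add: endo_inj_surj)
qed

lemma prod_pairs: "(\<Prod>j<2 * M. f j) = (\<Prod>i<M. f (2 * i) * f (2 * i + 1 :: nat) :: real)"
  by (induction M) (auto simp: mult_ac)

text \<open>In terms of inversions: two distinct blocks contribute four equal comparisons.\<close>

lemma sign_pair_preserving:
  fixes \<sigma> :: "nat \<Rightarrow> nat"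
  assumes \<sigma>: "\<sigma> permutes {..<2 * M}"
    and pairs: "\<And>i. i < M \<Longrightarrow> \<sigma> (2 * i) div 2 = \<sigma> (2 * i + 1) div 2"
  shows "rsign \<sigma> * (\<Prod>i<M. pairing (\<sigma> (2 * i)) (\<sigma> (2 * i + 1))) = 1"
proof -
  define s where "s k j = sgn (real (\<sigma> k) - real (\<sigma> j))" for k j
  have sgn_cong: "sgn (real x - real y) = sgn (real x' - real y')"
    if "x div 2 \<noteq> y div 2" "x' div 2 = x div 2" "y' div 2 = y div 2" for x y x' y'
  proof -
    have lt: "a < b" if "a div 2 < b div 2" for a b :: nat
      using that div_le_mono[of b a 2] by linarith
    show ?thesis
      using that lt[of x y] lt[of x' y'] lt[of y x] lt[of y' x']
      by (cases "x div 2" "y div 2" rule: linorder_cases) auto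
  qed
  have four: "s (2 * l) (2 * i) * s (2 * l) (2 * i + 1) * (s (2 * l + 1) (2 * i) * s (2 * l + 1) (2 * i + 1)) = 1"
    if "l < M" "i < l" for l i
  proof -
    have d: "\<sigma> (2 * l) div 2 \<noteq> \<sigma> (2 * i) div 2"
      using bij_betw_imp_inj_on[OF pair_preserving_bij[OF \<sigma> pairs]] that
      by (metis inj_onD lessThan_iff less_imp_neq order.strict_trans)
    have e: "\<sigma> (2 * l + 1) div 2 = \<sigma> (2 * l) div 2" "\<sigma> (2 * i + 1) div 2 = \<sigma> (2 * i) div 2"
      using pairs that by auto
    have "s (2 * l) (2 * i + 1) = s (2 * l) (2 * i)" "s (2 * l + 1) (2 * i) = s (2 * l) (2 * i)"
      "s (2 * l + 1) (2 * i + 1) = s (2 * l) (2 * i)"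
      unfolding s_def by (rule sgn_cong; use d e in simp)+
    moreover have "s (2 * l) (2 * i) * s (2 * l) (2 * i) = 1"
      using d by (auto simp: s_def sgn_if)
    ultimately show ?thesis by simp
  qed
  have "rsign \<sigma> = (\<Prod>k<2 * M. \<Prod>j<k. s k j)"
    using sign_eq_prod_sgn[OF \<sigma>] by (simp add: s_def)
  also have "\<dots> = (\<Prod>l<M. (\<Prod>j<2 * l. s (2 * l) j) * (\<Prod>j<2 * l + 1. s (2 * l + 1) j))"
    by (rule prod_pairs)
  also have "\<dots> = (\<Prod>l<M. s (2 * l + 1) (2 * l))"
  proof (rule prod.cong[OF refl])
    fix l assume l: "l \<in> {..<M}"
    have "(\<Prod>j<2 * l + 1. s (2 * l + 1) j) = (\<Prod>j<2 * l. s (2 * l + 1) j) * s (2 * l + 1) (2 * l)"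
      by simp
    then have "(\<Prod>j<2 * l. s (2 * l) j) * (\<Prod>j<2 * l + 1. s (2 * l + 1) j)
          = (\<Prod>i<l. s (2 * l) (2 * i) * s (2 * l) (2 * i + 1) * (s (2 * l + 1) (2 * i) * s (2 * l + 1) (2 * i + 1)))
            * s (2 * l + 1) (2 * l)"
      by (simp only: prod_pairs prod.distrib mult.assoc)
    also have "\<dots> = s (2 * l + 1) (2 * l)"
      using four l by (subst prod.neutral) auto
    finally show "(\<Prod>j<2 * l. s (2 * l) j) * (\<Prod>j<2 * l + 1. s (2 * l + 1) j) = s (2 * l + 1) (2 * l)" .
  qed
  also have "\<dots> = (\<Prod>i<M. pairing (\<sigma> (2 * i)) (\<sigma> (2 * i + 1)))"
    using pairs by (intro prod.cong) (auto simp: pairing_def s_def)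
  finally have "rsign \<sigma> = (\<Prod>i<M. pairing (\<sigma> (2 * i)) (\<sigma> (2 * i + 1)))" .
  moreover have "rsign \<sigma> * rsign \<sigma> = 1"
    by (auto simp: sign_def)
  ultimately show ?thesis by simp
qed

text \<open>A Pfaffian without its usual normalisation. By \<open>sign_pair_preserving\<close> a
  permutation that preserves the pairs contributes 1 and any other 0, so the value is
  \<open>2 ^ M * fact M\<close>.\<close>

definition pairing_sum :: "nat \<Rightarrow> real" where
  "pairing_sum M = (\<Sum>\<sigma> | \<sigma> permutes {..<2 * M}.
     rsign \<sigma> * (\<Prod>i<M. pairing (\<sigma> (2 * i)) (\<sigma> (2 * i + 1))))"

lemma pairing_sum_pos: "pairing_sum M > 0"
  unfolding pairing_sum_def
proof (rule sum_pos2)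
  show "finite {\<sigma>. \<sigma> permutes {..<2 * M}}"
    by (rule finite_permutations) simp
  show "id \<in> {\<sigma>. \<sigma> permutes {..<2 * M}}"
    by (simp add: permutes_id)
  show "0 < rsign id * (\<Prod>i<M. pairing (id (2 * i)) (id (2 * i + 1)))"
    by (subst sign_pair_preserving) (auto simp: permutes_id)
  show "0 \<le> rsign \<sigma> * (\<Prod>i<M. pairing (\<sigma> (2 * i)) (\<sigma> (2 * i + 1)))"
    if "\<sigma> \<in> {\<sigma>. \<sigma> permutes {..<2 * M}}" for \<sigma>
  proof (cases "\<forall>i<M. \<sigma> (2 * i) div 2 = \<sigma> (2 * i + 1) div 2")
    case True
    then show ?thesis using that by (subst sign_pair_preserving) auto
  next
    case False
    then have "(\<Prod>i<M. pairing (\<sigma> (2 * i)) (\<sigma> (2 * i + 1))) = 0"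
      by (auto simp: pairing_def)
    then show ?thesis by (simp del: prod_zero_iff)
  qed
qed

text \<open>The first-order variation of the Pfaffian in the direction \<open>c\<close>. By
  \<open>last_pair_preserved\<close> the surviving permutations are the same as before, and since
  they permute the blocks, every block contributes its entry of \<open>c\<close> exactly
  once.\<close>

lemma pairing_sum_replace_one:
  assumes anti: "\<And>i j. c j i = - c i j"
  shows "(\<Sum>\<sigma> | \<sigma> permutes {..<2 * M}. rsign \<sigma> *
            (\<Sum>k<M. c (\<sigma> (2 * k)) (\<sigma> (2 * k + 1)) *
               (\<Prod>i\<in>{..<M} - {k}. pairing (\<sigma> (2 * i)) (\<sigma> (2 * i + 1)))))
         = pairing_sum M * (\<Sum>a<M. c (2 * a) (2 * a + 1) :: real)"
  unfolding pairing_sum_def sum_distrib_right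
proof (rule sum.cong[OF refl])
  fix \<sigma> assume "\<sigma> \<in> {\<sigma>. \<sigma> permutes {..<2 * M}}"
  then have \<sigma>: "\<sigma> permutes {..<2 * M}" by simp
  let ?b = "\<lambda>i. pairing (\<sigma> (2 * i)) (\<sigma> (2 * i + 1))"
  have inj: "\<sigma> x = \<sigma> y \<longleftrightarrow> x = y" for x y
    using permutes_inj[OF \<sigma>] by (auto simp: inj_def)
  show "rsign \<sigma> * (\<Sum>k<M. c (\<sigma> (2 * k)) (\<sigma> (2 * k + 1)) * (\<Prod>i\<in>{..<M} - {k}. ?b i))
        = rsign \<sigma> * (\<Prod>i<M. ?b i) * (\<Sum>a<M. c (2 * a) (2 * a + 1))"
  proof (cases "\<forall>i<M. \<sigma> (2 * i) div 2 = \<sigma> (2 * i + 1) div 2")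
    case False
    then have "(\<Prod>i<M. ?b i) = 0"
      by (auto simp: pairing_def)
    moreover have "(\<Prod>i\<in>{..<M} - {k}. ?b i) = 0" if "k < M" for k
    proof -
      obtain i where "i < M" "i \<noteq> k" "\<sigma> (2 * i) div 2 \<noteq> \<sigma> (2 * i + 1) div 2"
        using False last_pair_preserved[OF \<sigma> \<open>k < M\<close>] by metis
      then have "?b i = 0" "i \<in> {..<M} - {k}"
        by (simp_all add: pairing_def)
      then show ?thesis by (meson finite_Diff finite_lessThan prod_zero)
    qed
    ultimately show ?thesis by (simp del: prod_zero_iff)
  next
    case True
    define C where "C a = c (2 * a) (2 * a + 1)" for a
    \<comment> \<open>On a single block an antisymmetric \<open>c\<close> is a multiple of
      \<open>pairing\<close>.\<close>
    have c: "c x y = pairing x y * C (x div 2)" if "x div 2 = y div 2" "x \<noteq> y" for x y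
    proof -
      define q where "q = x div 2"
      have ne: "x mod 2 \<noteq> y mod 2"
        using that by (metis div_mult_mod_eq)
      have xy: "x = 2 * q + x mod 2" "y = 2 * q + y mod 2"
        using that(1) mult_div_mod_eq[of 2 x] mult_div_mod_eq[of 2 y] by (simp_all add: q_def)
      have "x mod 2 = 0 \<and> y mod 2 = 1 \<or> x mod 2 = 1 \<and> y mod 2 = 0"
        using ne not_mod_2_eq_1_eq_0[of x] not_mod_2_eq_1_eq_0[of y] by argo
      then consider "x mod 2 = 0" "y mod 2 = 1" | "x mod 2 = 1" "y mod 2 = 0"
        by (elim disjE conjE)
      then show ?thesis
      proof cases
        case 1
        then have "x = 2 * q" "y = 2 * q + 1" using xy by simp_all
        then show ?thesis by (simp add: pairing_def C_def)
      next
        case 2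
        then have "x = 2 * q + 1" "y = 2 * q" using xy by simp_all
        then show ?thesis using anti[of y x] by (simp add: pairing_def C_def)
      qed
    qed
    have "(\<Sum>k<M. c (\<sigma> (2 * k)) (\<sigma> (2 * k + 1)) * (\<Prod>i\<in>{..<M} - {k}. ?b i))
          = (\<Sum>k<M. (\<Prod>i<M. ?b i) * C (\<sigma> (2 * k) div 2))"
    proof (rule sum.cong[OF refl])
      fix k assume k: "k \<in> {..<M}"
      then have "c (\<sigma> (2 * k)) (\<sigma> (2 * k + 1)) = ?b k * C (\<sigma> (2 * k) div 2)"
        using True inj by (intro c) auto
      then show "c (\<sigma> (2 * k)) (\<sigma> (2 * k + 1)) * (\<Prod>i\<in>{..<M} - {k}. ?b i)
                 = (\<Prod>i<M. ?b i) * C (\<sigma> (2 * k) div 2)"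
        using k by (simp add: prod.remove[of "{..<M}" k])
    qed
    also have "\<dots> = (\<Prod>i<M. ?b i) * (\<Sum>a<M. C a)"
      unfolding sum_distrib_left[symmetric]
      using sum.reindex_bij_betw[OF pair_preserving_bij[OF \<sigma>], of C] True by simp
    finally show ?thesis by (simp add: C_def)
  qed
qed

text \<open>For odd \<open>N\<close> the last variable is unpaired, and the last index \<open>2 * M\<close> is the only one with
  \<open>u k \<noteq> 0\<close> and is skew-orthogonal to all the others; hence only permutations fixing it survive.\<close>

lemma pairing_sum_with_unpaired:
  assumes N: "2 * M \<le> N" "N \<le> 2 * M + 1"
    and b: "\<And>i j. i < N \<Longrightarrow> j < N \<Longrightarrow> b i j = pairing i j"
    and u: "\<And>k. 2 * M < N \<Longrightarrow> k < N \<Longrightarrow> u k = (if k = 2 * M then 1 else 0)"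
    and anti: "\<And>i j. c j i = - c i j"
  shows "(\<Sum>\<sigma> | \<sigma> permutes {..<N}. rsign \<sigma> *
            ((\<Sum>k<M. c (\<sigma> (2 * k)) (\<sigma> (2 * k + 1)) *
               (\<Prod>i\<in>{..<M} - {k}. b (\<sigma> (2 * i)) (\<sigma> (2 * i + 1)))) * (\<Prod>j\<in>{2 * M..<N}. u (\<sigma> j))
             + (\<Prod>i<M. b (\<sigma> (2 * i)) (\<sigma> (2 * i + 1))) * (\<Sum>j\<in>{2 * M..<N}. v (\<sigma> j))))
         = pairing_sum M * ((\<Sum>a<M. c (2 * a) (2 * a + 1)) + (\<Sum>j\<in>{2 * M..<N}. v j) :: real)"
    (is "sum ?F _ = _")
proof -
  have img: "\<sigma> i < N \<longleftrightarrow> i < N" if "\<sigma> permutes {..<N}" for \<sigma> i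
    using permutes_in_image[OF that, of i] by simp
  have "sum ?F {\<sigma>. \<sigma> permutes {..<N}} = sum ?F {\<sigma>. \<sigma> permutes {..<2 * M}}"
  proof (rule sum.mono_neutral_right)
    show "finite {\<sigma>. \<sigma> permutes {..<N}}" by (rule finite_permutations) simp
    show "{\<sigma>. \<sigma> permutes {..<2 * M}} \<subseteq> {\<sigma>. \<sigma> permutes {..<N}}"
      using N(1) by (auto intro: permutes_subset)
    show "\<forall>\<sigma>\<in>{\<sigma>. \<sigma> permutes {..<N}} - {\<sigma>. \<sigma> permutes {..<2 * M}}. ?F \<sigma> = 0"
    proof
      fix \<sigma> assume \<sigma>: "\<sigma> \<in> {\<sigma>. \<sigma> permutes {..<N}} - {\<sigma>. \<sigma> permutes {..<2 * M}}"
      then have Neq: "N = 2 * M + 1" using N by (cases "N = 2 * M") auto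
      have p: "\<sigma> permutes {..<N}" using \<sigma> by simp
      have ne: "\<sigma> (2 * M) \<noteq> 2 * M"
      proof
        assume "\<sigma> (2 * M) = 2 * M"
        then have "\<sigma> permutes {..<2 * M}"
          by (intro permutes_superset[OF p]) (auto simp: Neq)
        with \<sigma> show False by simp
      qed
      have "u (\<sigma> (2 * M)) = 0"
        using ne u img[OF p, of "2 * M"] Neq by simp
      moreover have "(\<Prod>i<M. b (\<sigma> (2 * i)) (\<sigma> (2 * i + 1))) = 0"
      proof -
        \<comment> \<open>The index \<open>2 * M\<close> has landed in a pair. It is the only index
          below \<open>N\<close> in its block, so the pairing of that pair vanishes.\<close>
        obtain x where x: "\<sigma> x = 2 * M" using permutes_surj[OF p] by (metis surjD)
        then have "x < 2 * M"
          using img[OF p, of x] ne Neq by (cases "x = 2 * M") auto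
        define i where "i = x div 2"
        have i: "i < M" "x = 2 * i \<or> x = 2 * i + 1" using \<open>x < 2 * M\<close> by (auto simp: i_def)
        have inj: "\<sigma> x = \<sigma> y \<longleftrightarrow> x = y" for x y
          using permutes_inj[OF p] by (auto simp: inj_def)
        have lt: "\<sigma> (2 * i) < 2 * M + 1" "\<sigma> (2 * i + 1) < 2 * M + 1"
          using i img[OF p, of "2 * i"] img[OF p, of "2 * i + 1"] Neq by auto
        have "\<sigma> (2 * i) \<noteq> \<sigma> (2 * i + 1)" using inj by simp
        then have "\<sigma> (2 * i) div 2 \<noteq> \<sigma> (2 * i + 1) div 2"
          using i(2) x lt by auto
        then have "b (\<sigma> (2 * i)) (\<sigma> (2 * i + 1)) = 0"
          using lt b Neq by (simp add: pairing_def)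
        then show ?thesis using i by auto
      qed
      ultimately show "?F \<sigma> = 0" by (simp add: Neq)
    qed
  qed
  also have "\<dots> = (\<Sum>\<sigma> | \<sigma> permutes {..<2 * M}.
      rsign \<sigma> * (\<Sum>k<M. c (\<sigma> (2 * k)) (\<sigma> (2 * k + 1)) *
               (\<Prod>i\<in>{..<M} - {k}. pairing (\<sigma> (2 * i)) (\<sigma> (2 * i + 1))))
      + rsign \<sigma> * (\<Prod>i<M. pairing (\<sigma> (2 * i)) (\<sigma> (2 * i + 1))) * (\<Sum>j\<in>{2 * M..<N}. v j))"
  proof (rule sum.cong[OF refl])
    fix \<sigma> assume "\<sigma> \<in> {\<sigma>. \<sigma> permutes {..<2 * M}}"
    then have p: "\<sigma> permutes {..<2 * M}" by simp
    have fixed: "\<sigma> j = j" if "j \<in> {2 * M..<N}" for j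
      using that p by (auto simp: permutes_def)
    have lt: "\<sigma> i < N" if "i < 2 * M" for i
      using that permutes_in_image[OF p, of i] N by auto
    have "(\<Prod>j\<in>{2 * M..<N}. u (\<sigma> j)) = 1"
      using fixed u N by (intro prod.neutral) auto
    moreover have "b (\<sigma> (2 * i)) (\<sigma> (2 * i + 1)) = pairing (\<sigma> (2 * i)) (\<sigma> (2 * i + 1))" if "i < M" for i
      using that by (intro b lt) auto
    moreover have "(\<Sum>j\<in>{2 * M..<N}. v (\<sigma> j)) = (\<Sum>j\<in>{2 * M..<N}. v j)"
      using fixed by (intro sum.cong) auto
    ultimately show "?F \<sigma> = rsign \<sigma> * (\<Sum>k<M. c (\<sigma> (2 * k)) (\<sigma> (2 * k + 1)) *
               (\<Prod>i\<in>{..<M} - {k}. pairing (\<sigma> (2 * i)) (\<sigma> (2 * i + 1))))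
      + rsign \<sigma> * (\<Prod>i<M. pairing (\<sigma> (2 * i)) (\<sigma> (2 * i + 1))) * (\<Sum>j\<in>{2 * M..<N}. v j)"
      by (simp add: distrib_left mult.assoc)
  qed
  also have "\<dots> = pairing_sum M * (\<Sum>a<M. c (2 * a) (2 * a + 1)) + pairing_sum M * (\<Sum>j\<in>{2 * M..<N}. v j)"
    unfolding sum.distrib pairing_sum_replace_one[of c M, OF anti]
    by (simp only: pairing_sum_def sum_distrib_right[of _ _ "sum v _"])
  finally show ?thesis by (simp add: distrib_left)
qed

section \<open>Lebesgue measure on functions and paired products\<close>

interpretation lebesgue_product: product_sigma_finite "\<lambda>_::nat. lborel :: real measure"
  by standard

abbreviation lebN :: "nat set \<Rightarrow> (nat \<Rightarrow> real) measure" where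
  "lebN I \<equiv> Pi\<^sub>M I (\<lambda>_. lborel)"

text \<open>Serves both the permutations of coordinates in the antisymmetrization and the shift of
  the index set from \<open>{..<N}\<close> to \<open>{1..N}\<close>.\<close>

lemma lebN_reindex:
  assumes "finite I" "finite J" "bij_betw \<pi> I J"
  shows "distr (lebN J) (lebN I) (\<lambda>y. \<lambda>i\<in>I. y (\<pi> i)) = lebN I"
proof (rule lebesgue_product.PiM_eqI)
  have \<pi>: "\<pi> i \<in> J" if "i \<in> I" for i
    using assms(3) that by (auto simp: bij_betw_def)
  have meas: "(\<lambda>y. \<lambda>i\<in>I. y (\<pi> i)) \<in> lebN J \<rightarrow>\<^sub>M lebN I"
    using \<pi> by (intro measurable_restrict measurable_component_singleton) auto
  fix A assume A: "\<And>i. i \<in> I \<Longrightarrow> A i \<in> sets (lborel :: real measure)"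
  define \<rho> where "\<rho> = inv_into I \<pi>"
  have \<rho>: "bij_betw \<rho> J I" and \<rho>\<pi>: "\<And>i. i \<in> I \<Longrightarrow> \<rho> (\<pi> i) = i"
    unfolding \<rho>_def using bij_betw_inv_into[OF assms(3)] assms(3) by (auto simp: bij_betw_def)
  have \<rho>I: "\<rho> j \<in> I" "\<pi> (\<rho> j) = j" if "j \<in> J" for j
    using that \<rho> assms(3) bij_betw_inv_into_right[OF assms(3) that] by (auto simp: bij_betw_def \<rho>_def)
  have "(\<lambda>y. \<lambda>i\<in>I. y (\<pi> i)) -` Pi\<^sub>E I A \<inter> space (lebN J) = Pi\<^sub>E J (A \<circ> \<rho>)"
  proof (intro equalityI subsetI)
    fix y assume "y \<in> (\<lambda>y. \<lambda>i\<in>I. y (\<pi> i)) -` Pi\<^sub>E I A \<inter> space (lebN J)"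
    then have y: "\<And>i. i \<in> I \<Longrightarrow> y (\<pi> i) \<in> A i" "y \<in> extensional J"
      by (auto simp: space_PiM PiE_iff)
    show "y \<in> Pi\<^sub>E J (A \<circ> \<rho>)"
      using y(1)[OF \<rho>I(1)] y(2) by (auto simp: PiE_iff \<rho>I(2))
  next
    fix y assume "y \<in> Pi\<^sub>E J (A \<circ> \<rho>)"
    then show "y \<in> (\<lambda>y. \<lambda>i\<in>I. y (\<pi> i)) -` Pi\<^sub>E I A \<inter> space (lebN J)"
      using \<pi> \<rho>\<pi> by (fastforce simp: space_PiM PiE_iff)
  qed
  then have "emeasure (distr (lebN J) (lebN I) (\<lambda>y. \<lambda>i\<in>I. y (\<pi> i))) (Pi\<^sub>E I A)
             = emeasure (lebN J) (Pi\<^sub>E J (A \<circ> \<rho>))"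
    using A assms by (subst emeasure_distr[OF meas]) (auto intro!: sets_PiM_I_finite)
  also have "\<dots> = (\<Prod>j\<in>J. emeasure lborel (A (\<rho> j)))"
    using A assms \<rho>I by (subst lebesgue_product.emeasure_PiM) auto
  also have "\<dots> = (\<Prod>i\<in>I. emeasure lborel (A i))"
    by (rule prod.reindex_bij_betw[OF \<rho>])
  finally show "emeasure (distr (lebN J) (lebN I) (\<lambda>y. \<lambda>i\<in>I. y (\<pi> i))) (Pi\<^sub>E I A)
             = (\<Prod>i\<in>I. emeasure lborel (A i))" .
qed (use assms in auto)

lemma
  fixes f :: "(nat \<Rightarrow> real) \<Rightarrow> real"
  assumes "finite I" "finite J" "bij_betw \<pi> I J"
  shows integral_lebN_reindex:
      "f \<in> borel_measurable (lebN I) \<Longrightarrow> (\<integral>y. f (\<lambda>i\<in>I. y (\<pi> i)) \<partial>lebN J) = (\<integral>y. f y \<partial>lebN I)"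
    and integrable_lebN_reindex:
      "integrable (lebN I) f \<Longrightarrow> integrable (lebN J) (\<lambda>y. f (\<lambda>i\<in>I. y (\<pi> i)))"
proof -
  have meas: "(\<lambda>y. \<lambda>i\<in>I. y (\<pi> i)) \<in> lebN J \<rightarrow>\<^sub>M lebN I"
    using assms by (intro measurable_restrict measurable_component_singleton) (auto simp: bij_betw_def)
  show "(\<integral>y. f (\<lambda>i\<in>I. y (\<pi> i)) \<partial>lebN J) = (\<integral>y. f y \<partial>lebN I)" if "f \<in> borel_measurable (lebN I)"
    using integral_distr[OF meas that] lebN_reindex[OF assms] by simp
  show "integrable (lebN J) (\<lambda>y. f (\<lambda>i\<in>I. y (\<pi> i)))" if "integrable (lebN I) f"
    using integrable_distr[OF meas, of f] lebN_reindex[OF assms] that by simp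
qed

lemma lebN_scale:
  assumes "finite I" "c \<noteq> 0"
  shows "lebN I = density (distr (lebN I) (lebN I) (\<lambda>y. \<lambda>i\<in>I. c * y i)) (\<lambda>_. ennreal \<bar>c\<bar> ^ card I)"
proof (rule lebesgue_product.PiM_eqI[symmetric])
  have meas: "(\<lambda>y. \<lambda>i\<in>I. c * y i) \<in> lebN I \<rightarrow>\<^sub>M lebN I"
    by (intro measurable_restrict) measurable
  fix A assume A: "\<And>i. i \<in> I \<Longrightarrow> A i \<in> sets (lborel :: real measure)"
  have 1: "emeasure lborel B = ennreal \<bar>c\<bar> * emeasure lborel ((\<lambda>x. c * x) -` B)" if "B \<in> sets (lborel :: real measure)" for B
  proof -
    have "emeasure lborel B = emeasure (density (distr lborel borel (\<lambda>x. 0 + c * x)) (\<lambda>_. ennreal \<bar>c\<bar>)) B"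
      using lborel_real_affine[of c 0] assms by simp
    also have "\<dots> = ennreal \<bar>c\<bar> * emeasure lborel ((\<lambda>x. c * x) -` B)"
      using that assms by (subst emeasure_density) (auto simp: nn_integral_cmult emeasure_distr)
    finally show ?thesis .
  qed
  have "(\<lambda>y. \<lambda>i\<in>I. c * y i) -` Pi\<^sub>E I A \<inter> space (lebN I) = Pi\<^sub>E I (\<lambda>i. (\<lambda>x. c * x) -` A i)"
    by (auto simp: space_PiM PiE_iff)
  moreover have "(\<lambda>x. c * x) -` A i \<in> sets lborel" if "i \<in> I" for i
    using measurable_sets_borel[of "\<lambda>x. c * x" borel "A i"] A[OF that] by simp
  ultimately have "emeasure (distr (lebN I) (lebN I) (\<lambda>y. \<lambda>i\<in>I. c * y i)) (Pi\<^sub>E I A)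
                 = (\<Prod>i\<in>I. emeasure lborel ((\<lambda>x. c * x) -` A i))"
    using A assms by (subst emeasure_distr[OF meas]) (auto intro!: sets_PiM_I_finite simp: lebesgue_product.emeasure_PiM)
  then show "emeasure (density (distr (lebN I) (lebN I) (\<lambda>y. \<lambda>i\<in>I. c * y i)) (\<lambda>_. ennreal \<bar>c\<bar> ^ card I)) (Pi\<^sub>E I A)
             = (\<Prod>i\<in>I. emeasure lborel (A i))"
    using A assms 1
    by (subst emeasure_density) (auto intro!: sets_PiM_I_finite simp: nn_integral_cmult prod.distrib)
qed (use assms in auto)

lemma integral_lebN_scale:
  fixes f :: "(nat \<Rightarrow> real) \<Rightarrow> 'a :: {banach, second_countable_topology}"
  assumes "finite I" "c \<noteq> 0" "f \<in> borel_measurable (lebN I)"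
  shows "(\<integral>y. f y \<partial>lebN I) = \<bar>c\<bar> ^ card I *\<^sub>R (\<integral>y. f (\<lambda>i\<in>I. c * y i) \<partial>lebN I)"
proof -
  have meas: "(\<lambda>y. \<lambda>i\<in>I. c * y i) \<in> lebN I \<rightarrow>\<^sub>M lebN I"
    by (intro measurable_restrict) measurable
  have "(\<integral>y. f y \<partial>lebN I)
        = (\<integral>y. f y \<partial>density (distr (lebN I) (lebN I) (\<lambda>y. \<lambda>i\<in>I. c * y i)) (\<lambda>_. ennreal (\<bar>c\<bar> ^ card I)))"
    using lebN_scale[OF assms(1,2)] assms by (simp add: ennreal_power)
  also have "\<dots> = (\<integral>y. \<bar>c\<bar> ^ card I *\<^sub>R f y \<partial>distr (lebN I) (lebN I) (\<lambda>y. \<lambda>i\<in>I. c * y i))"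
    using assms by (subst integral_density) auto
  also have "\<dots> = (\<integral>y. \<bar>c\<bar> ^ card I *\<^sub>R f (\<lambda>i\<in>I. c * y i) \<partial>lebN I)"
    using assms by (subst integral_distr[OF meas]) auto
  finally show ?thesis by simp
qed

section \<open>The skew form and the integration of paired products\<close>

definition skew :: "(real \<Rightarrow> real) \<Rightarrow> (real \<Rightarrow> real) \<Rightarrow> real" where
  "skew f g = (LBINT s. f s * (LBINT t. g t * sgn (t - s)))"

lemma abs_skew_inner_le:
  fixes g :: "real \<Rightarrow> real"
  assumes "integrable lborel g"
  shows "\<bar>LBINT t. g t * sgn (t - s)\<bar> \<le> (LBINT t. \<bar>g t\<bar>)"
proof -
  have [measurable]: "g \<in> borel_measurable borel" using assms by auto
  have "integrable lborel (\<lambda>t. g t * sgn (t - s))"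
    by (rule Bochner_Integration.integrable_bound[OF assms]) (auto simp: abs_mult sgn_if)
  then have "\<bar>LBINT t. g t * sgn (t - s)\<bar> \<le> (LBINT t. \<bar>g t * sgn (t - s)\<bar>)"
    using integral_abs_bound by blast
  also have "\<dots> \<le> (LBINT t. \<bar>g t\<bar>)"
  proof (rule integral_mono)
    show "integrable lborel (\<lambda>t. \<bar>g t * sgn (t - s)\<bar>)"
      by (rule Bochner_Integration.integrable_bound[OF assms]) (auto simp: abs_mult sgn_if)
  qed (use assms in \<open>auto simp: abs_mult sgn_if\<close>)
  finally show ?thesis .
qed

lemma integrable_skew:
  fixes f g :: "real \<Rightarrow> real"
  assumes f: "integrable lborel f" and g: "integrable lborel g"
  shows "integrable lborel (\<lambda>s. f s * (LBINT t. g t * sgn (t - s)))"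
proof (rule Bochner_Integration.integrable_bound)
  show "integrable lborel (\<lambda>s. f s * (LBINT t. \<bar>g t\<bar>))"
    using f by simp
  show "(\<lambda>s. f s * (LBINT t. g t * sgn (t - s))) \<in> borel_measurable lborel"
    using f g by measurable
  show "AE s in lborel. norm (f s * (LBINT t. g t * sgn (t - s))) \<le> norm (f s * (LBINT t. \<bar>g t\<bar>))"
    using abs_skew_inner_le[OF g] by (auto simp: abs_mult intro!: AE_I2 mult_left_mono)
qed

lemma skew_antisym:
  fixes f g :: "real \<Rightarrow> real"
  assumes f: "integrable lborel f" and g: "integrable lborel g"
  shows "skew g f = - skew f g"
proof -
  have [measurable]: "f \<in> borel_measurable borel" "g \<in> borel_measurable borel" using f g by auto
  have int: "integrable (lborel \<Otimes>\<^sub>M lborel) (\<lambda>(s, t). f s * g t * sgn (t - s))"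
  proof (rule Bochner_Integration.integrable_bound)
    show "integrable (lborel \<Otimes>\<^sub>M lborel) (\<lambda>(s, t). f s * g t)"
    proof (rule lborel_pair.Fubini_integrable)
      have "(\<lambda>x. LINT y|lborel. norm (case (x, y) of (s, t) \<Rightarrow> f s * g t)) = (\<lambda>x. \<bar>f x\<bar> * (LINT y|lborel. \<bar>g y\<bar>))"
        by (auto simp: abs_mult)
      then show "integrable lborel (\<lambda>x. LINT y|lborel. norm (case (x, y) of (s, t) \<Rightarrow> f s * g t))"
        using f by simp
    qed (use f g in auto)
    show "(\<lambda>(s, t). f s * g t * sgn (t - s)) \<in> borel_measurable (lborel \<Otimes>\<^sub>M lborel)"
      by measurable
    show "AE p in lborel \<Otimes>\<^sub>M lborel. norm (case p of (s, t) \<Rightarrow> f s * g t * sgn (t - s))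
            \<le> norm (case p of (s, t) \<Rightarrow> f s * g t)"
      by (auto simp: abs_mult sgn_if)
  qed
  have "skew f g = (LBINT s. (LBINT t. f s * g t * sgn (t - s)))"
    unfolding skew_def by (simp add: mult.assoc)
  also have "\<dots> = (LBINT t. (LBINT s. f s * g t * sgn (t - s)))"
    using lborel_pair.Fubini_integral[OF int] by simp
  also have "\<dots> = (LBINT t. - (g t * (LBINT s. f s * sgn (s - t))))"
  proof (rule Bochner_Integration.integral_cong[OF refl])
    fix t
    have "(LBINT s. f s * g t * sgn (t - s)) = (LBINT s. (- g t) * (f s * sgn (s - t)))"
      by (rule Bochner_Integration.integral_cong) (auto simp: sgn_if)
    also have "\<dots> = - (g t * (LBINT s. f s * sgn (s - t)))"
      by (subst integral_mult_right_zero) simp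
    finally show "(LBINT s. f s * g t * sgn (t - s)) = - (g t * (LBINT s. f s * sgn (s - t)))" .
  qed
  also have "\<dots> = - skew g f"
    unfolding skew_def by simp
  finally show ?thesis by simp
qed

definition paired_prod :: "nat \<Rightarrow> nat \<Rightarrow> (nat \<Rightarrow> real \<Rightarrow> real) \<Rightarrow> (nat \<Rightarrow> real) \<Rightarrow> real" where
  "paired_prod M N w y = (\<Prod>j<N. w j (y j)) * pair_sgn M y"

lemma abs_pair_sgn_le: "\<bar>pair_sgn M y\<bar> \<le> 1"
  unfolding pair_sgn_def abs_prod by (intro prod_le_1) (auto simp: sgn_if)

lemma pair_sgn_measurable:
  "2 * M \<le> N \<Longrightarrow> pair_sgn M \<in> borel_measurable (lebN {..<N})"
  unfolding pair_sgn_def[abs_def]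
  by (intro borel_measurable_prod borel_measurable_sgn borel_measurable_diff)
     (auto intro!: measurable_component_singleton)

lemma integrable_paired_prod:
  assumes "2 * M \<le> N" "\<And>j. j < N \<Longrightarrow> integrable lborel (w j)"
  shows "integrable (lebN {..<N}) (paired_prod M N w)"
proof (rule Bochner_Integration.integrable_bound)
  show int: "integrable (lebN {..<N}) (\<lambda>y. \<Prod>j<N. w j (y j))"
    using assms by (intro lebesgue_product.product_integrable_prod) auto
  show "paired_prod M N w \<in> borel_measurable (lebN {..<N})"
    unfolding paired_prod_def[abs_def]
    using borel_measurable_integrable[OF int] pair_sgn_measurable[OF assms(1)]
    by (rule borel_measurable_times)
  show "AE y in lebN {..<N}. norm (paired_prod M N w y) \<le> norm (\<Prod>j<N. w j (y j))"
    using abs_pair_sgn_le by (auto simp: paired_prod_def abs_mult intro!: mult_left_le)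
qed

lemma pair_sgn_upd: "2 * M \<le> n \<Longrightarrow> pair_sgn M (y(n := t)) = pair_sgn M y"
  unfolding pair_sgn_def by (intro prod.cong) auto

lemma integral_paired_prod_unpaired:
  assumes "2 * M \<le> n" "\<And>j. j < Suc n \<Longrightarrow> integrable lborel (w j)"
  shows "(\<integral>y. paired_prod M (Suc n) w y \<partial>lebN {..<Suc n})
         = (\<integral>y. paired_prod M n w y \<partial>lebN {..<n}) * (LBINT t. w n t)"
proof -
  have "(\<integral>y. paired_prod M (Suc n) w y \<partial>lebN {..<Suc n})
        = (\<integral>y. (LBINT t. paired_prod M (Suc n) w (y(n := t))) \<partial>lebN {..<n})"
    using lebesgue_product.product_integral_insert[of "{..<n}" n "paired_prod M (Suc n) w"]
      integrable_paired_prod[of M "Suc n" w] assms by (simp add: lessThan_Suc)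
  also have "\<dots> = (\<integral>y. paired_prod M n w y * (LBINT t. w n t) \<partial>lebN {..<n})"
  proof (rule Bochner_Integration.integral_cong[OF refl])
    fix y
    have "paired_prod M (Suc n) w (y(n := t)) = paired_prod M n w y * w n t" for t
      using assms(1) by (simp add: paired_prod_def pair_sgn_upd)
    then show "(LBINT t. paired_prod M (Suc n) w (y(n := t))) = paired_prod M n w y * (LBINT t. w n t)"
      by simp
  qed
  finally show ?thesis by simp
qed

lemma integral_paired_prod_paired:
  assumes "\<And>j. j < 2 * M + 2 \<Longrightarrow> integrable lborel (w j)"
  shows "(\<integral>y. paired_prod (Suc M) (2 * M + 2) w y \<partial>lebN {..<2 * M + 2})
         = (\<integral>y. paired_prod M (2 * M) w y \<partial>lebN {..<2 * M}) * skew (w (2 * M)) (w (2 * M + 1))"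
proof -
  define T where "T s = (LBINT t. w (2 * M + 1) t * sgn (t - s))" for s
  \<comment> \<open>Integrating out the second variable of the last pair multiplies the weight of
    the first one by \<open>T\<close>. With this modified weight the first variable counts as
    unpaired, and the iterated integral is \<open>skew\<close> exactly as it was defined.\<close>
  define w' where "w' = w(2 * M := \<lambda>s. w (2 * M) s * T s)"
  have int: "integrable lborel (\<lambda>s. w (2 * M) s * T s)"
    unfolding T_def using assms by (intro integrable_skew) auto
  have "(\<integral>y. paired_prod (Suc M) (2 * M + 2) w y \<partial>lebN {..<2 * M + 2})
        = (\<integral>y. (LBINT t. paired_prod (Suc M) (2 * M + 2) w (y(2 * M + 1 := t))) \<partial>lebN {..<2 * M + 1})"
    using lebesgue_product.product_integral_insert[of "{..<2 * M + 1}" "2 * M + 1" "paired_prod (Suc M) (2 * M + 2) w"]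
      integrable_paired_prod[of "Suc M" "2 * M + 2" w] assms by (simp add: lessThan_Suc)
  also have "\<dots> = (\<integral>y. paired_prod M (2 * M + 1) w' y \<partial>lebN {..<2 * M + 1})"
  proof (rule Bochner_Integration.integral_cong[OF refl])
    fix y :: "nat \<Rightarrow> real"
    have "paired_prod (Suc M) (2 * M + 2) w (y(2 * M + 1 := t))
          = (\<Prod>j<2 * M. w j (y j)) * pair_sgn M y * w (2 * M) (y (2 * M))
            * (w (2 * M + 1) t * sgn (t - y (2 * M)))" for t
      using pair_sgn_upd[of M "2 * M + 1" y t]
      by (simp add: paired_prod_def pair_sgn_def mult_ac)
    then have "(LBINT t. paired_prod (Suc M) (2 * M + 2) w (y(2 * M + 1 := t)))
          = (\<Prod>j<2 * M. w j (y j)) * pair_sgn M y * w (2 * M) (y (2 * M)) * T (y (2 * M))"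
      by (simp add: T_def)
    also have "\<dots> = paired_prod M (2 * M + 1) w' y"
      by (simp add: paired_prod_def w'_def)
    finally show "(LBINT t. paired_prod (Suc M) (2 * M + 2) w (y(2 * M + 1 := t)))
          = paired_prod M (2 * M + 1) w' y" .
  qed
  also have "\<dots> = (\<integral>y. paired_prod M (2 * M) w' y \<partial>lebN {..<2 * M}) * (LBINT t. w' (2 * M) t)"
    using integral_paired_prod_unpaired[of M "2 * M" w'] assms int by (simp add: w'_def)
  also have "paired_prod M (2 * M) w' = paired_prod M (2 * M) w"
    by (simp add: paired_prod_def w'_def fun_eq_iff)
  also have "(LBINT t. w' (2 * M) t) = skew (w (2 * M)) (w (2 * M + 1))"
    by (simp add: w'_def T_def skew_def)
  finally show ?thesis .
qed

lemma integral_paired_prod: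
  assumes "2 * M \<le> N" "\<And>j. j < N \<Longrightarrow> integrable lborel (w j)"
  shows "(\<integral>y. paired_prod M N w y \<partial>lebN {..<N})
         = (\<Prod>i<M. skew (w (2 * i)) (w (2 * i + 1))) * (\<Prod>j\<in>{2 * M..<N}. LBINT t. w j t)"
  using assms
proof (induction N rule: dec_induct)
  case base
  have "(\<integral>y. paired_prod M (2 * M) w y \<partial>lebN {..<2 * M}) = (\<Prod>i<M. skew (w (2 * i)) (w (2 * i + 1)))"
    using base
  proof (induction M)
    case 0
    then show ?case
      by (simp add: paired_prod_def pair_sgn_def PiM_empty lebesgue_integral_count_space_finite)
  next
    case (Suc M)
    have "(\<integral>y. paired_prod (Suc M) (2 * M + 2) w y \<partial>lebN {..<2 * M + 2})
         = (\<integral>y. paired_prod M (2 * M) w y \<partial>lebN {..<2 * M}) * skew (w (2 * M)) (w (2 * M + 1))"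
      using Suc.prems by (intro integral_paired_prod_paired) auto
    then show ?case using Suc by simp
  qed
  then show ?case by simp
next
  case (step n)
  then show ?case
    by (subst integral_paired_prod_unpaired) auto
qed

section \<open>Linear statistics of the eigenvalue law\<close>

lemma sum_pairs: "(\<Sum>j<2 * M. f j) = (\<Sum>i<M. f (2 * i) + f (2 * i + 1 :: nat) :: real)"
  by (induction M) auto

text \<open>Expanding the alternant over permutations \<sigma> and the statistic over the slot
  \<open>k\<close> that carries \<open>h\<close> gives products with the weights
  \<open>w \<sigma> k\<close>, which integrate factor by factor. Only the factor containing slot
  \<open>k\<close> differs from a skew product of basis functions.\<close>

lemma
  fixes e :: "nat \<Rightarrow> real \<Rightarrow> real" and h :: "real \<Rightarrow> real"
  assumes N: "2 * M \<le> N" "N \<le> 2 * M + 1"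
    and e: "\<And>i. i < N \<Longrightarrow> integrable lborel (e i)"
    and he: "\<And>i. i < N \<Longrightarrow> integrable lborel (\<lambda>t. h t * e i t)"
    and sk: "\<And>i j. i < N \<Longrightarrow> j < N \<Longrightarrow> skew (e i) (e j) = pairing i j"
    and u: "\<And>k. 2 * M < N \<Longrightarrow> k < N \<Longrightarrow> (LBINT t. e k t) = (if k = 2 * M then 1 else 0)"
  defines "F \<equiv> \<lambda>y. (\<Sum>j<N. h (y j)) * alternant N e y * pair_sgn M y"
  defines "c \<equiv> \<lambda>i j. skew (\<lambda>t. h t * e i t) (e j) - skew (\<lambda>t. h t * e j t) (e i)"
  shows integrable_alternant_pair_sgn: "integrable (lebN {..<N}) F"
    and integral_alternant_pair_sgn: "(\<integral>y. F y \<partial>lebN {..<N})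
      = pairing_sum M * ((\<Sum>a<M. c (2 * a) (2 * a + 1)) + (\<Sum>j\<in>{2 * M..<N}. LBINT t. h t * e j t))"
proof -
  define w where "w \<sigma> k = (\<lambda>j. if j = k then (\<lambda>t. h t * e (\<sigma> j) t) else e (\<sigma> j))" for \<sigma> and k :: nat
  have perm: "\<sigma> j < N" if "\<sigma> permutes {..<N}" "j < N" for \<sigma> j
    using permutes_in_image[OF that(1), of j] that(2) by simp
  have F: "F = (\<lambda>y. \<Sum>\<sigma> | \<sigma> permutes {..<N}. \<Sum>k<N. rsign \<sigma> * paired_prod M N (w \<sigma> k) y)"
  proof
    fix y
    have "(\<Prod>j<N. w \<sigma> k j (y j)) = h (y k) * (\<Prod>j<N. e (\<sigma> j) (y j))" if "k < N" for \<sigma> k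
      using that by (simp add: prod.remove[of "{..<N}" k] w_def)
    then show "F y = (\<Sum>\<sigma> | \<sigma> permutes {..<N}. \<Sum>k<N. rsign \<sigma> * paired_prod M N (w \<sigma> k) y)"
      by (simp add: F_def alternant_def paired_prod_def sum_distrib_left sum_distrib_right mult_ac)
  qed
  have int_w: "integrable lborel (w \<sigma> k j)" if "\<sigma> permutes {..<N}" "j < N" for \<sigma> k j
    using perm[OF that] e he by (auto simp: w_def)
  have int: "integrable (lebN {..<N}) (paired_prod M N (w \<sigma> k))" if "\<sigma> permutes {..<N}" for \<sigma> k
    using int_w[OF that] N by (intro integrable_paired_prod) auto
  show "integrable (lebN {..<N}) F"
    unfolding F using int by (intro Bochner_Integration.integrable_sum integrable_mult_right) auto
  define b where "b i j = skew (e i) (e j)" for i j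
  define U where "U k = (LBINT t. e k t)" for k
  define V where "V k = (LBINT t. h t * e k t)" for k
  have "(\<integral>y. F y \<partial>lebN {..<N})
        = (\<Sum>\<sigma> | \<sigma> permutes {..<N}. rsign \<sigma> * (\<Sum>k<N. \<integral>y. paired_prod M N (w \<sigma> k) y \<partial>lebN {..<N}))"
    unfolding F using int by (simp add: sum_distrib_left)
  also have "\<dots> = (\<Sum>\<sigma> | \<sigma> permutes {..<N}. rsign \<sigma> *
            ((\<Sum>k<M. c (\<sigma> (2 * k)) (\<sigma> (2 * k + 1)) *
               (\<Prod>i\<in>{..<M} - {k}. b (\<sigma> (2 * i)) (\<sigma> (2 * i + 1)))) * (\<Prod>j\<in>{2 * M..<N}. U (\<sigma> j))
             + (\<Prod>i<M. b (\<sigma> (2 * i)) (\<sigma> (2 * i + 1))) * (\<Sum>j\<in>{2 * M..<N}. V (\<sigma> j))))"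
  proof (rule sum.cong[OF refl])
    fix \<sigma> assume "\<sigma> \<in> {\<sigma>. \<sigma> permutes {..<N}}"
    then have \<sigma>: "\<sigma> permutes {..<N}" by simp
    let ?B = "\<lambda>i. b (\<sigma> (2 * i)) (\<sigma> (2 * i + 1))"
    define I where "I k = (\<integral>y. paired_prod M N (w \<sigma> k) y \<partial>lebN {..<N})" for k
    have I: "I k = (\<Prod>i<M. skew (w \<sigma> k (2 * i)) (w \<sigma> k (2 * i + 1)))
                 * (\<Prod>j\<in>{2 * M..<N}. LBINT t. w \<sigma> k j t)" for k
      unfolding I_def using int_w[OF \<sigma>] N by (intro integral_paired_prod) auto
    have pair: "I (2 * k) + I (2 * k + 1)
        = c (\<sigma> (2 * k)) (\<sigma> (2 * k + 1)) * (\<Prod>i\<in>{..<M} - {k}. ?B i) * (\<Prod>j\<in>{2 * M..<N}. U (\<sigma> j))"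
      if "k < M" for k
    proof -
      have tail: "(\<Prod>j\<in>{2 * M..<N}. LBINT t. w \<sigma> l j t) = (\<Prod>j\<in>{2 * M..<N}. U (\<sigma> j))"
        if "l < 2 * M" for l
        using that by (intro prod.cong) (auto simp: w_def U_def)
      have rest: "(\<Prod>i\<in>{..<M} - {k}. skew (w \<sigma> l (2 * i)) (w \<sigma> l (2 * i + 1))) = (\<Prod>i\<in>{..<M} - {k}. ?B i)"
        if "l = 2 * k \<or> l = 2 * k + 1" for l
        using that by (intro prod.cong) (auto simp: w_def b_def)
      have "2 * k < N" "2 * k + 1 < N"
        using that N by auto
      \<comment> \<open>Moving \<open>h\<close> from the second slot of the pair to the first brings
        a minus sign; the two slots together then give the antisymmetric \<open>c\<close> that
        \<open>pairing_sum_with_unpaired\<close> expects.\<close>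
      then have anti: "skew (e (\<sigma> (2 * k))) (\<lambda>t. h t * e (\<sigma> (2 * k + 1)) t)
          = - skew (\<lambda>t. h t * e (\<sigma> (2 * k + 1)) t) (e (\<sigma> (2 * k)))"
        using perm[OF \<sigma>] by (intro skew_antisym he e) auto
      have "I (2 * k) = skew (\<lambda>t. h t * e (\<sigma> (2 * k)) t) (e (\<sigma> (2 * k + 1)))
             * (\<Prod>i\<in>{..<M} - {k}. ?B i) * (\<Prod>j\<in>{2 * M..<N}. U (\<sigma> j))"
        using that by (simp add: I tail prod.remove[of "{..<M}" k] rest[of "2 * k", simplified]) (simp add: w_def)
      moreover have "I (2 * k + 1) = skew (e (\<sigma> (2 * k))) (\<lambda>t. h t * e (\<sigma> (2 * k + 1)) t)
             * (\<Prod>i\<in>{..<M} - {k}. ?B i) * (\<Prod>j\<in>{2 * M..<N}. U (\<sigma> j))"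
        using that by (simp add: I tail prod.remove[of "{..<M}" k] rest[of "2 * k + 1", simplified]) (simp add: w_def)
      moreover have "c (\<sigma> (2 * k)) (\<sigma> (2 * k + 1))
          = skew (\<lambda>t. h t * e (\<sigma> (2 * k)) t) (e (\<sigma> (2 * k + 1)))
            + skew (e (\<sigma> (2 * k))) (\<lambda>t. h t * e (\<sigma> (2 * k + 1)) t)"
        by (simp only: c_def anti diff_conv_add_uminus)
      ultimately show ?thesis
        by (simp only: distrib_right)
    qed
    have last: "I k = (\<Prod>i<M. ?B i) * V (\<sigma> k)" if "k \<in> {2 * M..<N}" for k
    proof -
      have "{2 * M..<N} = {k}" using that N by auto
      moreover have "(\<Prod>i<M. skew (w \<sigma> k (2 * i)) (w \<sigma> k (2 * i + 1))) = (\<Prod>i<M. ?B i)"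
        using that by (intro prod.cong) (auto simp: w_def b_def)
      ultimately show ?thesis by (simp add: I V_def w_def)
    qed
    have "(\<Sum>k<N. I k) = (\<Sum>k<2 * M. I k) + (\<Sum>k\<in>{2 * M..<N}. I k)"
      using sum.atLeastLessThan_concat[of 0 "2 * M" N I] N by (simp add: lessThan_atLeast0)
    also have "(\<Sum>k<2 * M. I k) = (\<Sum>k<M. c (\<sigma> (2 * k)) (\<sigma> (2 * k + 1)) * (\<Prod>i\<in>{..<M} - {k}. ?B i))
         * (\<Prod>j\<in>{2 * M..<N}. U (\<sigma> j))"
      unfolding sum_pairs sum_distrib_right by (intro sum.cong refl pair) simp
    also have "(\<Sum>k\<in>{2 * M..<N}. I k) = (\<Prod>i<M. ?B i) * (\<Sum>j\<in>{2 * M..<N}. V (\<sigma> j))"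
      unfolding sum_distrib_left by (intro sum.cong refl last) simp
    finally show "rsign \<sigma> * (\<Sum>k<N. \<integral>y. paired_prod M N (w \<sigma> k) y \<partial>lebN {..<N}) = rsign \<sigma> *
            ((\<Sum>k<M. c (\<sigma> (2 * k)) (\<sigma> (2 * k + 1)) * (\<Prod>i\<in>{..<M} - {k}. ?B i))
               * (\<Prod>j\<in>{2 * M..<N}. U (\<sigma> j))
             + (\<Prod>i<M. ?B i) * (\<Sum>j\<in>{2 * M..<N}. V (\<sigma> j)))"
      by (simp add: I_def)
  qed
  also have "\<dots> = pairing_sum M * ((\<Sum>a<M. c (2 * a) (2 * a + 1)) + (\<Sum>j\<in>{2 * M..<N}. V j))"
    using N sk u by (intro pairing_sum_with_unpaired) (auto simp: b_def U_def c_def)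
  finally show "(\<integral>y. F y \<partial>lebN {..<N})
      = pairing_sum M * ((\<Sum>a<M. c (2 * a) (2 * a + 1)) + (\<Sum>j\<in>{2 * M..<N}. LBINT t. h t * e j t))"
    by (simp add: V_def)
qed

section \<open>From the alternating integral to the normalised eigenvalue law\<close>

definition vdm_weight :: "real \<Rightarrow> nat \<Rightarrow> (nat \<Rightarrow> real) \<Rightarrow> real" where
  "vdm_weight a N y = (\<Prod>j<N. exp (- a * (y j)\<^sup>2)) * \<bar>vdm N y\<bar>"

lemma vdm_measurable: "vdm N \<in> borel_measurable (lebN {..<N})"
  unfolding vdm_def[abs_def]
  by (intro borel_measurable_prod borel_measurable_diff)
     (auto intro!: measurable_component_singleton)

lemma vdm_weight_measurable: "vdm_weight a N \<in> borel_measurable (lebN {..<N})"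
proof -
  have "(\<lambda>y. exp (- a * (y j)\<^sup>2)) \<in> borel_measurable (lebN {..<N})" if "j < N" for j
  proof -
    have [measurable]: "(\<lambda>y. y j) \<in> lebN {..<N} \<rightarrow>\<^sub>M borel"
      using measurable_component_singleton[of j "{..<N}" "\<lambda>_. lborel :: real measure"] that by simp
    show ?thesis by measurable
  qed
  then show ?thesis
    unfolding vdm_weight_def[abs_def]
    by (intro borel_measurable_times borel_measurable_prod borel_measurable_abs vdm_measurable) auto
qed

lemma linear_statistic_measurable:
  fixes h :: "real \<Rightarrow> 'a :: {second_countable_topology, topological_comm_monoid_add}"
  assumes [measurable]: "h \<in> borel_measurable borel"
  shows "(\<lambda>y. \<Sum>j\<in>I. h (y j)) \<in> borel_measurable (lebN I)"
proof (intro borel_measurable_sum)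
  fix j assume "j \<in> I"
  then have [measurable]: "(\<lambda>y. y j) \<in> lebN I \<rightarrow>\<^sub>M borel"
    using measurable_component_singleton[of j I "\<lambda>_. lborel :: real measure"] by simp
  show "(\<lambda>y. h (y j)) \<in> borel_measurable (lebN I)" by measurable
qed

text \<open>Averaging over permutations of the coordinates leaves the integral unchanged. The
  statistic is symmetric and the alternant is alternating, so only \<open>pair_sgn\<close> is
  affected: it becomes a multiple of the sign of the Vandermonde product, which turns the alternant
  into a multiple of the weight. The point is that \<open>K\<close> is chosen before
  \<open>h\<close>.\<close>

lemma integral_antisymmetrize:
  assumes M: "2 * M \<le> N"
    and e: "\<And>i t. i < N \<Longrightarrow> e i t = poly (p i) t * exp (- a * t\<^sup>2)"
    and deg: "\<And>i. i < N \<Longrightarrow> degree (p i) < N"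
  shows "\<exists>K. \<forall>h. integrable (lebN {..<N}) (\<lambda>y. (\<Sum>j<N. h (y j)) * alternant N e y * pair_sgn M y) \<longrightarrow>
    (\<integral>y. (\<Sum>j<N. h (y j)) * alternant N e y * pair_sgn M y \<partial>lebN {..<N})
      = K * (\<integral>y. (\<Sum>j<N. h (y j)) * vdm_weight a N y \<partial>lebN {..<N})"
proof -
  obtain \<kappa> where \<kappa>: "\<And>y. alternant N (\<lambda>i. poly (p i)) y = \<kappa> * vdm N y"
    using alternant_poly[of N p, OF deg] by blast
  obtain c where c: "\<And>y. inj_on y {..<N} \<Longrightarrow>
      (\<Sum>\<tau> | \<tau> permutes {..<N}. rsign \<tau> * pair_sgn M (y \<circ> \<tau>)) = c * sgn (vdm N y)"
    using antisymmetrize_pair_sgn[OF M] by blast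
  define w where "w y = (\<Prod>j<N. exp (- a * (y j)\<^sup>2))" for y
  have alt: "alternant N e y = \<kappa> * w y * vdm N y" for y
  proof -
    have "alternant N e y = (\<Sum>\<sigma> | \<sigma> permutes {..<N}. w y * (rsign \<sigma> * (\<Prod>j<N. poly (p (\<sigma> j)) (y j))))"
      unfolding alternant_def
    proof (rule sum.cong[OF refl])
      fix \<sigma> assume "\<sigma> \<in> {\<sigma>. \<sigma> permutes {..<N}}"
      then have "(\<Prod>j<N. e (\<sigma> j) (y j)) = (\<Prod>j<N. poly (p (\<sigma> j)) (y j) * exp (- a * (y j)\<^sup>2))"
        using permutes_in_image[of \<sigma> "{..<N}"] by (intro prod.cong refl e) auto
      then show "rsign \<sigma> * (\<Prod>j<N. e (\<sigma> j) (y j)) = w y * (rsign \<sigma> * (\<Prod>j<N. poly (p (\<sigma> j)) (y j)))"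
        by (simp add: w_def prod.distrib)
    qed
    then show ?thesis
      using \<kappa>[of y] by (simp add: sum_distrib_left[symmetric] alternant_def)
  qed
  have fact0: "card {\<tau>. \<tau> permutes {..<N}} = fact N"
    by (subst card_permutations[of "{..<N}" N]) auto
  show ?thesis
  proof (intro exI allI impI)
    fix h :: "real \<Rightarrow> real"
    define H where "H y = (\<Sum>j<N. h (y j))" for y
    define F where "F y = H y * alternant N e y * pair_sgn M y" for y
    assume "integrable (lebN {..<N}) (\<lambda>y. (\<Sum>j<N. h (y j)) * alternant N e y * pair_sgn M y)"
    then have int: "integrable (lebN {..<N}) F"
      unfolding F_def H_def .
    have F\<tau>: "F (\<lambda>i\<in>{..<N}. y (\<tau> i)) = H y * alternant N e y * (rsign \<tau> * pair_sgn M (y \<circ> \<tau>))"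
      if "\<tau> permutes {..<N}" for \<tau> y
    proof -
      have "H (\<lambda>i\<in>{..<N}. y (\<tau> i)) = (\<Sum>j<N. h (y (\<tau> j)))"
        by (simp add: H_def)
      also have "\<dots> = H y"
        using sum.permute[OF that, of "\<lambda>j. h (y j)"] by (simp add: H_def comp_def)
      finally have "H (\<lambda>i\<in>{..<N}. y (\<tau> i)) = H y" .
      moreover have "alternant N e (\<lambda>i\<in>{..<N}. y (\<tau> i)) = rsign \<tau> * alternant N e y"
        using alternant_permute[OF that, of e y] alternant_cong[of N "\<lambda>i\<in>{..<N}. y (\<tau> i)" "y \<circ> \<tau>" e] by simp
      moreover have "pair_sgn M (\<lambda>i\<in>{..<N}. y (\<tau> i)) = pair_sgn M (y \<circ> \<tau>)"
        unfolding pair_sgn_def using M by (intro prod.cong) auto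
      ultimately show ?thesis by (simp add: F_def)
    qed
    have bij: "bij_betw \<tau> {..<N} {..<N}" if "\<tau> permutes {..<N}" for \<tau>
      using that by (rule permutes_imp_bij)
    have int\<tau>: "integrable (lebN {..<N}) (\<lambda>y. F (\<lambda>i\<in>{..<N}. y (\<tau> i)))"
      and I\<tau>: "(\<integral>y. F (\<lambda>i\<in>{..<N}. y (\<tau> i)) \<partial>lebN {..<N}) = (\<integral>y. F y \<partial>lebN {..<N})"
      if "\<tau> permutes {..<N}" for \<tau>
      using integrable_lebN_reindex[OF _ _ bij[OF that] int]
        integral_lebN_reindex[OF _ _ bij[OF that] borel_measurable_integrable[OF int]] by auto
    have "fact N * (\<integral>y. F y \<partial>lebN {..<N})
        = (\<Sum>\<tau> | \<tau> permutes {..<N}. \<integral>y. F (\<lambda>i\<in>{..<N}. y (\<tau> i)) \<partial>lebN {..<N})"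
      by (simp add: I\<tau> fact0)
    also have "\<dots> = (\<integral>y. (\<Sum>\<tau> | \<tau> permutes {..<N}. F (\<lambda>i\<in>{..<N}. y (\<tau> i))) \<partial>lebN {..<N})"
      by (subst Bochner_Integration.integral_sum) (auto intro: int\<tau>)
    also have "\<dots> = (\<integral>y. \<kappa> * c * (H y * vdm_weight a N y) \<partial>lebN {..<N})"
    proof (rule Bochner_Integration.integral_cong[OF refl])
      fix y :: "nat \<Rightarrow> real"
      have "(\<Sum>\<tau> | \<tau> permutes {..<N}. F (\<lambda>i\<in>{..<N}. y (\<tau> i)))
            = H y * alternant N e y * (\<Sum>\<tau> | \<tau> permutes {..<N}. rsign \<tau> * pair_sgn M (y \<circ> \<tau>))"
        by (simp add: F\<tau> sum_distrib_left)
      also have "\<dots> = \<kappa> * c * (H y * vdm_weight a N y)"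
      proof (cases "inj_on y {..<N}")
        case True
        have "vdm N y * sgn (vdm N y) = \<bar>vdm N y\<bar>" by (simp add: abs_sgn)
        then show ?thesis
          unfolding alt c[OF True] vdm_weight_def w_def
          by (simp add: algebra_simps)
      next
        \<comment> \<open>Where two coordinates coincide the sign is not governed by a sorting
          permutation, but both sides carry a vanishing Vandermonde factor.\<close>
        case False
        then have "vdm N y = 0"
          using vdm_eq_0[of _ N] by (auto simp: inj_on_def)
        then show ?thesis by (simp add: alt vdm_weight_def)
      qed
      finally show "(\<Sum>\<tau> | \<tau> permutes {..<N}. F (\<lambda>i\<in>{..<N}. y (\<tau> i))) = \<kappa> * c * (H y * vdm_weight a N y)" .
    qed
    also have "\<dots> = \<kappa> * c * (\<integral>y. H y * vdm_weight a N y \<partial>lebN {..<N})"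
      by simp
    finally show "(\<integral>y. (\<Sum>j<N. h (y j)) * alternant N e y * pair_sgn M y \<partial>lebN {..<N})
      = \<kappa> * c / fact N * (\<integral>y. (\<Sum>j<N. h (y j)) * vdm_weight a N y \<partial>lebN {..<N})"
      by (simp add: F_def H_def field_simps)
  qed
qed

lemma vdm_weight_shift: "vdm_weight a N (\<lambda>i\<in>{..<N}. y (Suc i)) = goe_weight a N y"
proof -
  have "(\<Prod>k\<in>{1..N}. \<Prod>j\<in>{1..<k}. \<bar>y k - y j\<bar>) = (\<Prod>k<N. \<Prod>j<k. \<bar>y (Suc k) - y (Suc j)\<bar>)"
  proof -
    have "(\<Prod>k\<in>{1..N}. \<Prod>j\<in>{1..<k}. \<bar>y k - y j\<bar>) = (\<Prod>k<N. \<Prod>j\<in>{1..<Suc k}. \<bar>y (Suc k) - y j\<bar>)"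
      by (rule prod.reindex_bij_witness[of _ Suc "\<lambda>k. k - 1"]) auto
    also have "\<dots> = (\<Prod>k<N. \<Prod>j<k. \<bar>y (Suc k) - y (Suc j)\<bar>)"
      by (intro prod.cong refl prod.reindex_bij_witness[of _ Suc "\<lambda>k. k - 1"]) auto
    finally show ?thesis .
  qed
  moreover have "(\<Prod>l\<in>{1..N}. exp (- a * (y l)\<^sup>2)) = (\<Prod>k<N. exp (- a * (y (Suc k))\<^sup>2))"
    by (rule prod.reindex_bij_witness[of _ Suc "\<lambda>k. k - 1"]) auto
  ultimately show ?thesis
    by (simp add: vdm_weight_def goe_weight_def vdm_def abs_prod)
qed

lemma bij_betw_Suc: "bij_betw Suc {..<N} {1..N}"
  by (rule bij_betwI[where g = "\<lambda>k. k - 1"]) auto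

lemma goe_weight_measurable: "goe_weight a N \<in> borel_measurable (lebN {1..N})"
proof -
  have "(\<lambda>y. \<lambda>i\<in>{..<N}. y (Suc i)) \<in> lebN {1..N} \<rightarrow>\<^sub>M lebN {..<N}"
    by (intro measurable_restrict measurable_component_singleton) auto
  from measurable_compose[OF this vdm_weight_measurable[of a N]] show ?thesis
    by (simp add: vdm_weight_shift)
qed

lemma integral_goe_weight:
  assumes "h \<in> borel_measurable borel"
  shows "(\<integral>y. (\<Sum>j\<in>{1..N}. h (y j)) * goe_weight a N y \<partial>lebN {1..N})
         = (\<integral>y. (\<Sum>j<N. h (y j)) * vdm_weight a N y \<partial>lebN {..<N})"
proof -
  have "(\<Sum>j\<in>{1..N}. h (y j)) = (\<Sum>j<N. h (y (Suc j)))" for y :: "nat \<Rightarrow> real"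
    by (rule sum.reindex_bij_witness[of _ Suc "\<lambda>k. k - 1"]) auto
  then show ?thesis
    using integral_lebN_reindex[of "{..<N}" "{1..N}" Suc "\<lambda>y. (\<Sum>j<N. h (y j)) * vdm_weight a N y"]
      linear_statistic_measurable[OF assms, of "{..<N}"] vdm_weight_measurable[of a N] bij_betw_Suc
    by (simp add: vdm_weight_shift)
qed

lemma goe_weight_nonneg: "goe_weight a N y \<ge> 0"
  by (auto simp: goe_weight_def intro!: mult_nonneg_nonneg prod_nonneg)

text \<open>Division by zero yields zero, so the formula also holds for a vanishing normalisation;
  that it does not vanish is shown separately.\<close>

lemma integral_goe_law:
  fixes f :: "(nat \<Rightarrow> real) \<Rightarrow> 'a :: {banach, second_countable_topology}"
  assumes "f \<in> borel_measurable (lebN {1..N})"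
  shows "(\<integral>y. f y \<partial>goe_law a N)
         = (\<integral>y. goe_weight a N y *\<^sub>R f y \<partial>lebN {1..N}) /\<^sub>R (\<integral>y. goe_weight a N y \<partial>lebN {1..N})"
proof -
  let ?Z = "\<integral>y. goe_weight a N y \<partial>lebN {1..N}"
  have Z: "?Z \<ge> 0"
    by (intro Bochner_Integration.integral_nonneg) (simp add: goe_weight_nonneg)
  have "(\<integral>y. f y \<partial>goe_law a N) = (\<integral>y. (goe_weight a N y / ?Z) *\<^sub>R f y \<partial>lebN {1..N})"
    unfolding goe_law_def Let_def using assms goe_weight_measurable[of a N] Z
    by (subst integral_density) (auto intro!: goe_weight_nonneg divide_nonneg_nonneg)
  also have "\<dots> = (\<integral>y. inverse ?Z *\<^sub>R (goe_weight a N y *\<^sub>R f y) \<partial>lebN {1..N})"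
    by (intro Bochner_Integration.integral_cong) (simp_all add: divide_inverse mult.commute)
  also have "\<dots> = (\<integral>y. goe_weight a N y *\<^sub>R f y \<partial>lebN {1..N}) /\<^sub>R ?Z"
    by (simp del: scaleR_scaleR)
  finally show ?thesis .
qed

definition sgn_conv :: "(real \<Rightarrow> real) \<Rightarrow> real \<Rightarrow> real" where
  "sgn_conv f x = (LBINT t. f t * sgn (x - t))"

lemma skew_sgn_conv: "skew f g = - (LBINT t. f t * sgn_conv g t)"
proof -
  have "(LBINT t. g t * sgn (t - s)) = - sgn_conv g s" for s
    unfolding sgn_conv_def integral_minus[symmetric]
    by (rule Bochner_Integration.integral_cong) (auto simp: sgn_if)
  then show ?thesis by (simp add: skew_def)
qed

lemma sgn_conv_bounded: "integrable lborel g \<Longrightarrow> \<bar>sgn_conv g x\<bar> \<le> (LBINT t. \<bar>g t\<bar>)"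
proof -
  assume "integrable lborel g"
  moreover have "(LBINT t. g t * sgn (t - x)) = - sgn_conv g x"
    unfolding sgn_conv_def integral_minus[symmetric]
    by (rule Bochner_Integration.integral_cong) (auto simp: sgn_if)
  ultimately show ?thesis
    using abs_skew_inner_le[of g x] by simp
qed

text \<open>The diagonal of the correlation kernel: integrated against \<open>h\<close>, it gives
  the bracket in \<open>integral_alternant_pair_sgn\<close>, with each \<open>skew\<close> rewritten
  by \<open>skew_sgn_conv\<close>.\<close>

definition skew_density :: "nat \<Rightarrow> nat \<Rightarrow> (nat \<Rightarrow> real \<Rightarrow> real) \<Rightarrow> real \<Rightarrow> real" where
  "skew_density M N e t = (\<Sum>i<M. e (2 * i + 1) t * sgn_conv (e (2 * i)) t - e (2 * i) t * sgn_conv (e (2 * i + 1)) t)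
     + (\<Sum>j\<in>{2 * M..<N}. e j t)"

text \<open>The statistic \<open>h = 1\<close> calibrates the unknown constant. Each pair
  contributes 2 and an unpaired variable 1, so \<open>R\<close> takes the value \<open>N\<close>,
  and \<open>K\<close> times the partition function equals \<open>pairing_sum M\<close>. Positivity
  of the latter gives the first claim and lets the constant cancel in the second.\<close>

lemma goe_linear_statistic:
  fixes e :: "nat \<Rightarrow> real \<Rightarrow> real"
  assumes N: "2 * M \<le> N" "N \<le> 2 * M + 1" "N \<ge> 1"
    and e: "\<And>i. i < N \<Longrightarrow> integrable lborel (e i)"
    and poly: "\<And>i t. i < N \<Longrightarrow> e i t = poly (p i) t * exp (- a * t\<^sup>2)"
    and deg: "\<And>i. i < N \<Longrightarrow> degree (p i) < N"
    and sk: "\<And>i j. i < N \<Longrightarrow> j < N \<Longrightarrow> skew (e i) (e j) = pairing i j"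
    and u: "\<And>k. 2 * M < N \<Longrightarrow> k < N \<Longrightarrow> (LBINT t. e k t) = (if k = 2 * M then 1 else 0)"
    and h: "h \<in> borel_measurable borel"
    and he: "\<And>i. i < N \<Longrightarrow> integrable lborel (\<lambda>t. h t * e i t)"
  shows "(\<integral>y. goe_weight a N y \<partial>lebN {1..N}) \<noteq> 0"
    and "(\<integral>y. (\<Sum>j\<in>{1..N}. h (y j)) \<partial>goe_law a N) = (LBINT t. h t * skew_density M N e t)"
proof -
  define R where "R h = (\<Sum>i<M. skew (\<lambda>t. h t * e (2 * i) t) (e (2 * i + 1)) - skew (\<lambda>t. h t * e (2 * i + 1) t) (e (2 * i)))
      + (\<Sum>j\<in>{2 * M..<N}. LBINT t. h t * e j t)" for h
  define Q where "Q h = (\<integral>y. (\<Sum>j<N. h (y j)) * vdm_weight a N y \<partial>lebN {..<N})" for h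
  obtain K where K: "\<And>h. integrable (lebN {..<N}) (\<lambda>y. (\<Sum>j<N. h (y j)) * alternant N e y * pair_sgn M y) \<Longrightarrow>
    (\<integral>y. (\<Sum>j<N. h (y j)) * alternant N e y * pair_sgn M y \<partial>lebN {..<N}) = K * Q h"
    using integral_antisymmetrize[of M N e p a, OF N(1) poly deg] unfolding Q_def by blast
  have KQ: "K * Q h = pairing_sum M * R h" if "\<And>i. i < N \<Longrightarrow> integrable lborel (\<lambda>t. h t * e i t)" for h
    using K[OF integrable_alternant_pair_sgn[OF N(1,2) e that sk u]]
      integral_alternant_pair_sgn[OF N(1,2) e that sk u]
    unfolding R_def by simp
  have R1: "R (\<lambda>_. 1) = N"
  proof -
    have "R (\<lambda>_. 1) = (\<Sum>i<M. 2) + (\<Sum>j\<in>{2 * M..<N}. 1)"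
      unfolding R_def using N sk u
      by (intro arg_cong2[where f = "(+)"] sum.cong) (auto simp: pairing_def)
    also have "\<dots> = real N"
      using N(1) by simp
    finally show ?thesis .
  qed
  have Q1: "Q (\<lambda>_. 1) = N * (\<integral>y. vdm_weight a N y \<partial>lebN {..<N})"
    by (simp add: Q_def)
  have ne: "K * (\<integral>y. vdm_weight a N y \<partial>lebN {..<N}) = pairing_sum M"
    using KQ[of "\<lambda>_. 1"] e R1 Q1 N(3) by simp
  have Z: "(\<integral>y. goe_weight a N y \<partial>lebN {1..N}) = (\<integral>y. vdm_weight a N y \<partial>lebN {..<N})"
    using integral_lebN_reindex[of "{..<N}" "{1..N}" Suc "vdm_weight a N"] bij_betw_Suc vdm_weight_measurable[of a N]
    by (simp add: vdm_weight_shift)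
  show "(\<integral>y. goe_weight a N y \<partial>lebN {1..N}) \<noteq> 0"
    using ne pairing_sum_pos[of M] unfolding Z by auto
  have "(\<integral>y. (\<Sum>j\<in>{1..N}. h (y j)) \<partial>goe_law a N) = Q h / (\<integral>y. vdm_weight a N y \<partial>lebN {..<N})"
    using integral_goe_weight[OF h, of N a] linear_statistic_measurable[OF h, of "{1..N}"]
    by (subst integral_goe_law) (auto simp: Q_def Z[symmetric] mult.commute divide_inverse)
  also have "Q h / (\<integral>y. vdm_weight a N y \<partial>lebN {..<N}) = K * Q h / pairing_sum M"
    using pairing_sum_pos[of M] unfolding ne[symmetric] by auto
  also have "\<dots> = R h"
    using KQ[OF he] pairing_sum_pos[of M] by simp
  also have "R h = (LBINT t. h t * skew_density M N e t)"
  proof -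
    have int: "integrable lborel (\<lambda>t. h t * e i t * sgn_conv (e j) t)" if "i < N" "j < N" for i j
    proof (rule Bochner_Integration.integrable_bound)
      show "integrable lborel (\<lambda>t. h t * e i t * (LBINT t. \<bar>e j t\<bar>))"
        using he that by simp
      have [measurable]: "e i \<in> borel_measurable borel" "e j \<in> borel_measurable borel"
        using e that by auto
      show "(\<lambda>t. h t * e i t * sgn_conv (e j) t) \<in> borel_measurable lborel"
        unfolding sgn_conv_def using h by measurable
      show "AE t in lborel. norm (h t * e i t * sgn_conv (e j) t) \<le> norm (h t * e i t * (LBINT t. \<bar>e j t\<bar>))"
        using sgn_conv_bounded[OF e[OF that(2)]]
        by (auto simp: abs_mult intro!: mult_left_mono order.trans[OF _ abs_ge_self])
    qed
    have "(LBINT t. h t * skew_density M N e t)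
       = (LBINT t. (\<Sum>i<M. h t * e (2 * i + 1) t * sgn_conv (e (2 * i)) t - h t * e (2 * i) t * sgn_conv (e (2 * i + 1)) t)
          + (\<Sum>j\<in>{2 * M..<N}. h t * e j t))"
      by (simp add: skew_density_def sum_distrib_left algebra_simps)
    also have "\<dots> = R h"
      unfolding R_def skew_sgn_conv using N
      by (subst Bochner_Integration.integral_add, intro Bochner_Integration.integrable_sum Bochner_Integration.integrable_diff int; (simp; fail)?)
         (auto simp: he int intro!: sum.cong)
    finally show ?thesis by simp
  qed
  finally show "(\<integral>y. (\<Sum>j\<in>{1..N}. h (y j)) \<partial>goe_law a N) = (LBINT t. h t * skew_density M N e t)" .
qed

lemma goe_weight_scale:
  "goe_weight a N (\<lambda>i\<in>{1..N}. c * y i) = (\<Prod>k\<in>{1..N}. \<Prod>j\<in>{1..<k}. \<bar>c\<bar>) * goe_weight (a * c\<^sup>2) N y"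
proof -
  have "(\<Prod>k\<in>{1..N}. \<Prod>j\<in>{1..<k}. \<bar>c * y k - c * y j\<bar>)
      = (\<Prod>k\<in>{1..N}. \<Prod>j\<in>{1..<k}. \<bar>c\<bar>) * (\<Prod>k\<in>{1..N}. \<Prod>j\<in>{1..<k}. \<bar>y k - y j\<bar>)"
    unfolding prod.distrib[symmetric] abs_mult[symmetric] right_diff_distrib ..
  then show ?thesis
    by (simp add: goe_weight_def power_mult_distrib mult_ac)
qed

text \<open>The Jacobian and the power of \<open>\<bar>c\<bar>\<close> from the Vandermonde product
  cancel against the normalisation. Used with \<open>c = - 1\<close> for the reflection symmetry and
  with \<open>c = sqrt (g / N)\<close> to reach the parameter \<open>1 / 4\<close>.\<close>

lemma integral_goe_law_scale:
  fixes f :: "(nat \<Rightarrow> real) \<Rightarrow> 'a :: {banach, second_countable_topology}"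
  assumes "c \<noteq> 0" and f: "f \<in> borel_measurable (lebN {1..N})"
  shows "(\<integral>y. f y \<partial>goe_law a N) = (\<integral>y. f (\<lambda>i\<in>{1..N}. c * y i) \<partial>goe_law (a * c\<^sup>2) N)"
proof -
  define D where "D = (\<Prod>k\<in>{1..N}. \<Prod>j\<in>{1..<k}. \<bar>c\<bar>)"
  have D: "D > 0"
    using assms(1) by (auto simp: D_def intro!: prod_pos)
  have w: "goe_weight a N (\<lambda>i\<in>{1..N}. c * y i) = D * goe_weight (a * c\<^sup>2) N y" for y
    by (simp only: goe_weight_scale D_def)
  have C: "\<bar>c\<bar> ^ N > 0"
    using assms(1) by simp
  have meas: "(\<lambda>y. \<lambda>i\<in>{1..N}. c * y i) \<in> lebN {1..N} \<rightarrow>\<^sub>M lebN {1..N}"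
    by (intro measurable_restrict) measurable
  have f': "(\<lambda>y. f (\<lambda>i\<in>{1..N}. c * y i)) \<in> borel_measurable (lebN {1..N})"
    using measurable_compose[OF meas f] .
  have fw: "(\<lambda>y. goe_weight a N y *\<^sub>R f y) \<in> borel_measurable (lebN {1..N})"
    using f goe_weight_measurable by (intro borel_measurable_scaleR)
  have "(\<integral>y. goe_weight a N y *\<^sub>R f y \<partial>lebN {1..N})
      = (\<bar>c\<bar> ^ N * D) *\<^sub>R (\<integral>y. goe_weight (a * c\<^sup>2) N y *\<^sub>R f (\<lambda>i\<in>{1..N}. c * y i) \<partial>lebN {1..N})"
    by (subst integral_lebN_scale[OF _ assms(1) fw])
       (simp_all add: w[simplified] scaleR_scaleR[symmetric] del: scaleR_scaleR)
  moreover have "(\<integral>y. goe_weight a N y \<partial>lebN {1..N})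
      = \<bar>c\<bar> ^ N * D * (\<integral>y. goe_weight (a * c\<^sup>2) N y \<partial>lebN {1..N})"
    by (subst integral_lebN_scale[OF _ assms(1) goe_weight_measurable])
       (simp_all add: w[simplified])
  ultimately show ?thesis
    unfolding integral_goe_law[OF f] integral_goe_law[OF f'] using C D by (simp add: field_simps)
qed

section \<open>Rapidly decreasing functions and Hermite functions\<close>

lemma integral_FTC_UNIV:
  fixes F f :: "real \<Rightarrow> 'a :: euclidean_space"
  assumes F: "\<And>x. (F has_vector_derivative f x) (at x)"
    and cont: "continuous_on UNIV f" and int: "integrable lborel f"
    and lim: "(F \<longlongrightarrow> A) at_bot" "(F \<longlongrightarrow> B) at_top"
  shows "(LBINT x. f x) = B - A"
proof -
  have "(LBINT x=-\<infinity>..\<infinity>. f x) = B - A"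
    using assms
    by (intro interval_integral_FTC_integrable[where F = F])
       (auto simp: ereal_tendsto_simps set_integrable_def continuous_on_eq_continuous_at)
  then show ?thesis
    by (simp add: interval_lebesgue_integral_def set_lebesgue_integral_def)
qed

lemma integral_FTC_half:
  fixes F f :: "real \<Rightarrow> real"
  assumes F: "\<And>x. (F has_real_derivative f x) (at x)"
    and cont: "continuous_on UNIV f" and int: "integrable lborel f"
    and lim: "(F \<longlongrightarrow> A) at_bot" "(F \<longlongrightarrow> B) at_top"
  shows "(LBINT t. indicator {..<x} t * f t) = F x - A"
    and "(LBINT t. indicator {x<..} t * f t) = B - F x"
proof -
  have ind: "set_integrable lborel S f" if "S \<in> sets borel" for S
    using int that unfolding set_integrable_def by (intro integrable_mult_indicator) auto
  have "isCont F x" using F DERIV_isCont by blast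
  then have l: "(F \<longlongrightarrow> F x) (at_left x)" "(F \<longlongrightarrow> F x) (at_right x)"
    by (auto simp: isCont_def filterlim_at_split)
  have e: "einterval (-\<infinity>) (ereal x) = {..<x}" "einterval (ereal x) \<infinity> = {x<..}"
    by (auto simp: einterval_def)
  have "(LBINT t=-\<infinity>..ereal x. f t) = F x - A"
    using F cont lim l
    by (intro interval_integral_FTC_integrable[where F = F] ind)
       (auto simp: ereal_tendsto_simps continuous_on_eq_continuous_at has_real_derivative_iff_has_vector_derivative)
  then show "(LBINT t. indicator {..<x} t * f t) = F x - A"
    by (simp add: interval_lebesgue_integral_def set_lebesgue_integral_def e)
  have "(LBINT t=ereal x..\<infinity>. f t) = B - F x"
    using F cont lim l
    by (intro interval_integral_FTC_integrable[where F = F] ind)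
       (auto simp: ereal_tendsto_simps continuous_on_eq_continuous_at has_real_derivative_iff_has_vector_derivative)
  then show "(LBINT t. indicator {x<..} t * f t) = B - F x"
    by (simp add: interval_lebesgue_integral_def set_lebesgue_integral_def e)
qed

text \<open>Since \<open>F\<close> vanishes at both ends, the integrals over the two half-lines are
  \<open>F x\<close> and \<open>- F x\<close>.\<close>

lemma sgn_conv_derivative:
  fixes F f :: "real \<Rightarrow> real"
  assumes F: "\<And>x. (F has_real_derivative f x) (at x)"
    and cont: "continuous_on UNIV f" and int: "integrable lborel f"
    and lim: "(F \<longlongrightarrow> 0) at_bot" "(F \<longlongrightarrow> 0) at_top"
  shows "sgn_conv f x = 2 * F x"
proof -
  have ind: "integrable lborel (\<lambda>t. indicator S t * f t)" if "S \<in> sets borel" for S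
    using int that integrable_mult_indicator[of S lborel f] by auto
  have "sgn_conv f x = (LBINT t. indicator {..<x} t * f t - indicator {x<..} t * f t)"
    unfolding sgn_conv_def
    by (rule Bochner_Integration.integral_cong) (auto simp: sgn_if indicator_def)
  also have "\<dots> = 2 * F x"
    using integral_FTC_half[OF F cont int lim] by (subst Bochner_Integration.integral_diff) (auto intro: ind)
  finally show ?thesis .
qed

text \<open>Covers functions of nonzero integral, whose antiderivatives cannot vanish at both ends;
  for even \<open>N\<close> this is the case met in the derivative of \<theta>.\<close>

lemma sgn_conv_has_derivative:
  fixes f :: "real \<Rightarrow> real"
  assumes cont: "continuous_on UNIV f" and int: "integrable lborel f"
  shows "(sgn_conv f has_real_derivative 2 * f x) (at x)"
proof -
  define a b where "a = x - 1" and "b = x + 1"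
  have ind: "integrable lborel (\<lambda>t. f t * sgn (s - t))" for s
    by (rule Bochner_Integration.integrable_bound[OF int])
      (use int in \<open>auto simp: abs_mult sgn_if\<close>)
  have eq: "sgn_conv f u = sgn_conv f a + 2 * (LBINT y=a..u. f y)" if "a \<le> u" for u
  proof -
    have "sgn_conv f u - sgn_conv f a = (LBINT t. f t * sgn (u - t) - f t * sgn (a - t))"
      unfolding sgn_conv_def by (subst Bochner_Integration.integral_diff) (auto intro: ind)
    also have "\<dots> = (LBINT t. 2 * (indicator (einterval a u) t * f t))"
    proof (rule integral_cong_AE)
      show "AE t in lborel. f t * sgn (u - t) - f t * sgn (a - t) = 2 * (indicator (einterval a u) t * f t)"
        using AE_lborel_singleton[of a] AE_lborel_singleton[of u]
      proof eventually_elim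
        case (elim t)
        then show ?case using that by (auto simp: sgn_if indicator_def einterval_def)
      qed
    qed (use int in measurable)
    also have "\<dots> = 2 * (LBINT y=a..u. f y)"
      using that by (simp add: interval_lebesgue_integral_def set_lebesgue_integral_def)
    finally show ?thesis by simp
  qed
  have "((\<lambda>u. LBINT y=a..u. f y) has_vector_derivative f x) (at x within {a..b})"
    using cont by (intro interval_integral_FTC2) (auto simp: a_def b_def intro: continuous_on_subset)
  then have "((\<lambda>u. LBINT y=a..u. f y) has_real_derivative f x) (at x)"
    by (subst (asm) at_within_interior) (auto simp: a_def b_def has_real_derivative_iff_has_vector_derivative)
  then have "((\<lambda>u. sgn_conv f a + 2 * (LBINT y=a..u. f y)) has_real_derivative 2 * f x) (at x)"
    by (auto intro!: derivative_eq_intros)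
  then show ?thesis
  proof (rule has_field_derivative_transform_within_open[where S = "{a<..}"])
    show "sgn_conv f a + 2 * (LBINT y=a..u. f y) = sgn_conv f u" if "u \<in> {a<..}" for u
      using eq[of u] that by (simp only: greaterThan_iff less_imp_le)
  qed (simp_all add: a_def)
qed

text \<open>Decay is asked of the function alone and not of its derivatives. This gives a class
  stable under products with continuous bounded functions such as \<theta>, which does not
  decay.\<close>

definition rapid :: "(real \<Rightarrow> real) \<Rightarrow> bool" where
  "rapid f \<longleftrightarrow> continuous_on UNIV f \<and> (\<forall>k. \<exists>C. \<forall>t. \<bar>t ^ k * f t\<bar> \<le> C)"

lemma rapid_continuous: "rapid f \<Longrightarrow> continuous_on UNIV f"
  by (simp add: rapid_def)

lemma rapid_measurable [measurable_dest]: "rapid f \<Longrightarrow> f \<in> borel_measurable borel"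
  by (simp add: rapid_def borel_measurable_continuous_onI)

lemma rapid_add: "rapid f \<Longrightarrow> rapid g \<Longrightarrow> rapid (\<lambda>t. f t + g t)"
  unfolding rapid_def
proof (intro conjI allI continuous_on_add; (elim conjE)?)
  fix k assume f: "\<forall>k. \<exists>C. \<forall>t. \<bar>t ^ k * f t\<bar> \<le> C" and g: "\<forall>k. \<exists>C. \<forall>t. \<bar>t ^ k * g t\<bar> \<le> C"
  from f obtain C where "\<And>t. \<bar>t ^ k * f t\<bar> \<le> C" by blast
  moreover from g obtain D where "\<And>t. \<bar>t ^ k * g t\<bar> \<le> D" by blast
  ultimately have "\<bar>t ^ k * (f t + g t)\<bar> \<le> C + D" for t
    unfolding distrib_left by (rule order.trans[OF abs_triangle_ineq add_mono])
  then show "\<exists>C. \<forall>t. \<bar>t ^ k * (f t + g t)\<bar> \<le> C" by blast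
qed auto

lemma rapid_mult_bounded:
  assumes f: "rapid f" and g: "continuous_on UNIV g" "\<And>t. \<bar>g t\<bar> \<le> B"
  shows "rapid (\<lambda>t. f t * g t)"
  unfolding rapid_def
proof (intro conjI allI continuous_on_mult)
  fix k
  from f obtain C where C: "\<And>t. \<bar>t ^ k * f t\<bar> \<le> C" by (auto simp: rapid_def)
  have "\<bar>t ^ k * (f t * g t)\<bar> \<le> C * B" for t
  proof -
    have "\<bar>t ^ k * (f t * g t)\<bar> = \<bar>t ^ k * f t\<bar> * \<bar>g t\<bar>" by (simp add: abs_mult)
    also have "\<dots> \<le> C * B" using C[of t] g(2)[of t] by (intro mult_mono) auto
    finally show ?thesis .
  qed
  then show "\<exists>C. \<forall>t. \<bar>t ^ k * (f t * g t)\<bar> \<le> C" by blast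
qed (use f g in \<open>auto simp: rapid_def\<close>)

lemma rapid_cmult: "rapid f \<Longrightarrow> rapid (\<lambda>t. c * f t)"
  using rapid_mult_bounded[of f "\<lambda>_. c" "\<bar>c\<bar>"] by (simp add: mult.commute)

lemma rapid_uminus: "rapid f \<Longrightarrow> rapid (\<lambda>t. - f t)"
  using rapid_cmult[of f "-1"] by simp

lemma rapid_diff: "rapid f \<Longrightarrow> rapid g \<Longrightarrow> rapid (\<lambda>t. f t - g t)"
  using rapid_add[of f "\<lambda>t. - g t"] rapid_uminus[of g] by simp

lemma rapid_power_mult: "rapid f \<Longrightarrow> rapid (\<lambda>t. t ^ j * f t)"
  unfolding rapid_def
  by (auto simp: mult.assoc[symmetric] power_add[symmetric] intro!: continuous_intros)

lemma rapid_mult_ident: "rapid f \<Longrightarrow> rapid (\<lambda>t. t * f t)"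
  using rapid_power_mult[of f 1] by simp

lemma rapid_bounded: "rapid f \<Longrightarrow> \<exists>C. \<forall>t. \<bar>f t\<bar> \<le> C"
  using spec[of _ "0 :: nat"] unfolding rapid_def by (metis mult_1 power_0)

lemma rapid_mult: "rapid f \<Longrightarrow> rapid g \<Longrightarrow> rapid (\<lambda>t. f t * g t)"
  using rapid_bounded[of g] rapid_mult_bounded[of f g] rapid_continuous by blast

lemma rapid_integrable:
  assumes "rapid f"
  shows "integrable lborel f"
proof -
  obtain C D where C: "\<And>t. \<bar>t ^ 0 * f t\<bar> \<le> C" and D: "\<And>t. \<bar>t ^ 2 * f t\<bar> \<le> D"
    using assms unfolding rapid_def by meson
  have int: "integrable lborel (\<lambda>t :: real. inverse (1 + t\<^sup>2))"
    using integrable_inverse_1_plus_square by (simp add: set_integrable_def)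
  show ?thesis
  proof (rule Bochner_Integration.integrable_bound)
    show "integrable lborel (\<lambda>t :: real. (C + D) * inverse (1 + t\<^sup>2))"
      using int by (intro integrable_mult_right)
    show "f \<in> borel_measurable lborel"
      using assms by measurable
    show "AE t in lborel. norm (f t) \<le> norm ((C + D) * inverse (1 + t\<^sup>2))"
    proof (intro AE_I2)
      fix t :: real
      have pos: "1 + t\<^sup>2 > 0" by (simp add: add_pos_nonneg)
      have "\<bar>f t\<bar> * (1 + t\<^sup>2) \<le> C + D"
        using C[of t] D[of t] by (simp add: abs_mult algebra_simps)
      then have "\<bar>f t\<bar> \<le> (C + D) * inverse (1 + t\<^sup>2)"
        using pos by (simp add: field_simps)
      then show "norm (f t) \<le> norm ((C + D) * inverse (1 + t\<^sup>2))"
        by simp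
    qed
  qed
qed

lemma rapid_tendsto_0:
  assumes "rapid f"
  shows "(f \<longlongrightarrow> 0) at_top" "(f \<longlongrightarrow> 0) at_bot"
proof -
  obtain D where D: "\<And>t. \<bar>t ^ 1 * f t\<bar> \<le> D"
    using assms unfolding rapid_def by blast
  have le: "norm (f t) \<le> D / \<bar>t\<bar>" if "t \<noteq> 0" for t
    using D[of t] that by (simp add: abs_mult field_simps)
  have 1: "((\<lambda>t. D / \<bar>t\<bar>) \<longlongrightarrow> 0) at_top" "((\<lambda>t. D / \<bar>t\<bar>) \<longlongrightarrow> 0) at_bot"
    by (auto intro!: real_tendsto_divide_at_top filterlim_abs_real
          filterlim_compose[OF filterlim_abs_real filterlim_uminus_at_top_at_bot, simplified])
  have "eventually (\<lambda>t. norm (f t) \<le> D / \<bar>t\<bar>) at_top"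
    by (rule eventually_mono[OF eventually_gt_at_top[of 0]]) (rule le, simp)
  then show "(f \<longlongrightarrow> 0) at_top"
    by (rule Lim_null_comparison[OF _ 1(1)])
  have "eventually (\<lambda>t. norm (f t) \<le> D / \<bar>t\<bar>) at_bot"
    by (rule eventually_mono[OF eventually_le_at_bot[of "-1"]]) (rule le, simp)
  then show "(f \<longlongrightarrow> 0) at_bot"
    by (rule Lim_null_comparison[OF _ 1(2)])
qed

lemma rapid_integral_derivative:
  assumes "\<And>t. (F has_real_derivative f t) (at t)" "rapid F" "rapid f"
  shows "(LBINT t. f t) = 0"
  using integral_FTC_UNIV[of F f 0 0] assms rapid_tendsto_0 rapid_continuous rapid_integrable
  by (simp add: has_real_derivative_iff_has_vector_derivative)

lemma rapid_sgn_conv_derivative: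
  assumes "\<And>t. (F has_real_derivative f t) (at t)" "rapid F" "rapid f"
  shows "sgn_conv f x = 2 * F x"
  using sgn_conv_derivative[of F f x] assms rapid_tendsto_0 rapid_continuous rapid_integrable by blast

lemma rapid_gaussian: "rapid (\<lambda>t. exp (- t\<^sup>2 / 4))"
  unfolding rapid_def
proof (intro conjI allI)
  fix k :: nat
  have "\<bar>t ^ k * exp (- t\<^sup>2 / 4)\<bar> \<le> 1 + 4 ^ k * fact k" for t :: real
  proof -
    define x where "x = t\<^sup>2 / 4"
    have x: "x \<ge> 0" by (simp add: x_def)
    have "x ^ k / fact k \<le> exp x"
    proof -
      have "(\<Sum>n\<in>{k}. inverse (fact n) *\<^sub>R x ^ n) \<le> (\<Sum>n. inverse (fact n) *\<^sub>R x ^ n)"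
        using x by (intro sum_le_suminf summable_exp_generic) auto
      then show ?thesis by (simp add: exp_def divide_inverse mult.commute)
    qed
    then have "x ^ k * exp (- x) \<le> fact k"
      by (simp add: exp_minus field_simps)
    moreover have "t ^ (2 * k) = 4 ^ k * x ^ k"
      by (simp add: x_def power_divide flip: power_mult)
    ultimately have 1: "t ^ (2 * k) * exp (- t\<^sup>2 / 4) \<le> 4 ^ k * fact k"
      by (simp add: x_def mult.assoc)
    \<comment> \<open>The series bound controls even powers only; this passes to arbitrary
      ones.\<close>
    have 2: "\<bar>t\<bar> ^ k \<le> 1 + t ^ (2 * k)"
    proof (cases "\<bar>t\<bar> \<le> 1")
      case True
      then have "\<bar>t\<bar> ^ k \<le> 1" by (simp add: power_le_one)
      then show ?thesis by (simp add: add_increasing2)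
    next
      case False
      then have "\<bar>t\<bar> ^ k \<le> \<bar>t\<bar> ^ (2 * k)" by (intro power_increasing) auto
      then show ?thesis by (simp add: power_even_abs)
    qed
    have "\<bar>t ^ k * exp (- t\<^sup>2 / 4)\<bar> \<le> (1 + t ^ (2 * k)) * exp (- t\<^sup>2 / 4)"
      using 2 by (simp add: abs_mult power_abs mult_right_mono)
    also have "\<dots> \<le> 1 + 4 ^ k * fact k"
      using 1 by (simp add: distrib_right add_mono)
    finally show ?thesis .
  qed
  then show "\<exists>C. \<forall>t::real. \<bar>t ^ k * exp (- t\<^sup>2 / 4)\<bar> \<le> C" by blast
qed (auto intro!: continuous_intros)

text \<open>The probabilists' Hermite polynomial He_n times \<open>exp (- t^2 / 4)\<close>. The
  eigenvalue weight supplies precisely this Gaussian for each variable, and products of two such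
  functions carry the orthogonality weight \<open>exp (- t^2 / 2)\<close>.\<close>

fun hermf :: "nat \<Rightarrow> real \<Rightarrow> real" where
  "hermf 0 t = exp (- t\<^sup>2 / 4)"
| "hermf (Suc 0) t = t * hermf 0 t"
| "hermf (Suc (Suc n)) t = t * hermf (Suc n) t - real (Suc n) * hermf n t"

text \<open>The derivative of \<open>hermf n\<close>, written with the raising operator so that
  index 0 is no exception.\<close>

definition hermf' :: "nat \<Rightarrow> real \<Rightarrow> real" where
  "hermf' n t = t / 2 * hermf n t - hermf (Suc n) t"

lemma hermf_derivative: "(hermf n has_real_derivative hermf' n t) (at t)"
  unfolding hermf'_def
proof (induction n arbitrary: t rule: induct_nat_012)
  case 0
  have "((\<lambda>t. exp (- t\<^sup>2 / 4)) has_real_derivative - t / 2 * exp (- t\<^sup>2 / 4)) (at t)"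
    by (auto intro!: derivative_eq_intros)
  then show ?case by (simp add: field_simps)
next
  case 1
  have "((\<lambda>t. t * exp (- t\<^sup>2 / 4)) has_real_derivative (exp (- t\<^sup>2 / 4) - t\<^sup>2 / 2 * exp (- t\<^sup>2 / 4))) (at t)"
    by (auto intro!: derivative_eq_intros simp: power2_eq_square algebra_simps)
  then show ?case by (simp add: field_simps power2_eq_square)
next
  case (ge2 n)
  have "((\<lambda>t. t * hermf (Suc n) t - real (Suc n) * hermf n t) has_real_derivative
     (hermf (Suc n) t + t * (t / 2 * hermf (Suc n) t - hermf (Suc (Suc n)) t)
       - real (Suc n) * (t / 2 * hermf n t - hermf (Suc n) t))) (at t)"
    by (rule derivative_eq_intros ge2 refl | simp)+
  moreover have "hermf (Suc n) t + t * (t / 2 * hermf (Suc n) t - hermf (Suc (Suc n)) t)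
       - real (Suc n) * (t / 2 * hermf n t - hermf (Suc n) t)
     = t / 2 * hermf (Suc (Suc n)) t - hermf (Suc (Suc (Suc n))) t"
    by (simp add: field_simps)
  ultimately show ?case by simp
qed

lemma hermf'_Suc: "hermf' (Suc n) t = real (Suc n) * hermf n t - t / 2 * hermf (Suc n) t"
  by (simp add: hermf'_def field_simps)

text \<open>The Weber (parabolic cylinder) equation. It is the reason why polynomial expressions in
  \<phi>, its derivative and \<theta> are closed under differentiation.\<close>

lemma hermf'_derivative: "(hermf' n has_real_derivative (t\<^sup>2 / 4 - real n - 1 / 2) * hermf n t) (at t)"
proof -
  have "((\<lambda>t. t / 2 * hermf n t - hermf (Suc n) t) has_real_derivative
      (1 / 2 * hermf n t + t / 2 * hermf' n t - hermf' (Suc n) t)) (at t)"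
    by (rule derivative_eq_intros hermf_derivative refl | simp)+
  moreover have "1 / 2 * hermf n t + t / 2 * hermf' n t - hermf' (Suc n) t
      = (t\<^sup>2 / 4 - real n - 1 / 2) * hermf n t"
    unfolding hermf'_Suc by (simp add: hermf'_def field_simps power2_eq_square)
  ultimately show ?thesis
    unfolding hermf'_def[abs_def] by simp
qed

lemma hermf_poly: "\<exists>p. degree p \<le> n \<and> (\<forall>t. hermf n t = poly p t * exp (- t\<^sup>2 / 4))"
proof (induction n rule: less_induct)
  case (less n)
  consider "n = 0" | "n = 1" | m where "n = Suc (Suc m)"
    by (metis One_nat_def not0_implies_Suc)
  then show ?case
  proof cases
    case 1
    then show ?thesis by (intro exI[of _ 1]) auto
  next
    case 2
    then show ?thesis by (intro exI[of _ "[:0, 1:]"]) auto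
  next
    case 3
    obtain p where p: "degree p \<le> Suc m" "\<And>t. hermf (Suc m) t = poly p t * exp (- t\<^sup>2 / 4)"
      using less[of "Suc m"] 3 by auto
    obtain q where q: "degree q \<le> m" "\<And>t. hermf m t = poly q t * exp (- t\<^sup>2 / 4)"
      using less[of m] 3 by auto
    have "degree (pCons 0 p - smult (real (Suc m)) q) \<le> n"
      using p(1) q(1) 3 degree_pCons_le[of 0 p] degree_smult_le[of "real (Suc m)" q]
      by (intro degree_diff_le) auto
    then show ?thesis
      by (intro exI[of _ "pCons 0 p - smult (real (Suc m)) q"]) (auto simp: 3 p(2) q(2) algebra_simps)
  qed
qed

lemma hermf'_poly: "\<exists>p. degree p \<le> Suc n \<and> (\<forall>t. hermf' n t = poly p t * exp (- t\<^sup>2 / 4))"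
proof -
  obtain p where p: "degree p \<le> n" "\<And>t. hermf n t = poly p t * exp (- t\<^sup>2 / 4)"
    using hermf_poly by blast
  obtain q where q: "degree q \<le> Suc n" "\<And>t. hermf (Suc n) t = poly q t * exp (- t\<^sup>2 / 4)"
    using hermf_poly by blast
  have "degree (smult (1 / 2) (pCons 0 p) - q) \<le> Suc n"
    using p(1) q(1) degree_pCons_le[of 0 p] degree_smult_le[of "1 / 2" "pCons 0 p"]
    by (intro degree_diff_le) auto
  then show ?thesis
    by (intro exI[of _ "smult (1 / 2) (pCons 0 p) - q"]) (auto simp: hermf'_def p(2) q(2) algebra_simps)
qed

lemma rapid_hermf: "rapid (hermf n)"
proof (induction n rule: induct_nat_012)
  case 0
  then show ?case using rapid_gaussian by (simp add: hermf.simps[abs_def])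
next
  case 1
  then show ?case using rapid_mult_ident[OF rapid_gaussian] by (simp add: hermf.simps[abs_def])
next
  case (ge2 n)
  then show ?case by (simp add: hermf.simps(3)[abs_def] rapid_diff rapid_cmult rapid_mult_ident del: of_nat_Suc)
qed

lemma rapid_hermf': "rapid (hermf' n)"
proof -
  have "rapid (\<lambda>t. (1 / 2) * (t * hermf n t) - hermf (Suc n) t)"
    by (intro rapid_diff rapid_cmult rapid_mult_ident rapid_hermf)
  then show ?thesis by (simp add: hermf'_def[abs_def])
qed

lemma integrable_hermf_mult: "integrable lborel (\<lambda>t. hermf m t * hermf n t)"
  by (intro rapid_integrable rapid_mult rapid_hermf)

definition herm_norm :: "nat \<Rightarrow> real" where
  "herm_norm n = (LBINT t. (hermf n t)\<^sup>2)"

lemma integral_gaussian_pos: 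
  fixes a :: real
  assumes "integrable lborel (\<lambda>t. exp (a * t\<^sup>2))"
  shows "(LBINT t. exp (a * t\<^sup>2)) > 0"
proof -
  have "(LBINT t. exp (a * t\<^sup>2)) \<noteq> 0"
  proof
    assume "(LBINT t. exp (a * t\<^sup>2)) = 0"
    then have "AE t in lborel. exp (a * t\<^sup>2) = 0"
      using assms by (subst (asm) integral_nonneg_eq_0_iff_AE) auto
    then have "AE t in (lborel :: real measure). False"
      by simp
    then have "emeasure lborel (UNIV :: real set) = 0"
      by (simp add: AE_iff_measurable[OF _ refl])
    then show False by simp
  qed
  moreover have "(LBINT t. exp (a * t\<^sup>2)) \<ge> 0"
    by (intro Bochner_Integration.integral_nonneg) simp
  ultimately show ?thesis by linarith
qed

text \<open>The derivative of the product of two neighbouring Hermite functions integrates to zero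
  and contains exactly their two squares.\<close>

lemma herm_norm_Suc: "herm_norm (Suc n) = real (Suc n) * herm_norm n"
proof -
  define F f where "F t = hermf n t * hermf (Suc n) t"
    and "f t = real (Suc n) * (hermf n t * hermf n t) - hermf (Suc n) t * hermf (Suc n) t" for t
  have "(F has_real_derivative f t) (at t)" for t
  proof -
    have "(F has_real_derivative hermf' n t * hermf (Suc n) t + hermf' (Suc n) t * hermf n t) (at t)"
      unfolding F_def by (rule DERIV_mult hermf_derivative)+
    moreover have "hermf' n t * hermf (Suc n) t + hermf' (Suc n) t * hermf n t = f t"
      unfolding hermf'_Suc f_def hermf'_def by (simp add: algebra_simps)
    ultimately show ?thesis by simp
  qed
  then have "(LBINT t. f t) = 0"
    by (rule rapid_integral_derivative)
       (auto simp: F_def[abs_def] f_def[abs_def] intro!: rapid_diff rapid_cmult rapid_mult rapid_hermf)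
  then show ?thesis
    unfolding f_def herm_norm_def power2_eq_square
    by (subst (asm) Bochner_Integration.integral_diff)
       (auto intro!: integrable_mult_right integrable_hermf_mult simp del: of_nat_Suc)
qed

lemma herm_norm_pos: "herm_norm n > 0"
proof (induction n)
  case 0
  have eq: "(hermf 0 t)\<^sup>2 = exp (- 1 / 2 * t\<^sup>2)" for t
    by (simp add: power2_eq_square[of "exp _"] exp_add[symmetric])
  have "integrable lborel (\<lambda>t. (hermf 0 t)\<^sup>2)"
    unfolding power2_eq_square by (rule integrable_hermf_mult)
  then show ?case
    unfolding herm_norm_def eq by (rule integral_gaussian_pos)
next
  case (Suc n)
  then show ?case by (simp add: herm_norm_Suc)
qed

text \<open>By the Weber equation the Wronskian of the two functions has derivative
  \<open>n - m\<close> times their product.\<close>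

lemma hermf_orthogonal:
  assumes "m \<noteq> n"
  shows "(LBINT t. hermf m t * hermf n t) = 0"
proof -
  define F f where "F t = hermf' m t * hermf n t - hermf m t * hermf' n t"
    and "f t = (real n - real m) * (hermf m t * hermf n t)" for t
  have "(F has_real_derivative f t) (at t)" for t
  proof -
    have "(F has_real_derivative ((t\<^sup>2 / 4 - real m - 1 / 2) * hermf m t * hermf n t + hermf' n t * hermf' m t)
       - (hermf' m t * hermf' n t + (t\<^sup>2 / 4 - real n - 1 / 2) * hermf n t * hermf m t)) (at t)"
      unfolding F_def by (rule DERIV_mult DERIV_diff hermf_derivative hermf'_derivative)+
    then show ?thesis by (simp add: f_def algebra_simps)
  qed
  then have "(LBINT t. f t) = 0"
    by (rule rapid_integral_derivative)
       (auto simp: F_def[abs_def] f_def[abs_def] intro!: rapid_diff rapid_cmult rapid_mult rapid_hermf rapid_hermf')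
  then show ?thesis
    using assms by (simp add: f_def)
qed

lemma integral_hermf': "(LBINT t. hermf' n t) = 0"
  by (rule rapid_integral_derivative[OF hermf_derivative rapid_hermf rapid_hermf'])

text \<open>Up to a derivative of a rapidly decreasing function, raising the index by two is
  multiplication by \<open>n + 1\<close>. Integrals, \<open>sgn_conv\<close> and the skew form
  inherit two-step recursions from this.\<close>

lemma hermf_Suc_Suc: "hermf (Suc (Suc n)) t = real (Suc n) * hermf n t - 2 * hermf' (Suc n) t"
  unfolding hermf'_Suc by (simp add: algebra_simps)

lemma integral_hermf_Suc_Suc:
  "(LBINT t. hermf (Suc (Suc n)) t) = real (Suc n) * (LBINT t. hermf n t)"
  unfolding hermf_Suc_Suc
  by (subst Bochner_Integration.integral_diff)
     (auto intro!: integrable_mult_right rapid_integrable rapid_hermf rapid_hermf' simp: integral_hermf' simp del: of_nat_Suc)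

lemma hermf_1: "hermf (Suc 0) t = - 2 * hermf' 0 t"
  by (simp add: hermf'_def)

lemma integral_hermf_odd: "odd n \<Longrightarrow> (LBINT t. hermf n t) = 0"
proof (induction n rule: induct_nat_012)
  case 1
  then show ?case unfolding hermf_1 by (simp add: integral_hermf')
qed (auto simp: integral_hermf_Suc_Suc simp del: hermf.simps)

lemma integral_hermf_even: "even n \<Longrightarrow> (LBINT t. hermf n t) > 0"
proof (induction n rule: induct_nat_012)
  case 0
  then show ?case
    using integral_gaussian_pos[of "- 1 / 4"] rapid_integrable[OF rapid_gaussian] by simp
qed (auto simp: integral_hermf_Suc_Suc simp del: hermf.simps(3))

lemma sgn_conv_hermf': "sgn_conv (hermf' n) t = 2 * hermf n t"
  by (rule rapid_sgn_conv_derivative[OF hermf_derivative rapid_hermf rapid_hermf'])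

lemma sgn_conv_cmult: "sgn_conv (\<lambda>t. c * f t) x = c * sgn_conv f x"
  by (simp add: sgn_conv_def mult.assoc)

lemma sgn_conv_diff:
  assumes "integrable lborel f" "integrable lborel g"
  shows "sgn_conv (\<lambda>t. f t - g t) x = sgn_conv f x - sgn_conv g x"
proof -
  have "integrable lborel (\<lambda>t. f t * sgn (x - t))" if "integrable lborel f" for f :: "real \<Rightarrow> real"
    by (rule Bochner_Integration.integrable_bound[OF that]) (use that in \<open>auto simp: abs_mult sgn_if\<close>)
  then show ?thesis
    unfolding sgn_conv_def using assms by (simp add: left_diff_distrib)
qed

lemma sgn_conv_hermf_Suc_Suc:
  "sgn_conv (hermf (Suc (Suc n))) t = real (Suc n) * sgn_conv (hermf n) t - 4 * hermf (Suc n) t"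
proof -
  have "sgn_conv (hermf (Suc (Suc n))) t = sgn_conv (\<lambda>t. real (Suc n) * hermf n t - 2 * hermf' (Suc n) t) t"
    by (simp only: hermf_Suc_Suc[abs_def])
  also have "\<dots> = real (Suc n) * sgn_conv (hermf n) t - 4 * hermf (Suc n) t"
    by (subst sgn_conv_diff)
       (auto intro!: integrable_mult_right rapid_integrable rapid_hermf rapid_hermf'
         simp: sgn_conv_cmult sgn_conv_hermf' simp del: of_nat_Suc)
  finally show ?thesis .
qed

lemma sgn_conv_hermf_1: "sgn_conv (hermf (Suc 0)) t = - 4 * hermf 0 t"
proof -
  have "sgn_conv (hermf (Suc 0)) t = sgn_conv (\<lambda>t. - 2 * hermf' 0 t) t"
    by (simp only: hermf_1[abs_def])
  then show ?thesis by (simp only: sgn_conv_cmult sgn_conv_hermf')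
qed

section \<open>The eigenvalue density\<close>

lemma skew_cmult_left: "skew (\<lambda>t. c * f t) g = c * skew f g"
  by (simp add: skew_sgn_conv mult.assoc)

lemma skew_cmult_right: "skew f (\<lambda>t. c * g t) = c * skew f g"
  by (simp add: skew_sgn_conv sgn_conv_cmult mult.left_commute)

text \<open>\<open>sgn_conv\<close> undoes differentiation up to the factor 2, so the skew form
  against a derivative is an ordinary inner product and orthogonality applies.\<close>

lemma skew_hermf_hermf': "skew (hermf m) (hermf' n) = (if m = n then - 2 * herm_norm n else 0)"
proof -
  have "skew (hermf m) (hermf' n) = - (LBINT t. 2 * (hermf m t * hermf n t))"
    unfolding skew_sgn_conv sgn_conv_hermf' by (simp add: mult_ac)
  also have "\<dots> = - 2 * (LBINT t. hermf m t * hermf n t)" by simp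
  finally show ?thesis
    by (auto simp: hermf_orthogonal herm_norm_def power2_eq_square)
qed

lemma skew_hermf_Suc_Suc:
  "skew (hermf m) (hermf (Suc (Suc n)))
   = real (Suc n) * skew (hermf m) (hermf n) + (if m = Suc n then 4 * herm_norm m else 0)"
proof -
  have int: "integrable lborel (\<lambda>t. hermf m t * sgn_conv (hermf n) t)"
  proof -
    have "(LBINT s. hermf n s * sgn (s - t)) = - sgn_conv (hermf n) t" for t
      unfolding sgn_conv_def integral_minus[symmetric]
      by (rule Bochner_Integration.integral_cong) (auto simp: sgn_if)
    then show ?thesis
      using integrable_skew[OF rapid_integrable[OF rapid_hermf] rapid_integrable[OF rapid_hermf], of m n] by simp
  qed
  have "skew (hermf m) (hermf (Suc (Suc n)))
      = - (LBINT t. real (Suc n) * (hermf m t * sgn_conv (hermf n) t) - 4 * (hermf m t * hermf (Suc n) t))"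
    unfolding skew_sgn_conv sgn_conv_hermf_Suc_Suc by (simp add: algebra_simps del: of_nat_Suc)
  also have "\<dots> = - (real (Suc n) * (LBINT t. hermf m t * sgn_conv (hermf n) t)
      - 4 * (LBINT t. hermf m t * hermf (Suc n) t))"
    using int integrable_hermf_mult[of m "Suc n"]
    by (subst Bochner_Integration.integral_diff) (auto simp del: of_nat_Suc)
  finally show ?thesis
    by (auto simp: skew_sgn_conv hermf_orthogonal herm_norm_def power2_eq_square)
qed

lemma skew_hermf_1: "skew (hermf m) (hermf (Suc 0)) = (if m = 0 then 4 * herm_norm m else 0)"
proof -
  have "skew (hermf m) (hermf (Suc 0)) = 4 * (LBINT t. hermf m t * hermf 0 t)"
    unfolding skew_sgn_conv sgn_conv_hermf_1 integral_minus[symmetric] integral_mult_right_zero[symmetric]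
    by (simp add: mult_ac)
  then show ?thesis
    by (auto simp: hermf_orthogonal herm_norm_def power2_eq_square simp del: hermf.simps)
qed

text \<open>The correction term of the two-step recursion occurs only between neighbouring indices,
  which have opposite parity; antisymmetry settles the starting value at index 0.\<close>

lemma skew_hermf_same_parity: "even (m + n) \<Longrightarrow> skew (hermf m) (hermf n) = 0"
proof (induction n rule: induct_nat_012)
  case 0
  have "skew (hermf 0) (hermf 0) = 0"
    using skew_antisym[OF rapid_integrable rapid_integrable, OF rapid_hermf rapid_hermf, of 0 0] by (simp del: hermf.simps)
  then have "even k \<Longrightarrow> skew (hermf 0) (hermf k) = 0" for k
    by (induction k rule: induct_nat_012) (auto simp: skew_hermf_Suc_Suc simp del: hermf.simps)
  then have "skew (hermf 0) (hermf m) = 0" using 0 by (simp del: hermf.simps)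
  then show ?case
    using skew_antisym[OF rapid_integrable rapid_integrable, OF rapid_hermf rapid_hermf, of 0 m] by (simp del: hermf.simps)
next
  case 1
  then show ?case by (cases m) (auto simp: skew_hermf_1 simp del: hermf.simps)
next
  case (ge2 n)
  then show ?case by (auto simp: skew_hermf_Suc_Suc simp del: hermf.simps)
qed

text \<open>Lowering \<open>n\<close> in steps of two meets no correction term while
  \<open>n < m\<close>. For odd \<open>N\<close> this makes the unpaired function of index
  \<open>N - 1\<close> skew-orthogonal to the odd Hermite functions of the pairs.\<close>

lemma skew_hermf_even_odd: "even m \<Longrightarrow> odd n \<Longrightarrow> n < m \<Longrightarrow> skew (hermf m) (hermf n) = 0"
  by (induction n rule: induct_nat_012) (auto simp: skew_hermf_Suc_Suc skew_hermf_1)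

text \<open>The derivative of a Hermite function combines its two neighbours in index, both of the
  parity opposite to \<open>n\<close>, hence orthogonal to \<open>hermf n\<close>.\<close>

lemma skew_hermf'_hermf': "even (m + n) \<Longrightarrow> skew (hermf' m) (hermf' n) = 0"
proof -
  assume mn: "even (m + n)"
  have "(LBINT t. hermf' m t * hermf n t) = 0"
  proof (cases m)
    case 0
    then have "hermf' m t * hermf n t = - (1 / 2) * (hermf (Suc 0) t * hermf n t)" for t
      using hermf_1[of t] by simp
    moreover have "n \<noteq> Suc 0" using mn 0 by auto
    ultimately show ?thesis by (simp add: hermf_orthogonal del: hermf.simps)
  next
    case (Suc k)
    have h: "hermf' (Suc k) t = (real (Suc k) * hermf k t - hermf (Suc (Suc k)) t) / 2" for t
      using hermf_Suc_Suc[of k t] by (simp del: hermf.simps)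
    have "hermf' m t * hermf n t
        = real (Suc k) / 2 * (hermf k t * hermf n t) - 1 / 2 * (hermf (Suc (Suc k)) t * hermf n t)" for t
      unfolding Suc h by (simp add: algebra_simps diff_divide_distrib add_divide_distrib del: hermf.simps)
    moreover have "n \<noteq> k" "n \<noteq> Suc (Suc k)" using mn Suc by auto
    ultimately show ?thesis
      using integrable_hermf_mult[of k n] integrable_hermf_mult[of "Suc (Suc k)" n]
      by (simp add: hermf_orthogonal del: hermf.simps)
  qed
  moreover have "skew (hermf' m) (hermf' n) = - (LBINT t. 2 * (hermf' m t * hermf n t))"
    unfolding skew_sgn_conv sgn_conv_hermf' by (simp add: mult_ac)
  ultimately show ?thesis by simp
qed

text \<open>For even \<open>N\<close> the index in the first branch is out of range; for odd \<open>N\<close> it is the unpaired one,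
  and the pairs use the odd Hermite functions, whose integrals vanish.\<close>

definition goe_basis :: "nat \<Rightarrow> nat \<Rightarrow> real \<Rightarrow> real" where
  "goe_basis N i =
     (if i = 2 * (N div 2) then (\<lambda>t. 1 / (LBINT t. hermf i t) * hermf i t)
      else if even i then hermf (i + N mod 2)
      else (\<lambda>t. - 1 / (2 * herm_norm (i - 1 + N mod 2)) * hermf' (i - 1 + N mod 2) t))"

lemma rapid_goe_basis: "rapid (goe_basis N i)"
  by (simp only: goe_basis_def split: if_split) (intro conjI impI rapid_hermf rapid_hermf' rapid_cmult)

lemma goe_basis_cases:
  fixes i N :: nat
  assumes "i < N"
  obtains a where "a < N div 2" "i = 2 * a" | a where "a < N div 2" "i = 2 * a + 1"
    | "N mod 2 = 1" "i = 2 * (N div 2)"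
proof -
  define a where "a = i div 2"
  have i: "i = 2 * a \<or> i = 2 * a + 1" by (auto simp: a_def)
  show thesis
  proof (cases "a < N div 2")
    case True
    then show ?thesis using i that by blast
  next
    case False
    have "N = 2 * (N div 2) + N mod 2" "N mod 2 < 2" by simp_all
    then have "i = 2 * (N div 2) \<and> N mod 2 = 1" using False assms i by linarith
    then show ?thesis using that by blast
  qed
qed

lemma goe_basis_even: "a < N div 2 \<Longrightarrow> goe_basis N (2 * a) = hermf (2 * a + N mod 2)"
  by (simp add: goe_basis_def)

text \<open>The prefactor comes from \<open>skew_hermf_hermf'\<close>: a Hermite function against
  its own derivative gives \<open>- 2 * herm_norm\<close>, and the pair is to have skew product
  1.\<close>

lemma goe_basis_odd: "a < N div 2 \<Longrightarrow>
    goe_basis N (2 * a + 1) = (\<lambda>t. - 1 / (2 * herm_norm (2 * a + N mod 2)) * hermf' (2 * a + N mod 2) t)"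
proof -
  have "2 * a + 1 \<noteq> 2 * (N div 2)" by presburger
  then show ?thesis by (simp add: goe_basis_def)
qed

lemma goe_basis_last:
  "goe_basis N (2 * (N div 2)) = (\<lambda>t. 1 / (LBINT t. hermf (2 * (N div 2)) t) * hermf (2 * (N div 2)) t)"
  by (simp add: goe_basis_def)

text \<open>Differentiation raises the degree by one. The Hermite functions in the pairs have index
  at most \<open>N - 2\<close>, so their derivatives still fit below degree
  \<open>N\<close>.\<close>

lemma goe_basis_poly:
  assumes "i < N"
  shows "\<exists>p. degree p < N \<and> (\<forall>t. goe_basis N i t = poly p t * exp (- (1 / 4) * t\<^sup>2))"
proof -
  have N: "N = 2 * (N div 2) + N mod 2" by simp
  have *: "\<exists>p. degree p < N \<and> (\<forall>t. c * f t = poly p t * exp (- (1 / 4) * t\<^sup>2))"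
    if "k < N" "\<exists>p. degree p \<le> k \<and> (\<forall>t. f t = poly p t * exp (- t\<^sup>2 / 4))"
    for k and c :: real and f :: "real \<Rightarrow> real"
  proof -
    from that obtain p where "degree p \<le> k" "\<And>t. f t = poly p t * exp (- t\<^sup>2 / 4)" by blast
    moreover from this have "degree (smult c p) < N"
      using degree_smult_le[of c p] that(1) by linarith
    ultimately show ?thesis by (intro exI[of _ "smult c p"]) auto
  qed
  from assms show ?thesis
  proof (cases rule: goe_basis_cases)
    case (1 a)
    then have "2 * a + N mod 2 < N" using N by linarith
    then show ?thesis using *[OF _ hermf_poly, of _ 1] 1 by (simp add: goe_basis_even)
  next
    case (2 a)
    then have "Suc (2 * a + N mod 2) < N" using N by linarith
    then show ?thesis unfolding 2(2) goe_basis_odd[OF 2(1)] by (rule *[OF _ hermf'_poly])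
  next
    case 3
    then have "2 * (N div 2) < N" using N by linarith
    then show ?thesis unfolding 3(2) goe_basis_last by (rule *[OF _ hermf_poly])
  qed
qed

lemma goe_basis_integral:
  assumes "2 * (N div 2) < N" "k < N"
  shows "(LBINT t. goe_basis N k t) = (if k = 2 * (N div 2) then 1 else 0)"
proof -
  have odd: "N mod 2 = 1" using assms(1) by presburger
  from assms(2) show ?thesis
  proof (cases rule: goe_basis_cases)
    case (1 a)
    then show ?thesis using odd by (simp add: goe_basis_even integral_hermf_odd del: hermf.simps)
  next
    case (2 a)
    then have "k \<noteq> 2 * (N div 2)" by presburger
    then show ?thesis unfolding 2(2) goe_basis_odd[OF 2(1)] by (simp add: integral_hermf')
  next
    case 3
    have "(LBINT t. hermf (2 * (N div 2)) t) > 0"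
      by (rule integral_hermf_even) simp
    then show ?thesis unfolding 3(2) goe_basis_last by simp
  qed
qed

text \<open>All Hermite functions in the pairs have indices of one parity. Two of them, or two of
  their derivatives, are therefore skew-orthogonal, and the mixed products reduce to ordinary
  orthogonality.\<close>

lemma goe_basis_skew:
  assumes "i < N" "j < N"
  shows "skew (goe_basis N i) (goe_basis N j) = pairing i j"
proof -
  have nz: "herm_norm n \<noteq> 0" for n using herm_norm_pos[of n] by simp
  have d: "(2 * a + 1) div 2 = a" "2 * a div 2 = a" for a :: nat by simp_all
  have antisym: "skew (goe_basis N i) (goe_basis N j) = - skew (goe_basis N j) (goe_basis N i)" for i j
    by (rule skew_antisym[OF rapid_integrable rapid_integrable, OF rapid_goe_basis rapid_goe_basis])
  have pairing_antisym: "pairing i j = - pairing j i" for i j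
    by (simp add: pairing_def sgn_if eq_commute[of "j div 2"])
  have ee: "skew (goe_basis N (2 * a)) (goe_basis N (2 * b)) = pairing (2 * a) (2 * b)"
    if "a < N div 2" "b < N div 2" for a b
    using that by (simp add: goe_basis_even skew_hermf_same_parity pairing_def del: hermf.simps)
  have eo: "skew (goe_basis N (2 * a)) (goe_basis N (2 * b + 1)) = pairing (2 * a) (2 * b + 1)"
    if "a < N div 2" "b < N div 2" for a b
    unfolding goe_basis_even[OF that(1)] goe_basis_odd[OF that(2)] skew_cmult_right skew_hermf_hermf' pairing_def d
    using nz by auto
  have oo: "skew (goe_basis N (2 * a + 1)) (goe_basis N (2 * b + 1)) = pairing (2 * a + 1) (2 * b + 1)"
    if "a < N div 2" "b < N div 2" for a b
    unfolding goe_basis_odd[OF that(1)] goe_basis_odd[OF that(2)] skew_cmult_right skew_cmult_left pairing_def d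
    by (subst skew_hermf'_hermf') auto
  have le: "skew (goe_basis N (2 * (N div 2))) (goe_basis N (2 * a)) = pairing (2 * (N div 2)) (2 * a)"
    if "a < N div 2" "N mod 2 = 1" for a
  proof -
    have "skew (hermf (2 * (N div 2))) (hermf (2 * a + 1)) = 0"
      using that by (intro skew_hermf_even_odd) auto
    then show ?thesis
      unfolding goe_basis_last goe_basis_even[OF that(1)] skew_cmult_left that(2) pairing_def d
      using that by simp
  qed
  have lo: "skew (goe_basis N (2 * (N div 2))) (goe_basis N (2 * a + 1)) = pairing (2 * (N div 2)) (2 * a + 1)"
    if "a < N div 2" "N mod 2 = 1" for a
  proof -
    have "2 * (N div 2) \<noteq> 2 * a + 1" by presburger
    then have "skew (hermf (2 * (N div 2))) (hermf' (2 * a + 1)) = 0"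
      by (subst skew_hermf_hermf') simp
    then show ?thesis
      unfolding goe_basis_last goe_basis_odd[OF that(1)] skew_cmult_left skew_cmult_right that(2) pairing_def d
      using that by simp
  qed
  have ll: "skew (goe_basis N (2 * (N div 2))) (goe_basis N (2 * (N div 2))) = pairing (2 * (N div 2)) (2 * (N div 2))"
    using antisym[of "2 * (N div 2)" "2 * (N div 2)"] by (simp add: pairing_def)
  from assms(1) show ?thesis
  proof (cases rule: goe_basis_cases)
    case i: (1 a)
    from assms(2) show ?thesis
    proof (cases rule: goe_basis_cases)
      case (1 b)
      then show ?thesis using i ee by simp
    next
      case (2 b)
      then show ?thesis using i eo by simp
    next
      case 3
      show ?thesis
        by (subst antisym, subst pairing_antisym) (use i 3 le in simp)
    qed
  next
    case i: (2 a)
    from assms(2) show ?thesis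
    proof (cases rule: goe_basis_cases)
      case (1 b)
      show ?thesis
        by (subst antisym, subst pairing_antisym) (use i 1 eo in simp)
    next
      case (2 b)
      then show ?thesis using i oo by simp
    next
      case 3
      show ?thesis
        by (subst antisym, subst pairing_antisym) (use i 3 lo in simp)
    qed
  next
    case i: 3
    from assms(2) show ?thesis
    proof (cases rule: goe_basis_cases)
      case (1 b)
      then show ?thesis using i le by simp
    next
      case (2 b)
      then show ?thesis using i lo by simp
    next
      case 3
      then show ?thesis using i ll by simp
    qed
  qed
qed

section \<open>Telescoping of the pair contributions\<close>

definition goe_density :: "nat \<Rightarrow> real \<Rightarrow> real" where
  "goe_density N = skew_density (N div 2) N (goe_basis N)"

lemma goe_law_linear_statistic:
  assumes "N \<ge> 1" and h: "h \<in> borel_measurable borel"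
    and int: "\<And>f. rapid f \<Longrightarrow> integrable lborel (\<lambda>t. h t * f t)"
  shows "(\<integral>y. goe_weight (1 / 4) N y \<partial>lebN {1..N}) \<noteq> 0" (is ?Z)
    and "(\<integral>y. (\<Sum>j\<in>{1..N}. h (y j)) \<partial>goe_law (1 / 4) N) = (LBINT t. h t * goe_density N t)" (is ?E)
proof -
  have "\<forall>i. \<exists>p. i < N \<longrightarrow> degree p < N \<and> (\<forall>t. goe_basis N i t = poly p t * exp (- (1 / 4) * t\<^sup>2))"
    using goe_basis_poly by blast
  then obtain p where p: "\<And>i. i < N \<Longrightarrow> degree (p i) < N"
      "\<And>i t. i < N \<Longrightarrow> goe_basis N i t = poly (p i) t * exp (- (1 / 4) * t\<^sup>2)"
    by metis
  have M: "2 * (N div 2) \<le> N" "N \<le> 2 * (N div 2) + 1"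
    by linarith+
  note stat = goe_linear_statistic[OF M assms(1) rapid_integrable p(2,1) goe_basis_skew goe_basis_integral h int]
  show ?Z by (rule stat(1)) (assumption | rule rapid_goe_basis)+
  show ?E unfolding goe_density_def by (rule stat(2)) (assumption | rule rapid_goe_basis)+
qed

text \<open>Consecutive values of \<open>herm_density\<close> of the same parity differ by one \<open>pair_density\<close>. Since
  \<open>sgn_conv f / 2\<close> is the antiderivative of \<open>f\<close> with opposite limits at \<open>\<plusminus>\<infinity>\<close>, the last factor in
  \<open>herm_density\<close> is the \<open>\<theta>\<close> of the introduction, normalised in the same way.\<close>

definition herm_density :: "nat \<Rightarrow> real \<Rightarrow> real" where
  "herm_density n t = ((hermf' n t)\<^sup>2 - (t\<^sup>2 / 4 - real n - 1 / 2) * (hermf n t)\<^sup>2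
     + hermf n t * (sgn_conv (hermf (Suc n)) t / 4 + hermf n t / 2)) / herm_norm n"

text \<open>The contribution to \<open>skew_density\<close> of the pair formed by
  \<open>hermf k\<close> and its normalised derivative.\<close>

definition pair_density :: "nat \<Rightarrow> real \<Rightarrow> real" where
  "pair_density k t = ((hermf k t)\<^sup>2 - hermf' k t * sgn_conv (hermf k) t / 2) / herm_norm k"

lemma herm_density_Suc_Suc: "herm_density (Suc (Suc n)) t = herm_density n t + pair_density (Suc n) t"
proof -
  define u v S \<nu> k where "u = hermf n t" and "v = hermf (Suc n) t" and "S = sgn_conv (hermf (Suc n)) t"
    and "\<nu> = herm_norm n" and "k = real n"
  have \<nu>: "\<nu> > 0" and k: "k \<ge> 0" using herm_norm_pos by (auto simp: \<nu>_def k_def)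
  have n: "herm_norm (Suc n) = (k + 1) * \<nu>" "herm_norm (Suc (Suc n)) = (k + 2) * (k + 1) * \<nu>"
    by (simp_all add: herm_norm_Suc \<nu>_def k_def algebra_simps)
  have h2: "hermf (Suc (Suc n)) t = t * v - (k + 1) * u"
    by (simp add: u_def v_def k_def add.commute)
  have d: "hermf' n t = t / 2 * u - v" "hermf' (Suc n) t = (k + 1) * u - t / 2 * v"
    "hermf' (Suc (Suc n)) t = (k + 2) * v - t / 2 * (t * v - (k + 1) * u)"
    by (simp_all add: hermf'_def[of n] hermf'_Suc h2 u_def v_def k_def algebra_simps del: hermf.simps(3))
  have S: "sgn_conv (hermf (Suc (Suc (Suc n)))) t = (k + 2) * S - 4 * (t * v - (k + 1) * u)"
    unfolding sgn_conv_hermf_Suc_Suc[of "Suc n"] h2 by (simp add: S_def k_def algebra_simps)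
  have kk: "real (Suc (Suc n)) = k + 2" by (simp add: k_def)
  \<comment> \<open>With all functions expressed through two neighbouring Hermite functions
    \<open>u\<close>, \<open>v\<close> and the convolution \<open>S\<close>, the claim is a
    polynomial identity between the three numerators; the norms differ only by the factors
    \<open>k + 1\<close> and \<open>k + 2\<close>.\<close>
  define A B C where "A = ((k + 2) * v - t / 2 * (t * v - (k + 1) * u))\<^sup>2
        - (t\<^sup>2 / 4 - (k + 2) - 1 / 2) * (t * v - (k + 1) * u)\<^sup>2
        + (t * v - (k + 1) * u) * (((k + 2) * S - 4 * (t * v - (k + 1) * u)) / 4 + (t * v - (k + 1) * u) / 2)"
    and "B = (t / 2 * u - v)\<^sup>2 - (t\<^sup>2 / 4 - k - 1 / 2) * u\<^sup>2 + u * (S / 4 + u / 2)"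
    and "C = v\<^sup>2 - ((k + 1) * u - t / 2 * v) * S / 2"
  have "A = (k + 2) * (k + 1) * B + (k + 2) * C"
    unfolding A_def B_def C_def
    by (simp add: algebra_simps power2_eq_square add_divide_distrib diff_divide_distrib)
  then have "A / ((k + 2) * (k + 1) * \<nu>) = B / \<nu> + C / ((k + 1) * \<nu>)"
    using \<nu> k by (simp add: add_divide_distrib)
  then show ?thesis
    unfolding herm_density_def pair_density_def n d S h2 kk u_def[symmetric] v_def[symmetric] S_def[symmetric]
      \<nu>_def[symmetric] k_def[symmetric] A_def B_def C_def .
qed

lemma herm_density_0: "herm_density 0 t = 0"
  unfolding herm_density_def sgn_conv_hermf_1 hermf'_def hermf.simps(2)
  by (simp add: algebra_simps power2_eq_square)

lemma herm_density_1: "herm_density (Suc 0) t = pair_density 0 t"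
proof -
  have n: "herm_norm (Suc 0) = herm_norm 0"
    by (simp add: herm_norm_Suc)
  have S: "sgn_conv (hermf (Suc (Suc 0))) t = sgn_conv (hermf 0) t - 4 * (t * hermf 0 t)"
    unfolding sgn_conv_hermf_Suc_Suc by simp
  show ?thesis
    unfolding herm_density_def pair_density_def n S hermf'_Suc hermf'_def[of 0] hermf.simps(2)
    by (simp add: algebra_simps power2_eq_square diff_divide_distrib add_divide_distrib del: hermf.simps)
qed

lemma sum_pair_density_odd: "(\<Sum>i<(M :: nat). pair_density (2 * i + 1) t) = herm_density (2 * M) t"
  by (induction M) (auto simp: herm_density_0 herm_density_Suc_Suc)

lemma sum_pair_density_even: "(\<Sum>i<Suc (M :: nat). pair_density (2 * i) t) = herm_density (2 * M + 1) t"
  by (induction M) (auto simp: herm_density_1 herm_density_Suc_Suc)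

lemma goe_density_eq_sum:
  "goe_density N t = (\<Sum>i<N div 2. pair_density (2 * i + N mod 2) t)
     + (if odd N then hermf (N - 1) t / (LBINT t. hermf (N - 1) t) else 0)"
proof -
  have "goe_basis N (2 * i + 1) t * sgn_conv (goe_basis N (2 * i)) t
      - goe_basis N (2 * i) t * sgn_conv (goe_basis N (2 * i + 1)) t = pair_density (2 * i + N mod 2) t"
    if "i < N div 2" for i
    unfolding goe_basis_even[OF that] goe_basis_odd[OF that] sgn_conv_cmult sgn_conv_hermf' pair_density_def
    using herm_norm_pos[of "2 * i + N mod 2"] by (simp add: field_simps power2_eq_square del: hermf.simps)
  moreover have "(\<Sum>j\<in>{2 * (N div 2)..<N}. goe_basis N j t)
      = (if odd N then hermf (N - 1) t / (LBINT t. hermf (N - 1) t) else 0)"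
  proof (cases "odd N")
    case True
    then have "{2 * (N div 2)..<N} = {2 * (N div 2)}" "2 * (N div 2) = N - 1"
      by (auto elim!: oddE)
    then show ?thesis using True goe_basis_last[of N] by simp
  next
    case False
    then have "{2 * (N div 2)..<N} = {}" by (auto elim!: evenE)
    then show ?thesis using False by simp
  qed
  ultimately show ?thesis
    unfolding goe_density_def skew_density_def by simp
qed

lemma goe_density_closed_form:
  assumes "N \<ge> 1"
  obtains \<theta> B where
    "\<And>t. goe_density N t = ((hermf' (N - 1) t)\<^sup>2 - (t\<^sup>2 / 4 - real N + 1 / 2) * (hermf (N - 1) t)\<^sup>2
            + hermf (N - 1) t * \<theta> t) / herm_norm (N - 1)"
    "\<And>t. (\<theta> has_real_derivative t * hermf (N - 1) t / 4) (at t)"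
    "\<And>t. \<bar>\<theta> t\<bar> \<le> B"
proof -
  define n where "n = N - 1"
  have N: "N = Suc n" using assms by (simp add: n_def)
  define c where "c = (if odd N then 1 / (LBINT t. hermf n t) else 0)"
  \<comment> \<open>The unpaired function present for odd \<open>N\<close> is a multiple of
    \<open>hermf n\<close>, so it is absorbed into the constant of integration.\<close>
  define \<theta> where "\<theta> t = sgn_conv (hermf (Suc n)) t / 4 + hermf n t / 2 + c * herm_norm n" for t
  have "goe_density N t = herm_density n t + c * hermf n t" for t
  proof (cases "odd N")
    case True
    then obtain M where "N = 2 * M + 1" by (elim oddE)
    then show ?thesis
      using True N sum_pair_density_odd[where M = M and t = t] by (simp add: goe_density_eq_sum c_def)
  next
    case False
    then obtain b where b: "N = 2 * b" by (blast elim: evenE)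
    then obtain M where "N = 2 * Suc M" using assms by (cases b) auto
    then show ?thesis
      using False N sum_pair_density_even[where M = M and t = t] by (simp add: goe_density_eq_sum c_def)
  qed
  then have "goe_density N t = herm_density n t + c * hermf n t" for t .
  also have "herm_density n t + c * hermf n t = ((hermf' n t)\<^sup>2 - (t\<^sup>2 / 4 - real N + 1 / 2) * (hermf n t)\<^sup>2
            + hermf n t * \<theta> t) / herm_norm n" for t
    using herm_norm_pos[of n] by (simp add: herm_density_def \<theta>_def N field_simps)
  finally have 1: "goe_density N t = ((hermf' n t)\<^sup>2 - (t\<^sup>2 / 4 - real N + 1 / 2) * (hermf n t)\<^sup>2
            + hermf n t * \<theta> t) / herm_norm n" for t .
  \<comment> \<open>The terms in \<open>hermf (Suc n)\<close> cancel; this is the purpose of the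
    summand \<open>hermf n t / 2\<close>.\<close>
  have 2: "(\<theta> has_real_derivative t * hermf n t / 4) (at t)" for t
  proof -
    have "(\<theta> has_real_derivative 2 * hermf (Suc n) t / 4 + hermf' n t / 2 + 0) (at t)"
      unfolding \<theta>_def
      by (intro DERIV_add DERIV_cdivide DERIV_const hermf_derivative sgn_conv_has_derivative
            rapid_continuous rapid_integrable rapid_hermf)
    then show ?thesis by (simp add: hermf'_def field_simps del: hermf.simps)
  qed
  obtain C where C: "\<And>t. \<bar>hermf n t\<bar> \<le> C"
    using rapid_bounded[OF rapid_hermf] by blast
  have "\<bar>\<theta> t\<bar> \<le> (LBINT t. \<bar>hermf (Suc n) t\<bar>) / 4 + C / 2 + \<bar>c * herm_norm n\<bar>" for t
    using sgn_conv_bounded[OF rapid_integrable[OF rapid_hermf[of "Suc n"]], of t] C[of t]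
    unfolding \<theta>_def by linarith
  with 1 2 show thesis
    by (intro that[of \<theta>]) (simp_all add: n_def)
qed

section \<open>The differential equation of the density\<close>

text \<open>The operator of the theorem for \<open>g = N = n\<close>, that is for the weight \<open>exp (- t\<^sup>2 / 4)\<close>.\<close>

definition goe_operator :: "real \<Rightarrow> (nat \<Rightarrow> real \<Rightarrow> real) \<Rightarrow> real \<Rightarrow> real" where
  "goe_operator n R t = - 4 * R 5 t + 5 * (t\<^sup>2 - (4 * n - 2)) * R 3 t - 6 * t * R 2 t
     + (- (t ^ 4) + (8 * n - 4) * t\<^sup>2 + (- 16 * n\<^sup>2 + 16 * n + 2)) * R 1 t
     + t * (t\<^sup>2 - (4 * n - 2)) * R 0 t"

text \<open>One family \<open>R\<close> carries the density and its derivatives, so that the moments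
  and the Stieltjes transform can be treated with the same data. The last conclusion is what later
  yields the second moment.\<close>

lemma goe_density_derivatives:
  assumes "N \<ge> 1"
  obtains R :: "nat \<Rightarrow> real \<Rightarrow> real" where
    "R 0 = goe_density N"
    "\<And>k t. k < 5 \<Longrightarrow> (R k has_real_derivative R (Suc k) t) (at t)"
    "\<And>k. k \<le> 5 \<Longrightarrow> rapid (R k)"
    "\<And>t. goe_operator N R t = 0"
    "(LBINT t. t\<^sup>2 * R 0 t) = (4 * real N - 2) * (LBINT t. R 0 t) + (3 / 4 - 3 * (real N - 1 / 2)\<^sup>2)"
proof -
  obtain \<theta> B where dens: "\<And>t. goe_density N t
          = ((hermf' (N - 1) t)\<^sup>2 - (t\<^sup>2 / 4 - real N + 1 / 2) * (hermf (N - 1) t)\<^sup>2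
            + hermf (N - 1) t * \<theta> t) / herm_norm (N - 1)"
    and \<theta>: "\<And>t. (\<theta> has_real_derivative t * hermf (N - 1) t / 4) (at t)"
    and B: "\<And>t. \<bar>\<theta> t\<bar> \<le> B"
    using goe_density_closed_form[OF assms] by blast
  define f p \<nu> where "f = hermf (N - 1)" and "p = hermf' (N - 1)" and "\<nu> = herm_norm (N - 1)"
  define q where "q t = t\<^sup>2 / 4 - real N + 1 / 2" for t :: real
  have \<nu>: "\<nu> > 0" by (simp add: \<nu>_def herm_norm_pos)
  have f: "(f has_real_derivative p t) (at t)" for t
    unfolding f_def p_def by (rule hermf_derivative)
  have p: "(p has_real_derivative q t * f t) (at t)" for t
    using hermf'_derivative[of "N - 1" t] assms by (simp add: f_def p_def q_def of_nat_diff algebra_simps)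
  have \<theta>: "(\<theta> has_real_derivative t * f t / 4) (at t)" for t
    unfolding f_def by (rule \<theta>)
  have q: "(q has_real_derivative t / 2) (at t)" for t
    unfolding q_def by (auto intro!: derivative_eq_intros)
  \<comment> \<open>The successive derivatives, each reduced to the five basic products by
    \<open>f' = p\<close>, \<open>p' = q * f\<close> and
    \<open>\<theta>' = t * f / 4\<close>.\<close>
  define A0 where "A0 t = (p t)\<^sup>2 - q t * (f t)\<^sup>2 + f t * \<theta> t" for t
  define A1 where "A1 t = p t * \<theta> t - t * (f t)\<^sup>2 / 4" for t
  define A2 where "A2 t = q t * f t * \<theta> t - t * f t * p t / 4 - (f t)\<^sup>2 / 4" for t
  define A3 where "A3 t = t / 2 * f t * \<theta> t + q t * p t * \<theta> t - 3 / 4 * f t * p t - t * (p t)\<^sup>2 / 4" for t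
  define A4 where "A4 t = (1 / 2 + (q t)\<^sup>2) * f t * \<theta> t + t * p t * \<theta> t
      + (t\<^sup>2 / 8 - 3 / 4 * q t) * (f t)\<^sup>2 - t / 4 * q t * f t * p t - (p t)\<^sup>2" for t
  define A5 where "A5 t = 2 * q t * t * f t * \<theta> t + (3 / 2 + (q t)\<^sup>2) * p t * \<theta> t
      + (3 / 8 * t\<^sup>2 - 15 / 4 * q t) * f t * p t - t / 4 * q t * (p t)\<^sup>2" for t
  define R where "R k = (\<lambda>t. ([A0, A1, A2, A3, A4, A5] ! k) t / \<nu>)" for k
  note D = f p \<theta> q
  have d0: "(A0 has_real_derivative A1 t) (at t)" for t
    unfolding A0_def
    by (rule derivative_eq_intros D refl)+ (simp add: A1_def algebra_simps power2_eq_square)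
  have d1: "(A1 has_real_derivative A2 t) (at t)" for t
    unfolding A1_def
    by (rule derivative_eq_intros D refl | simp)+ (simp add: A2_def algebra_simps power2_eq_square)
  have d2: "(A2 has_real_derivative A3 t) (at t)" for t
    unfolding A2_def
    by (rule derivative_eq_intros D refl | simp)+ (simp add: A3_def algebra_simps power2_eq_square)
  have d3: "(A3 has_real_derivative A4 t) (at t)" for t
    unfolding A3_def
    by (rule derivative_eq_intros D refl | simp)+ (simp add: A4_def algebra_simps power2_eq_square)
  have d4: "(A4 has_real_derivative A5 t) (at t)" for t
    unfolding A4_def
    by (rule derivative_eq_intros D refl | simp)+ (simp add: A5_def algebra_simps power2_eq_square)
  have rf: "rapid f" and rp: "rapid p"
    by (simp_all add: f_def p_def rapid_hermf rapid_hermf')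
  have c\<theta>: "continuous_on UNIV \<theta>"
    using \<theta> by (intro DERIV_continuous_on) (rule DERIV_subset, auto)
  have rf\<theta>: "rapid (\<lambda>t. f t * \<theta> t)" and rp\<theta>: "rapid (\<lambda>t. p t * \<theta> t)"
    using rapid_mult_bounded[OF rf c\<theta> B] rapid_mult_bounded[OF rp c\<theta> B] by auto
  have rff: "rapid (\<lambda>t. (f t)\<^sup>2)" and rfp: "rapid (\<lambda>t. f t * p t)" and rpp: "rapid (\<lambda>t. (p t)\<^sup>2)"
    using rapid_mult[OF rf rf] rapid_mult[OF rf rp] rapid_mult[OF rp rp] by (simp_all add: power2_eq_square)
  have rq: "rapid (\<lambda>t. q t * h t)" if "rapid h" for h
  proof -
    have "rapid (\<lambda>t. 1 / 4 * (t ^ 2 * h t) + (1 / 2 - real N) * h t)"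
      using that by (intro rapid_add rapid_cmult rapid_power_mult)
    moreover have "(\<lambda>t. 1 / 4 * (t ^ 2 * h t) + (1 / 2 - real N) * h t) = (\<lambda>t. q t * h t)"
      by (auto simp: q_def algebra_simps)
    ultimately show ?thesis by simp
  qed
  note rapids = rapid_add rapid_diff rapid_cmult rapid_power_mult rapid_mult_ident rq rf\<theta> rp\<theta> rff rfp rpp
  have r0: "rapid A0"
  proof -
    have "rapid (\<lambda>t. (p t)\<^sup>2 - q t * (f t)\<^sup>2 + f t * \<theta> t)"
      by (intro rapids)
    then show ?thesis by (simp add: A0_def[abs_def])
  qed
  have r1: "rapid A1"
  proof -
    have "rapid (\<lambda>t. p t * \<theta> t - 1 / 4 * (t * (f t)\<^sup>2))"
      by (intro rapids)
    then show ?thesis by (simp add: A1_def[abs_def])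
  qed
  have r2: "rapid A2"
  proof -
    have "rapid (\<lambda>t. q t * (f t * \<theta> t) - 1 / 4 * (t * (f t * p t)) - 1 / 4 * (f t)\<^sup>2)"
      by (intro rapids)
    then show ?thesis by (simp add: A2_def[abs_def] mult_ac)
  qed
  have r3: "rapid A3"
  proof -
    have "rapid (\<lambda>t. 1 / 2 * (t * (f t * \<theta> t)) + q t * (p t * \<theta> t) - 3 / 4 * (f t * p t) - 1 / 4 * (t * (p t)\<^sup>2))"
      by (intro rapids)
    then show ?thesis by (simp add: A3_def[abs_def] mult_ac)
  qed
  have r4: "rapid A4"
  proof -
    have "rapid (\<lambda>t. 1 / 2 * (f t * \<theta> t) + q t * (q t * (f t * \<theta> t)) + t * (p t * \<theta> t)
      + 1 / 8 * (t ^ 2 * (f t)\<^sup>2) - 3 / 4 * (q t * (f t)\<^sup>2) - 1 / 4 * (t * (q t * (f t * p t))) - (p t)\<^sup>2)"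
      by (intro rapids)
    then show ?thesis
      by (rule back_subst[of rapid]) (auto simp: A4_def algebra_simps power2_eq_square)
  qed
  have r5: "rapid A5"
  proof -
    have "rapid (\<lambda>t. 2 * (t * (q t * (f t * \<theta> t))) + 3 / 2 * (p t * \<theta> t) + q t * (q t * (p t * \<theta> t))
      + 3 / 8 * (t ^ 2 * (f t * p t)) - 15 / 4 * (q t * (f t * p t)) - 1 / 4 * (t * (q t * (p t)\<^sup>2)))"
      by (intro rapids)
    then show ?thesis
      by (rule back_subst[of rapid]) (auto simp: A5_def algebra_simps power2_eq_square)
  qed
  have "R 0 = goe_density N"
    by (auto simp: R_def A0_def dens f_def p_def q_def \<nu>_def)
  moreover have "(R k has_real_derivative R (Suc k) t) (at t)" if "k < 5" for k t
  proof -
    have "k \<in> {0, 1, 2, 3, 4}" using that by auto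
    then have "([A0, A1, A2, A3, A4, A5] ! k has_real_derivative ([A0, A1, A2, A3, A4, A5] ! Suc k) t) (at t)"
      using d0 d1 d2 d3 d4 by (auto simp: eval_nat_numeral)
    then show ?thesis
      unfolding R_def by (rule DERIV_cdivide)
  qed
  moreover have "rapid (R k)" if "k \<le> 5" for k
  proof -
    have "k \<in> {0, 1, 2, 3, 4, 5}" using that by auto
    then have "rapid ([A0, A1, A2, A3, A4, A5] ! k)"
      using r0 r1 r2 r3 r4 r5 by (auto simp: eval_nat_numeral)
    then show ?thesis
      using rapid_cmult[of _ "1 / \<nu>"] by (simp add: R_def)
  qed
  moreover have "goe_operator N R t = 0" for t
  proof -
    \<comment> \<open>With \<open>q\<close> left unexpanded, the coefficient of each of the five
      products \<open>f * \<theta>\<close>, \<open>p * \<theta>\<close>, \<open>f^2\<close>,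
      \<open>f * p\<close> and \<open>p^2\<close> vanishes separately.\<close>
    have E: "- 4 * A5 t + 5 * (4 * q t) * A3 t - 6 * t * A2 t + (6 - 16 * (q t)\<^sup>2) * A1 t + t * (4 * q t) * A0 t = 0"
      unfolding A0_def A1_def A2_def A3_def A5_def by (simp add: field_simps power2_eq_square)
    have q1: "4 * q t = t\<^sup>2 - (4 * real N - 2)"
      and q2: "6 - 16 * (q t)\<^sup>2 = - (t ^ 4) + (8 * real N - 4) * t\<^sup>2 + (- 16 * (real N)\<^sup>2 + 16 * real N + 2)"
      by (simp_all add: q_def field_simps power2_eq_square power4_eq_xxxx)
    have "- 4 * A5 t + 5 * (t\<^sup>2 - (4 * real N - 2)) * A3 t - 6 * t * A2 t
      + (- (t ^ 4) + (8 * real N - 4) * t\<^sup>2 + (- 16 * (real N)\<^sup>2 + 16 * real N + 2)) * A1 t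
      + t * (t\<^sup>2 - (4 * real N - 2)) * A0 t = 0"
      using E unfolding q1 q2 .
    moreover have "goe_operator N R t = (- 4 * A5 t + 5 * (t\<^sup>2 - (4 * real N - 2)) * A3 t - 6 * t * A2 t
      + (- (t ^ 4) + (8 * real N - 4) * t\<^sup>2 + (- 16 * (real N)\<^sup>2 + 16 * real N + 2)) * A1 t
      + t * (t\<^sup>2 - (4 * real N - 2)) * A0 t) / \<nu>"
    proof -
      have R: "R 0 t = A0 t / \<nu>" "R 1 t = A1 t / \<nu>" "R 2 t = A2 t / \<nu>" "R 3 t = A3 t / \<nu>" "R 5 t = A5 t / \<nu>"
        by (simp_all add: R_def)
      show ?thesis
        unfolding goe_operator_def R
        by (simp only: times_divide_eq_right add_divide_distrib[symmetric] diff_divide_distrib[symmetric])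
    qed
    ultimately show ?thesis by simp
  qed
  moreover have "(LBINT t. t\<^sup>2 * R 0 t)
      = (4 * real N - 2) * (LBINT t. R 0 t) + (3 / 4 - 3 * (real N - 1 / 2)\<^sup>2)"
  proof -
    define \<kappa> where "\<kappa> = real N - 1 / 2"
    define b where "b t = (p t)\<^sup>2 - q t * (f t)\<^sup>2" for t
    \<comment> \<open>Since \<open>4 * q = t^2 - 4 * \<kappa>\<close>, the derivative of
      \<open>4 * p * \<theta>\<close> contains \<open>(t^2 - 4 * \<kappa>) * f * \<theta>\<close>;
      this dictates which combination of moments can be integrated. The remaining terms of
      \<open>V\<close> reduce \<open>t^2 * b\<close> and \<open>b\<close> to multiples of
      \<open>f^2\<close>, by means of \<open>b' = - t * f^2 / 2\<close> and
      \<open>(f * p)' = b + 2 * q * f^2\<close>.\<close>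
    define V where "V t = (t ^ 3 * b t + t\<^sup>2 * (f t * p t) - t * (f t)\<^sup>2 - 2 * \<kappa> * (t * b t - f t * p t)) / 4
       - 4 * \<kappa> * (f t * p t / 2 + t * b t / 2) + 4 * (p t * \<theta> t) - t * (f t)\<^sup>2 / 2" for t
    define v where "v t = t\<^sup>2 * A0 t - 4 * \<kappa> * A0 t - (3 / 4 - 3 * \<kappa>\<^sup>2) * (f t)\<^sup>2" for t
    have qk: "q t = t\<^sup>2 / 4 - \<kappa>" for t by (simp add: q_def \<kappa>_def)
    have db: "(b has_real_derivative - t / 2 * (f t)\<^sup>2) (at t)" for t
      unfolding b_def
      by (rule derivative_eq_intros D refl)+ (simp add: algebra_simps power2_eq_square)
    have "(V has_real_derivative v t) (at t)" for t
      unfolding V_def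
      by (rule derivative_eq_intros D db refl | simp)+
         (simp add: v_def A0_def b_def qk algebra_simps power2_eq_square power3_eq_cube add_divide_distrib diff_divide_distrib)
    moreover have "rapid V"
    proof -
      have rb: "rapid b" unfolding b_def[abs_def] by (intro rapids)
      have "rapid (\<lambda>t. 1 / 4 * (t ^ 3 * b t + t ^ 2 * (f t * p t) - t * (f t)\<^sup>2 - 2 * \<kappa> * (t * b t - f t * p t))
       - 4 * \<kappa> * (1 / 2 * (f t * p t) + 1 / 2 * (t * b t)) + 4 * (p t * \<theta> t) - 1 / 2 * (t * (f t)\<^sup>2))"
        by (intro rapids rb)
      then show ?thesis by (simp add: V_def[abs_def])
    qed
    moreover have "rapid v"
      unfolding v_def[abs_def] by (intro rapids r0)
    ultimately have "(LBINT t. v t) = 0"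
      by (rule rapid_integral_derivative)
    moreover have "(LBINT t. v t) = (LBINT t. t\<^sup>2 * A0 t) - 4 * \<kappa> * (LBINT t. A0 t) - (3 / 4 - 3 * \<kappa>\<^sup>2) * \<nu>"
    proof -
      have i: "integrable lborel (\<lambda>t. t\<^sup>2 * A0 t)" "integrable lborel A0" "integrable lborel (\<lambda>t. (f t)\<^sup>2)"
        by (intro rapid_integrable rapids r0)+
      have "(LBINT t. (f t)\<^sup>2) = \<nu>" by (simp add: f_def \<nu>_def herm_norm_def)
      then show ?thesis
        unfolding v_def using i by simp
    qed
    ultimately have "(LBINT t. t\<^sup>2 * A0 t) = 4 * \<kappa> * (LBINT t. A0 t) + (3 / 4 - 3 * \<kappa>\<^sup>2) * \<nu>"
      by simp
    moreover have "(LBINT t. t\<^sup>2 * R 0 t) = (LBINT t. t\<^sup>2 * A0 t) / \<nu>"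
      "(LBINT t. R 0 t) = (LBINT t. A0 t) / \<nu>"
      by (simp_all add: R_def)
    moreover have "4 * \<kappa> = 4 * real N - 2" by (simp add: \<kappa>_def)
    ultimately show ?thesis
      using \<nu> by (simp add: \<kappa>_def[symmetric] add_divide_distrib)
  qed
  ultimately show thesis by (rule that)
qed

lemma rapid_moment_derivative:
  assumes R: "\<And>t. (f has_real_derivative f' t) (at t)" "rapid f" "rapid f'"
  shows "(LBINT t. t ^ j * f' t) = - real j * (LBINT t. t ^ (j - 1) * f t)"
proof -
  have "((\<lambda>t. t ^ j * f t) has_real_derivative real j * (t ^ (j - 1) * f t) + t ^ j * f' t) (at t)" for t
    by (rule derivative_eq_intros R(1) refl | simp)+
  then have "(LBINT t. real j * (t ^ (j - 1) * f t) + t ^ j * f' t) = 0"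
    by (rule rapid_integral_derivative) (intro rapid_add rapid_cmult rapid_power_mult R)+
  moreover have "integrable lborel (\<lambda>t. t ^ (j - 1) * f t)" "integrable lborel (\<lambda>t. t ^ j * f' t)"
    by (intro rapid_integrable rapid_power_mult R)+
  ultimately show ?thesis by simp
qed

section \<open>Moments and Stieltjes transforms\<close>

lemma goe_moment_eq_integral:
  assumes "N \<ge> 1"
  shows "goe_moment N k = (LBINT t. t ^ k * goe_density N t)"
  unfolding goe_moment_def
  by (rule goe_law_linear_statistic[OF assms]) (auto intro: rapid_integrable rapid_power_mult)

lemma finite_measure_goe_law:
  assumes "N \<ge> 1"
  shows "finite_measure (goe_law (1 / 4) N)"
proof (rule finite_measureI)
  define Z where "Z = (\<integral>y. goe_weight (1 / 4) N y \<partial>lebN {1..N})"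
  have "Z \<noteq> 0"
    unfolding Z_def by (rule goe_law_linear_statistic(1)[OF assms, of "\<lambda>_. 1"]) (auto intro: rapid_integrable)
  \<comment> \<open>The integral of a function that is not integrable is 0 by convention, so a
    nonzero value certifies integrability.\<close>
  then have "integrable (lebN {1..N}) (goe_weight (1 / 4) N)"
    unfolding Z_def by (metis not_integrable_integral_eq)
  then have int: "integrable (lebN {1..N}) (\<lambda>y. goe_weight (1 / 4) N y / Z)"
    by simp
  have "Z \<ge> 0"
    unfolding Z_def by (intro Bochner_Integration.integral_nonneg goe_weight_nonneg)
  have [measurable]: "goe_weight (1 / 4) N \<in> borel_measurable (lebN {1..N})"
    by (rule goe_weight_measurable)
  have m: "(\<lambda>y. ennreal (goe_weight (1 / 4) N y / Z)) \<in> borel_measurable (lebN {1..N})"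
    by measurable
  have "emeasure (goe_law (1 / 4) N) (space (goe_law (1 / 4) N)) = (\<integral>\<^sup>+y. ennreal (goe_weight (1 / 4) N y / Z) \<partial>lebN {1..N})"
    unfolding goe_law_def Let_def Z_def[symmetric]
    by (subst emeasure_density[OF m]) (auto intro!: nn_integral_cong simp: indicator_def)
  also have "\<dots> = ennreal (\<integral>y. goe_weight (1 / 4) N y / Z \<partial>lebN {1..N})"
    using int \<open>Z \<ge> 0\<close> by (intro nn_integral_eq_integral) (auto intro!: divide_nonneg_nonneg goe_weight_nonneg)
  finally show "emeasure (goe_law (1 / 4) N) (space (goe_law (1 / 4) N)) \<noteq> \<infinity>"
    by simp
qed

lemma goe_law_measurable: "borel_measurable (goe_law a N) = borel_measurable (lebN {1..N})"
  unfolding goe_law_def Let_def by (rule measurable_cong_sets) simp_all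

lemma goe_moment_0:
  assumes "N \<ge> 1"
  shows "goe_moment N 0 = real N"
proof -
  have "(\<integral>y. goe_weight (1 / 4) N y \<partial>lebN {1..N}) \<noteq> 0"
    by (rule goe_law_linear_statistic(1)[OF assms, of "\<lambda>_. 1"]) (auto intro: rapid_integrable)
  then show ?thesis
    unfolding goe_moment_def by (subst integral_goe_law) auto
qed

text \<open>Reflection of all eigenvalues preserves the law.\<close>

lemma goe_moment_odd:
  assumes "odd k"
  shows "goe_moment N k = 0"
proof -
  have meas: "(\<lambda>y. \<Sum>j\<in>{1..N}. y j ^ k) \<in> borel_measurable (lebN {1..N})"
    by (rule linear_statistic_measurable[where h = "\<lambda>t. t ^ k"]) simp
  have "goe_moment N k = (\<integral>y. (\<Sum>j\<in>{1..N}. (\<lambda>i\<in>{1..N}. - 1 * y i) j ^ k) \<partial>goe_law (1 / 4) N)"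
    unfolding goe_moment_def using integral_goe_law_scale[OF _ meas, of "-1" "1 / 4"] by simp
  also have "\<dots> = (\<integral>y. - (\<Sum>j\<in>{1..N}. y j ^ k) \<partial>goe_law (1 / 4) N)"
    using assms by (simp add: sum_negf)
  also have "\<dots> = - goe_moment N k"
    by (simp add: goe_moment_def)
  finally show ?thesis by simp
qed

text \<open>The real result is applied to real and imaginary parts. Splitting the complex integral
  requires integrability, which boundedness provides because the law is a finite measure.\<close>

lemma goe_law_linear_statistic_complex:
  fixes F :: "real \<Rightarrow> complex"
  assumes "N \<ge> 1" and F[measurable]: "F \<in> borel_measurable borel" and bd: "\<And>t. norm (F t) \<le> C"
  shows "(\<integral>y. (\<Sum>j\<in>{1..N}. F (y j)) \<partial>goe_law (1 / 4) N) = (LBINT t. F t * of_real (goe_density N t))"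
proof -
  interpret finite_measure "goe_law (1 / 4) N"
    by (rule finite_measure_goe_law[OF assms(1)])
  obtain R :: "nat \<Rightarrow> real \<Rightarrow> real" where "R 0 = goe_density N" "\<And>k. k \<le> 5 \<Longrightarrow> rapid (R k)"
    by (rule goe_density_derivatives[OF assms(1)]) (rule that)
  then have rapid: "rapid (goe_density N)" by (metis zero_le)
  have int: "integrable (goe_law (1 / 4) N) (\<lambda>y. \<Sum>j\<in>{1..N}. F (y j))"
  proof (rule integrable_const_bound)
    show "AE y in goe_law (1 / 4) N. norm (\<Sum>j\<in>{1..N}. F (y j)) \<le> (\<Sum>j\<in>{1..N}. C)"
      by (intro AE_I2 order.trans[OF norm_sum] sum_mono bd)
    show "(\<lambda>y. \<Sum>j\<in>{1..N}. F (y j)) \<in> borel_measurable (goe_law (1 / 4) N)"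
      unfolding goe_law_measurable by (rule linear_statistic_measurable) simp
  qed
  have bounded_int: "integrable lborel (\<lambda>t. h t * f t)"
    if "rapid f" "h \<in> borel_measurable borel" "\<And>t. \<bar>h t\<bar> \<le> C" for f h :: "real \<Rightarrow> real"
  proof (rule Bochner_Integration.integrable_bound)
    show "integrable lborel (\<lambda>t. C * f t)" using rapid_integrable[OF that(1)] by simp
    show "(\<lambda>t. h t * f t) \<in> borel_measurable lborel"
      using that by measurable
    show "AE t in lborel. norm (h t * f t) \<le> norm (C * f t)"
      using that(3) by (intro AE_I2) (simp add: abs_mult mult_right_mono order.trans[OF that(3) abs_ge_self])
  qed
  have int': "integrable lborel (\<lambda>t. F t * of_real (goe_density N t))"
  proof (rule Bochner_Integration.integrable_bound)
    show "integrable lborel (\<lambda>t. C * goe_density N t)" using rapid_integrable[OF rapid] by simp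
    show "(\<lambda>t. F t * of_real (goe_density N t)) \<in> borel_measurable lborel"
      using rapid_measurable[OF rapid] by measurable
    show "AE t in lborel. norm (F t * of_real (goe_density N t)) \<le> norm (C * goe_density N t)"
      by (intro AE_I2) (simp add: norm_mult abs_mult mult_right_mono order.trans[OF bd abs_ge_self])
  qed
  have Re: "\<bar>Re (F t)\<bar> \<le> C" and Im: "\<bar>Im (F t)\<bar> \<le> C" for t
    using bd[of t] abs_Re_le_cmod[of "F t"] abs_Im_le_cmod[of "F t"] by linarith+
  have "(\<integral>y. (\<Sum>j\<in>{1..N}. Re (F (y j))) \<partial>goe_law (1 / 4) N) = (LBINT t. Re (F t) * goe_density N t)"
    by (rule goe_law_linear_statistic[OF assms(1)]) (auto intro!: bounded_int Re)
  moreover have "(\<integral>y. (\<Sum>j\<in>{1..N}. Im (F (y j))) \<partial>goe_law (1 / 4) N) = (LBINT t. Im (F t) * goe_density N t)"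
    by (rule goe_law_linear_statistic[OF assms(1)]) (auto intro!: bounded_int Im)
  ultimately show ?thesis
    using integral_Re[OF int] integral_Im[OF int] integral_Re[OF int'] integral_Im[OF int']
    by (intro complex_eqI) simp_all
qed

section \<open>Stieltjes transforms of rapidly decreasing functions\<close>

definition stieltjes :: "(real \<Rightarrow> real) \<Rightarrow> complex \<Rightarrow> complex" where
  "stieltjes f z = (LBINT t. of_real (f t) / (z - of_real t))"

lemma nonreal_Im: "z \<notin> \<real> \<longleftrightarrow> Im z \<noteq> 0"
  by (simp add: complex_is_Real_iff)

lemma Im_le_norm_diff_of_real: "\<bar>Im z\<bar> \<le> norm (z - of_real t)"
  using abs_Im_le_cmod[of "z - of_real t"] by simp

lemma integrable_stieltjes:
  assumes "rapid f" "z \<notin> \<real>"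
  shows "integrable lborel (\<lambda>t. of_real (f t) / (z - of_real t) :: complex)"
proof (rule Bochner_Integration.integrable_bound)
  show "integrable lborel (\<lambda>t. f t / \<bar>Im z\<bar>)" using rapid_integrable[OF assms(1)] by simp
  show "(\<lambda>t. of_real (f t) / (z - of_real t) :: complex) \<in> borel_measurable lborel"
    using rapid_measurable[OF assms(1)] by measurable
  show "AE t in lborel. norm (of_real (f t) / (z - of_real t)) \<le> norm (f t / \<bar>Im z\<bar>)"
    using assms(2) Im_le_norm_diff_of_real[of z]
    by (intro AE_I2) (auto simp: norm_divide nonreal_Im intro!: divide_left_mono mult_pos_pos elim: order.strict_trans2[rotated])
qed

lemma norm_stieltjes_le:
  assumes "rapid f" "z \<notin> \<real>"
  shows "norm (stieltjes f z) \<le> (LBINT t. \<bar>f t\<bar>) / \<bar>Im z\<bar>"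
proof -
  have "norm (stieltjes f z) \<le> (LBINT t. norm (of_real (f t) / (z - of_real t)))"
    unfolding stieltjes_def by (rule integral_norm_bound)
  also have "\<dots> \<le> (LBINT t. \<bar>f t\<bar> / \<bar>Im z\<bar>)"
  proof (rule integral_mono)
    show "integrable lborel (\<lambda>t. norm (of_real (f t) / (z - of_real t)))"
      by (intro integrable_norm integrable_stieltjes assms)
    show "integrable lborel (\<lambda>t. \<bar>f t\<bar> / \<bar>Im z\<bar>)"
      using rapid_integrable[OF assms(1)] by simp
    show "norm (of_real (f t) / (z - of_real t)) \<le> \<bar>f t\<bar> / \<bar>Im z\<bar>" for t
      using assms(2) Im_le_norm_diff_of_real[of z]
      by (auto simp: norm_divide nonreal_Im intro!: divide_left_mono mult_pos_pos elim: order.strict_trans2[rotated])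
  qed
  finally show ?thesis by simp
qed

lemma stieltjes_add:
  "rapid f \<Longrightarrow> rapid g \<Longrightarrow> z \<notin> \<real> \<Longrightarrow> stieltjes (\<lambda>t. f t + g t) z = stieltjes f z + stieltjes g z"
  unfolding stieltjes_def
  by (subst Bochner_Integration.integral_add[symmetric])
     (auto intro: integrable_stieltjes simp: add_divide_distrib)

lemma stieltjes_cmult: "stieltjes (\<lambda>t. c * f t) z = c *\<^sub>R stieltjes f z"
  by (simp add: stieltjes_def scaleR_conv_of_real flip: times_divide_eq_right)

text \<open>From \<open>z / (z - t) = 1 + t / (z - t)\<close>. The extra integral is the source of
  both the inhomogeneity of the differential equation and the terms of the expansion at
  infinity.\<close>

lemma mult_stieltjes:
  assumes "rapid f" "z \<notin> \<real>"
  shows "z * stieltjes f z = stieltjes (\<lambda>t. t * f t) z + of_real (LBINT t. f t)"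
proof -
  have nz: "z - of_real t \<noteq> 0" for t
    using assms(2) by auto
  have "z * stieltjes f z = (LBINT t. z * (of_real (f t) / (z - of_real t)))"
    unfolding stieltjes_def by (rule integral_mult_right_zero[symmetric])
  also have "\<dots> = (LBINT t. of_real (t * f t) / (z - of_real t) + of_real (f t))"
    by (intro Bochner_Integration.integral_cong refl) (use nz in \<open>simp add: field_simps\<close>)
  also have "\<dots> = stieltjes (\<lambda>t. t * f t) z + of_real (LBINT t. f t)"
    unfolding stieltjes_def using assms rapid_integrable[OF assms(1)]
    by (subst Bochner_Integration.integral_add)
       (auto intro!: integrable_stieltjes[of "\<lambda>t. t * f t", simplified] rapid_mult_ident)
  finally show ?thesis .
qed

lemma stieltjes_expansion:
  assumes "rapid f" "z \<notin> \<real>"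
  shows "stieltjes f z = (\<Sum>k<m. of_real (LBINT t. t ^ k * f t) / z ^ (k + 1))
           + stieltjes (\<lambda>t. t ^ m * f t) z / z ^ m"
proof (induction m)
  case 0
  then show ?case by simp
next
  case (Suc m)
  have "z \<noteq> 0" using assms(2) by auto
  have "stieltjes (\<lambda>t. t ^ m * f t) z
      = (stieltjes (\<lambda>t. t ^ Suc m * f t) z + of_real (LBINT t. t ^ m * f t)) / z"
    using mult_stieltjes[OF rapid_power_mult[OF assms(1)] assms(2), of m] \<open>z \<noteq> 0\<close>
    by (simp add: field_simps)
  then show ?case
    using Suc \<open>z \<noteq> 0\<close> by (simp add: field_simps)
qed

text \<open>Integration by parts: the derivative of \<open>f t / (z - t)\<close> in \<open>t\<close>
  is the sum of the two integrands, and the boundary values vanish.\<close>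

lemma stieltjes_square:
  assumes f: "\<And>t. (f has_real_derivative f' t) (at t)" and rapid: "rapid f" "rapid f'" and z: "z \<notin> \<real>"
  shows "integrable lborel (\<lambda>t. of_real (f t) / (z - of_real t)\<^sup>2 :: complex)"
    and "stieltjes f' z = - (LBINT t. of_real (f t) / (z - of_real t)\<^sup>2)"
proof -
  have nz: "z - of_real t \<noteq> 0" for t
    using z by auto
  have Im: "Im z \<noteq> 0" using z by (simp add: nonreal_Im)
  show int: "integrable lborel (\<lambda>t. of_real (f t) / (z - of_real t)\<^sup>2 :: complex)"
  proof (rule Bochner_Integration.integrable_bound)
    show "integrable lborel (\<lambda>t. f t / \<bar>Im z\<bar>\<^sup>2)" using rapid_integrable[OF rapid(1)] by simp
    show "(\<lambda>t. of_real (f t) / (z - of_real t)\<^sup>2 :: complex) \<in> borel_measurable lborel"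
      using rapid_measurable[OF rapid(1)] by measurable
    have "norm (of_real (f t) / (z - of_real t)\<^sup>2) \<le> \<bar>f t\<bar> / \<bar>Im z\<bar>\<^sup>2" for t
      unfolding norm_divide norm_power norm_of_real
      using Im Im_le_norm_diff_of_real[of z t] nz[of t]
      by (intro divide_left_mono power_mono mult_pos_pos zero_less_power) auto
    then show "AE t in lborel. norm (of_real (f t) / (z - of_real t)\<^sup>2) \<le> norm (f t / \<bar>Im z\<bar>\<^sup>2)"
      by (intro AE_I2) simp
  qed
  define F where "F t = of_real (f t) / (z - of_real t)" for t
  define F' where "F' t = of_real (f' t) / (z - of_real t) + of_real (f t) / (z - of_real t)\<^sup>2" for t
  have "(F has_vector_derivative F' t) (at t)" for t
  proof -
    have 1: "((\<lambda>t. of_real (f t)) has_vector_derivative of_real (f' t)) (at t)"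
      using f by (simp add: has_vector_derivative_of_real has_real_derivative_iff_has_vector_derivative)
    have 2: "((\<lambda>t. inverse (z - of_real t)) has_vector_derivative inverse ((z - of_real t)\<^sup>2)) (at t)"
    proof -
      have "((\<lambda>w. inverse (z - w)) has_field_derivative inverse ((z - of_real t)\<^sup>2)) (at (of_real t))"
        using nz[of t] by (auto intro!: derivative_eq_intros simp: power2_eq_square)
      moreover have "(of_real has_vector_derivative (1 :: complex)) (at t)"
        using has_vector_derivative_of_real[of "\<lambda>t. t" 1 "at t"] by simp
      ultimately show ?thesis
        using field_vector_diff_chain_at[of of_real 1 t "\<lambda>w. inverse (z - w)"] by (simp add: comp_def)
    qed
    show ?thesis
      using has_vector_derivative_mult[OF 1 2]
      by (simp add: F_def[abs_def] F'_def divide_inverse algebra_simps)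
  qed
  moreover have "continuous_on UNIV F'"
  proof -
    have "continuous_on UNIV f" "continuous_on UNIV f'" using rapid rapid_continuous by auto
    then show ?thesis
      unfolding F'_def[abs_def] using nz by (intro continuous_intros) auto
  qed
  moreover have "integrable lborel F'"
    unfolding F'_def[abs_def] using integrable_stieltjes[OF rapid(2) z] int by simp
  moreover have lim: "(F \<longlongrightarrow> 0) at_bot" "(F \<longlongrightarrow> 0) at_top"
  proof -
    have le: "norm (F t) \<le> \<bar>f t\<bar> / \<bar>Im z\<bar>" for t
      unfolding F_def norm_divide norm_of_real
      using Im Im_le_norm_diff_of_real[of z t] nz[of t] by (intro divide_left_mono mult_pos_pos) auto
    have l: "((\<lambda>t. \<bar>f t\<bar> / \<bar>Im z\<bar>) \<longlongrightarrow> 0) at_bot" "((\<lambda>t. \<bar>f t\<bar> / \<bar>Im z\<bar>) \<longlongrightarrow> 0) at_top"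
      using rapid_tendsto_0[OF rapid(1)] by (auto intro!: tendsto_divide_zero tendsto_rabs_zero)
    show "(F \<longlongrightarrow> 0) at_bot" "(F \<longlongrightarrow> 0) at_top"
      by (rule Lim_null_comparison[OF _ l(1)] Lim_null_comparison[OF _ l(2)]; simp add: le)+
  qed
  ultimately have "(LBINT t. F' t) = 0"
    using integral_FTC_UNIV[of F F' 0 0] by simp
  then show "stieltjes f' z = - (LBINT t. of_real (f t) / (z - of_real t)\<^sup>2)"
    unfolding F'_def stieltjes_def using integrable_stieltjes[OF rapid(2) z] int
    by (simp add: eq_neg_iff_add_eq_0)
qed

text \<open>After the integration by parts of \<open>stieltjes_square\<close>, the error of the
  difference quotient is \<open>w - z\<close> times an integral that stays bounded near
  \<open>z\<close>.\<close>

lemma stieltjes_has_derivative: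
  assumes f: "\<And>t. (f has_real_derivative f' t) (at t)" and rapid: "rapid f" "rapid f'" and z: "z \<notin> \<real>"
  shows "(stieltjes f has_field_derivative stieltjes f' z) (at z)"
proof -
  define d where "d = \<bar>Im z\<bar>"
  have d: "d > 0" using z by (simp add: d_def nonreal_Im)
  \<comment> \<open>Within distance \<open>d / 2\<close> of \<open>z\<close> the imaginary part is
    still at least \<open>d / 2\<close> in absolute value. One factor of the denominator is bounded
    by this and the two others by \<open>d\<close>.\<close>
  define K where "K = 2 / d ^ 3 * (LBINT t. \<bar>f t\<bar>)"
  note sq = stieltjes_square[OF f rapid z]
  have bound: "norm ((stieltjes f w - stieltjes f z) / (w - z) - stieltjes f' z) \<le> K * norm (w - z)"
    if w: "w \<noteq> z" "norm (w - z) < d / 2" for w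
  proof -
    have Imw: "\<bar>Im w\<bar> \<ge> d / 2"
      using abs_Im_le_cmod[of "w - z"] w(2) by (simp add: d_def)
    then have w': "w \<notin> \<real>" using d by (auto simp: nonreal_Im)
    have nz: "z - of_real t \<noteq> 0" "w - of_real t \<noteq> 0" for t
      using z w' by auto
    define h where "h t = of_real (f t) / ((w - of_real t) * (z - of_real t)\<^sup>2)" for t
    have h: "(of_real (f t) / (w - of_real t) - of_real (f t) / (z - of_real t)) / (w - z)
        + of_real (f t) / (z - of_real t)\<^sup>2 = (w - z) * h t" for t
    proof -
      have "a / u - a / v = - a * (u - v) / (u * v)" if "u \<noteq> 0" "v \<noteq> 0" for a u v :: complex
        using that by (simp add: field_simps)
      from this[OF nz(2,1), of "of_real (f t)" t]
      have "(of_real (f t) / (w - of_real t) - of_real (f t) / (z - of_real t)) / (w - z)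
          = - of_real (f t) / ((w - of_real t) * (z - of_real t))"
        using w(1) by simp
      moreover have "- a / (u * v) + a / v\<^sup>2 = (u - v) * (a / (u * v\<^sup>2))" if "u \<noteq> 0" "v \<noteq> 0" for a u v :: complex
        using that by (simp add: field_simps power2_eq_square)
      from this[OF nz(2,1), of "of_real (f t)" t]
      have "- of_real (f t) / ((w - of_real t) * (z - of_real t)) + of_real (f t) / (z - of_real t)\<^sup>2 = (w - z) * h t"
        by (simp add: h_def)
      ultimately show ?thesis by simp
    qed
    have "(stieltjes f w - stieltjes f z) / (w - z) - stieltjes f' z
       = (LBINT t. (of_real (f t) / (w - of_real t) - of_real (f t) / (z - of_real t)) / (w - z)
        + of_real (f t) / (z - of_real t)\<^sup>2)"
      using integrable_stieltjes[OF rapid(1) z] integrable_stieltjes[OF rapid(1) w'] sq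
      by (simp add: stieltjes_def)
    also have "\<dots> = (w - z) * (LBINT t. h t)"
      unfolding h by simp
    finally have eq: "(stieltjes f w - stieltjes f z) / (w - z) - stieltjes f' z = (w - z) * (LBINT t. h t)" .
    have hle: "norm (h t) \<le> 2 / d ^ 3 * \<bar>f t\<bar>" for t
    proof -
      have "norm (h t) = \<bar>f t\<bar> / (norm (w - of_real t) * norm (z - of_real t) ^ 2)"
        by (simp add: h_def norm_divide norm_mult norm_power)
      also have "\<dots> \<le> \<bar>f t\<bar> / (d / 2 * d ^ 2)"
      proof (intro divide_left_mono mult_mono power_mono)
        show "d / 2 \<le> norm (w - of_real t)" "d \<le> norm (z - of_real t)"
          using Im_le_norm_diff_of_real[of w t] Imw Im_le_norm_diff_of_real[of z t] by (auto simp: d_def)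
        show "0 < norm (w - of_real t) * (norm (z - of_real t))\<^sup>2 * (d / 2 * d\<^sup>2)"
          using nz[of t] d by simp
      qed (use d in auto)
      also have "\<dots> = 2 / d ^ 3 * \<bar>f t\<bar>"
        by (simp add: power2_eq_square power3_eq_cube mult_ac)
      finally show ?thesis .
    qed
    have "norm (LBINT t. h t) \<le> (LBINT t. norm (h t))"
      by (rule integral_norm_bound)
    also have "\<dots> \<le> (LBINT t. 2 / d ^ 3 * \<bar>f t\<bar>)"
    proof (rule integral_mono)
      show i: "integrable lborel (\<lambda>t. 2 / d ^ 3 * \<bar>f t\<bar>)"
        using rapid_integrable[OF rapid(1)] by simp
      show "integrable lborel (\<lambda>t. norm (h t))"
      proof (rule Bochner_Integration.integrable_bound[OF i])
        show "(\<lambda>t. norm (h t)) \<in> borel_measurable lborel"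
          unfolding h_def using rapid_measurable[OF rapid(1)] by measurable
        show "AE t in lborel. norm (norm (h t)) \<le> norm (2 / d ^ 3 * \<bar>f t\<bar>)"
          using hle d by (intro AE_I2) (simp add: abs_mult)
      qed
    qed (rule hle)
    finally have "norm (LBINT t. h t) \<le> K"
      by (simp add: K_def)
    then show ?thesis
      unfolding eq norm_mult by (subst mult.commute) (rule mult_right_mono, simp_all)
  qed
  have "((\<lambda>w. (stieltjes f w - stieltjes f z) / (w - z) - stieltjes f' z) \<longlongrightarrow> 0) (at z)"
  proof (rule Lim_null_comparison)
    show "\<forall>\<^sub>F w in at z. norm ((stieltjes f w - stieltjes f z) / (w - z) - stieltjes f' z) \<le> K * norm (w - z)"
      unfolding eventually_at using d bound
      by (intro exI[of _ "d / 2"]) (auto simp: dist_norm)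
    show "((\<lambda>w. K * norm (w - z)) \<longlongrightarrow> 0) (at z)"
      by (intro tendsto_mult_right_zero tendsto_norm_zero LIM_zero tendsto_ident_at)
  qed
  then show ?thesis
    unfolding has_field_derivative_iff by (simp add: LIM_zero_iff)
qed

text \<open>Applied both to integration against a power of \<open>t\<close> and to the Stieltjes
  transform. Linearity is only available on rapidly decreasing functions, so the sum is built up
  term by term, carrying rapid decrease along.\<close>

lemma goe_operator_linear:
  fixes \<Lambda> :: "(real \<Rightarrow> real) \<Rightarrow> 'a :: real_vector"
  assumes R: "\<And>k. k \<le> 5 \<Longrightarrow> rapid (R k)"
    and add: "\<And>f g. rapid f \<Longrightarrow> rapid g \<Longrightarrow> \<Lambda> (\<lambda>t. f t + g t) = \<Lambda> f + \<Lambda> g"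
    and scale: "\<And>c f. rapid f \<Longrightarrow> \<Lambda> (\<lambda>t. c * f t) = c *\<^sub>R \<Lambda> f"
  defines "D \<equiv> \<lambda>j k. \<Lambda> (\<lambda>t. t ^ j * R k t)"
  shows "\<Lambda> (goe_operator n R) = (- 4) *\<^sub>R D 0 5 + 5 *\<^sub>R D 2 3 - (5 * (4 * n - 2)) *\<^sub>R D 0 3
     - 6 *\<^sub>R D 1 2 - D 4 1 + (8 * n - 4) *\<^sub>R D 2 1 + (- 16 * n\<^sup>2 + 16 * n + 2) *\<^sub>R D 0 1
     + D 3 0 - (4 * n - 2) *\<^sub>R D 1 0"
proof -
  \<comment> \<open>The operator as a list of triples: coefficient, power of \<open>t\<close>, order
    of the derivative.\<close>
  define c :: "(real \<times> nat \<times> nat) list" where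
    "c = [(- 4, 0, 5), (5, 2, 3), (- (5 * (4 * n - 2)), 0, 3), (- 6, 1, 2), (- 1, 4, 1),
          (8 * n - 4, 2, 1), (- 16 * n\<^sup>2 + 16 * n + 2, 0, 1), (1, 3, 0), (- (4 * n - 2), 1, 0)]"
  have lin: "rapid (\<lambda>t. \<Sum>(a, j, k)\<leftarrow>l. a * (t ^ j * R k t)) \<and>
      \<Lambda> (\<lambda>t. \<Sum>(a, j, k)\<leftarrow>l. a * (t ^ j * R k t)) = (\<Sum>(a, j, k)\<leftarrow>l. a *\<^sub>R D j k)"
    if "\<forall>(a, j, k)\<in>set l. k \<le> 5" for l
    using that
  proof (induction l)
    case Nil
    have "rapid (\<lambda>t. 0)" using rapid_cmult[OF R[of 0], of 0] by simp
    moreover have "\<Lambda> (\<lambda>t. 0) = 0" using scale[OF R[of 0], of 0] by simp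
    ultimately show ?case by simp
  next
    case (Cons x l)
    obtain a j k where x: "x = (a, j, k)" by (cases x)
    have r: "rapid (\<lambda>t. t ^ j * R k t)"
      using Cons.prems x by (intro rapid_power_mult R) auto
    show ?case
      using Cons add[OF rapid_cmult[OF r, of a]] scale[OF r, of a] rapid_add[OF rapid_cmult[OF r, of a]]
      by (simp add: x D_def)
  qed
  have "goe_operator n R = (\<lambda>t. \<Sum>(a, j, k)\<leftarrow>c. a * (t ^ j * R k t))"
    by (rule ext) (simp add: goe_operator_def c_def algebra_simps power2_eq_square power3_eq_cube power4_eq_xxxx)
  then show ?thesis
    using lin[of c] by (simp add: c_def algebra_simps)
qed

section \<open>Moments and the equation of the Stieltjes transform\<close>

lemma goe_density_moments:
  assumes "N \<ge> 1"
    and R0: "R 0 = goe_density N"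
    and R: "\<And>k. k \<le> 5 \<Longrightarrow> rapid (R k)"
    and D: "\<And>k t. k < 5 \<Longrightarrow> (R k has_real_derivative R (Suc k) t) (at t)"
  shows "(LBINT t. t ^ j * R 0 t) = goe_moment N j"
    and "k < 5 \<Longrightarrow> (LBINT t. t ^ j * R (Suc k) t) = - real j * (LBINT t. t ^ (j - 1) * R k t)"
proof -
  show "(LBINT t. t ^ j * R 0 t) = goe_moment N j"
    by (simp only: R0 goe_moment_eq_integral[OF assms(1)])
  show "(LBINT t. t ^ j * R (Suc k) t) = - real j * (LBINT t. t ^ (j - 1) * R k t)" if "k < 5"
    by (rule rapid_moment_derivative[OF D R R]) (use that in simp_all)
qed

text \<open>Where a subtraction in an index truncates, one of the factors in front of that moment vanishes.\<close>

lemma goe_moment_recurrence: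
  fixes N k :: nat
  assumes "N \<ge> 1"
  defines "n \<equiv> real N" and "m \<equiv> goe_moment N"
  shows "(real k + 5) * m (k + 3) = (4 * n - 2) * (2 * real k + 5) * m (k + 1)
      + real k * (5 * (real k + 2) * (real k + 1) + 6 * (real k + 1) + (- 16 * n\<^sup>2 + 16 * n + 2)) * m (k - 1)
      - 5 * (4 * n - 2) * real k * real (k - 1) * real (k - 2) * m (k - 3)
      - 4 * real k * real (k - 1) * real (k - 2) * real (k - 3) * real (k - 4) * m (k - 5)"
proof -
  obtain R :: "nat \<Rightarrow> real \<Rightarrow> real" where R: "R 0 = goe_density N"
    "\<And>k t. k < 5 \<Longrightarrow> (R k has_real_derivative R (Suc k) t) (at t)"
    "\<And>k. k \<le> 5 \<Longrightarrow> rapid (R k)" "\<And>t. goe_operator N R t = 0"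
    by (rule goe_density_derivatives[OF assms(1)]) (rule that)
  define I where "I j k = (LBINT t. t ^ j * R k t)" for j k
  define \<Lambda> where "\<Lambda> f = (LBINT t. t ^ k * f t)" for f :: "real \<Rightarrow> real"
  have I0: "I j 0 = m j" for j
    unfolding I_def m_def by (rule goe_density_moments(1)[OF assms(1) R(1,3,2)])
  have IS: "I j (Suc i) = - real j * I (j - 1) i" if "i < 5" for i j
    unfolding I_def by (rule goe_density_moments(2)[OF assms(1) R(1,3,2) that])
  have I1: "I j 1 = - real j * I (j - 1) 0" and I2: "I j 2 = - real j * I (j - 1) 1"
    and I3: "I j 3 = - real j * I (j - 1) 2" and I4: "I j 4 = - real j * I (j - 1) 3"
    and I5: "I j 5 = - real j * I (j - 1) 4" for j
    using IS[of 0 j] IS[of 1 j] IS[of 2 j] IS[of 3 j] IS[of 4 j]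
    by (simp_all add: eval_nat_numeral)
  have "\<Lambda> (goe_operator n R) = 0"
    by (simp add: \<Lambda>_def R(4) n_def)
  moreover have "\<Lambda> (goe_operator n R) = (- 4) *\<^sub>R I k 5 + 5 *\<^sub>R I (k + 2) 3 - (5 * (4 * n - 2)) *\<^sub>R I k 3
     - 6 *\<^sub>R I (k + 1) 2 - I (k + 4) 1 + (8 * n - 4) *\<^sub>R I (k + 2) 1 + (- 16 * n\<^sup>2 + 16 * n + 2) *\<^sub>R I k 1
     + I (k + 3) 0 - (4 * n - 2) *\<^sub>R I (k + 1) 0"
  proof -
    have D: "\<Lambda> (\<lambda>t. t ^ j * R i t) = I (k + j) i" for i j
      by (simp add: \<Lambda>_def I_def power_add mult.assoc)
    have add: "\<Lambda> (\<lambda>t. f t + g t) = \<Lambda> f + \<Lambda> g" if "rapid f" "rapid g" for f g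
      unfolding \<Lambda>_def distrib_left
      using that by (intro Bochner_Integration.integral_add rapid_integrable rapid_power_mult)
    have scale: "\<Lambda> (\<lambda>t. c * f t) = c *\<^sub>R \<Lambda> f" for c f
      unfolding \<Lambda>_def by (simp add: mult.left_commute)
    show ?thesis
      by (simp only: goe_operator_linear[where \<Lambda> = \<Lambda>, OF R(3) add scale] D add_0_right)
  qed
  ultimately have E: "(- 4) * I k 5 + 5 * I (k + 2) 3 - (5 * (4 * n - 2)) * I k 3
     - 6 * I (k + 1) 2 - I (k + 4) 1 + (8 * n - 4) * I (k + 2) 1 + (- 16 * n\<^sup>2 + 16 * n + 2) * I k 1
     + I (k + 3) 0 - (4 * n - 2) * I (k + 1) 0 = 0"
    by simp
  have v: "I k 5 = - real k * real (k - 1) * real (k - 2) * real (k - 3) * real (k - 4) * m (k - 5)"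
    "I (k + 2) 3 = - (real k + 2) * (real k + 1) * real k * m (k - 1)"
    "I k 3 = - real k * real (k - 1) * real (k - 2) * m (k - 3)"
    "I (k + 1) 2 = (real k + 1) * real k * m (k - 1)"
    "I (k + 4) 1 = - (real k + 4) * m (k + 3)"
    "I (k + 2) 1 = - (real k + 2) * m (k + 1)"
    "I k 1 = - real k * m (k - 1)"
    unfolding I5 I4 I3 I2 I1 I0 by (simp_all add: numeral_eq_Suc) (simp_all add: algebra_simps)
  \<comment> \<open>The products containing truncated subtractions become atoms, which leaves a
    polynomial identity for \<open>algebra\<close>.\<close>
  define d e where "d = real k * real (k - 1) * real (k - 2) * m (k - 3)"
    and "e = real k * real (k - 1) * real (k - 2) * real (k - 3) * real (k - 4) * m (k - 5)"
  have "4 * e + 5 * (- (real k + 2) * (real k + 1) * real k * m (k - 1)) + 5 * (4 * n - 2) * d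
     - 6 * ((real k + 1) * real k * m (k - 1)) + (real k + 4) * m (k + 3)
     - (8 * n - 4) * (real k + 2) * m (k + 1) - (- 16 * n\<^sup>2 + 16 * n + 2) * (real k * m (k - 1))
     + m (k + 3) - (4 * n - 2) * m (k + 1) = 0"
    using E unfolding v I0 by (simp only: d_def e_def mult_minus_left mult_minus_right minus_minus diff_minus_eq_add
        add_uminus_conv_diff mult.assoc)
  then have "(real k + 5) * m (k + 3) = (4 * n - 2) * (2 * real k + 5) * m (k + 1)
      + real k * (5 * (real k + 2) * (real k + 1) + 6 * (real k + 1) + (- 16 * n\<^sup>2 + 16 * n + 2)) * m (k - 1)
      - 5 * (4 * n - 2) * d - 4 * e"
    by algebra
  then show ?thesis
    by (simp only: d_def e_def mult.assoc)
qed

text \<open>Out of reach of \<open>goe_moment_recurrence\<close>, whose leading moment has index at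
  least 3.\<close>

lemma goe_moment_2:
  assumes "N \<ge> 1"
  shows "goe_moment N 2 = real N ^ 2 + real N"
proof -
  obtain R :: "nat \<Rightarrow> real \<Rightarrow> real" where R: "R 0 = goe_density N"
    "(LBINT t. t\<^sup>2 * R 0 t) = (4 * real N - 2) * (LBINT t. R 0 t) + (3 / 4 - 3 * (real N - 1 / 2)\<^sup>2)"
    by (rule goe_density_derivatives[OF assms]) (rule that)
  have "goe_moment N 2 = (4 * real N - 2) * goe_moment N 0 + (3 / 4 - 3 * (real N - 1 / 2)\<^sup>2)"
    using R goe_moment_eq_integral[OF assms, of 0] goe_moment_eq_integral[OF assms, of 2] by simp
  then show ?thesis
    using goe_moment_0[OF assms] by (simp add: field_simps power2_eq_square)
qed

text \<open>The recurrence at \<open>k = 1, 3, 5, 7, 9\<close>, starting from \<open>m_0\<close> and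
  \<open>m_2\<close>.\<close>

lemma goe_moments_4_to_12:
  fixes N :: nat
  assumes "N \<ge> 1"
  shows "goe_moment N 4 = 2 * real N ^ 3 + 5 * real N ^ 2 + 5 * real N" (is ?m4)
    and "goe_moment N 6 = 5 * real N ^ 4 + 22 * real N ^ 3 + 52 * real N ^ 2 + 41 * real N" (is ?m6)
    and "goe_moment N 8 = 14 * real N ^ 5 + 93 * real N ^ 4 + 374 * real N ^ 3
       + 690 * real N ^ 2 + 509 * real N" (is ?m8)
    and "goe_moment N 10 = 42 * real N ^ 6 + 386 * real N ^ 5 + 2290 * real N ^ 4
       + 7150 * real N ^ 3 + 12143 * real N ^ 2 + 8229 * real N" (is ?m10)
    and "goe_moment N 12 = 132 * real N ^ 7 + 1586 * real N ^ 6 + 12798 * real N ^ 5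
       + 58760 * real N ^ 4 + 167148 * real N ^ 3 + 258479 * real N ^ 2 + 166377 * real N" (is ?m12)
proof -
  define n where "n = real N"
  note m0 = goe_moment_0[OF assms, folded n_def] and m2 = goe_moment_2[OF assms, folded n_def]
  note rec = goe_moment_recurrence[OF assms, folded n_def]
  have m4: "goe_moment N 4 = 2 * n ^ 3 + 5 * n ^ 2 + 5 * n"
  proof -
    have "6 * goe_moment N 4 = (4 * n - 2) * 7 * goe_moment N 2 + (42 + (- 16 * n\<^sup>2 + 16 * n + 2)) * goe_moment N 0"
      using rec[of 1] by (simp add: numeral_2_eq_2)
    then show ?thesis unfolding m0 m2 by algebra
  qed
  have m6: "goe_moment N 6 = 5 * n ^ 4 + 22 * n ^ 3 + 52 * n ^ 2 + 41 * n"
  proof -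
    have "8 * goe_moment N 6 = (4 * n - 2) * 11 * goe_moment N 4
        + 3 * (124 + (- 16 * n\<^sup>2 + 16 * n + 2)) * goe_moment N 2 - 30 * (4 * n - 2) * goe_moment N 0"
      using rec[of 3] by simp
    then show ?thesis unfolding m0 m2 m4 by algebra
  qed
  have m8: "goe_moment N 8 = 14 * n ^ 5 + 93 * n ^ 4 + 374 * n ^ 3 + 690 * n ^ 2 + 509 * n"
  proof -
    have "10 * goe_moment N 8 = (4 * n - 2) * 15 * goe_moment N 6
        + 5 * (246 + (- 16 * n\<^sup>2 + 16 * n + 2)) * goe_moment N 4 - 300 * (4 * n - 2) * goe_moment N 2
        - 480 * goe_moment N 0"
      using rec[of 5] by simp
    then show ?thesis unfolding m0 m2 m4 m6 by algebra
  qed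
  have m10: "goe_moment N 10 = 42 * n ^ 6 + 386 * n ^ 5 + 2290 * n ^ 4 + 7150 * n ^ 3 + 12143 * n ^ 2 + 8229 * n"
  proof -
    have "12 * goe_moment N 10 = (4 * n - 2) * 19 * goe_moment N 8
        + 7 * (408 + (- 16 * n\<^sup>2 + 16 * n + 2)) * goe_moment N 6 - 1050 * (4 * n - 2) * goe_moment N 4
        - 10080 * goe_moment N 2"
      using rec[of 7] by simp
    then show ?thesis unfolding m2 m4 m6 m8 by algebra
  qed
  have m12: "goe_moment N 12 = 132 * n ^ 7 + 1586 * n ^ 6 + 12798 * n ^ 5
       + 58760 * n ^ 4 + 167148 * n ^ 3 + 258479 * n ^ 2 + 166377 * n"
  proof -
    have "14 * goe_moment N 12 = (4 * n - 2) * 23 * goe_moment N 10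
        + 9 * (610 + (- 16 * n\<^sup>2 + 16 * n + 2)) * goe_moment N 8 - 2520 * (4 * n - 2) * goe_moment N 6
        - 60480 * goe_moment N 4"
      using rec[of 9] by simp
    then show ?thesis unfolding m4 m6 m8 m10 by algebra
  qed
  show ?m4 ?m6 ?m8 ?m10 ?m12
    using m4 m6 m8 m10 m12 by (simp_all only: n_def)
qed

text \<open>Transforming the equation of the density gives a homogeneous relation in which powers of
  \<open>t\<close> stand inside the transform. Pulling them out as powers of \<open>z\<close> leaves
  one integral per step, and these integrals add up to the right-hand side.\<close>

lemma stieltjes_ode:
  fixes N :: nat and z :: complex
  assumes "N \<ge> 1" and z: "z \<notin> \<real>"
    and R0: "R 0 = goe_density N"
    and D: "\<And>k t. k < 5 \<Longrightarrow> (R k has_real_derivative R (Suc k) t) (at t)"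
    and R: "\<And>k. k \<le> 5 \<Longrightarrow> rapid (R k)"
    and L: "\<And>t. goe_operator N R t = 0"
  defines "n \<equiv> of_nat N" and "S \<equiv> \<lambda>k. stieltjes (R k) z"
  shows "- 4 * S 5 + 5 * (z\<^sup>2 - (4 * n - 2)) * S 3 - 6 * z * S 2
     + (- (z ^ 4) + (8 * n - 4) * z\<^sup>2 + (- 16 * n\<^sup>2 + 16 * n + 2)) * S 1
     + z * (z\<^sup>2 - (4 * n - 2)) * S 0 = 2 * n * z\<^sup>2 - 8 * n\<^sup>2 + 10 * n"
proof -
  define \<Lambda> where "\<Lambda> f = stieltjes f z" for f
  define E where "E j k = stieltjes (\<lambda>t. t ^ j * R k t) z" for j k
  define I where "I j k = (LBINT t. t ^ j * R k t)" for j k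
  have I0: "I j 0 = goe_moment N j" for j
    unfolding I_def by (rule goe_density_moments(1)[OF assms(1) R0 R D])
  have IS: "I j (Suc i) = - real j * I (j - 1) i" if "i < 5" for i j
    unfolding I_def by (rule goe_density_moments(2)[OF assms(1) R0 R D that])
  have I1: "I j 1 = - real j * I (j - 1) 0" and I2: "I j 2 = - real j * I (j - 1) 1"
    and I3: "I j 3 = - real j * I (j - 1) 2" for j
    using IS[of 0 j] IS[of 1 j] IS[of 2 j] by (simp_all add: eval_nat_numeral)
  have E: "z * E j k = E (Suc j) k + of_real (I j k)" if "k \<le> 5" for j k
    unfolding E_def I_def
    using mult_stieltjes[OF rapid_power_mult[OF R[OF that]] z, of j] by (simp add: mult.assoc)
  have S: "S k = E 0 k" for k by (simp add: S_def E_def)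
  have "\<Lambda> (goe_operator N R) = 0"
    by (simp add: \<Lambda>_def stieltjes_def L)
  moreover have "\<Lambda> (goe_operator N R) = (- 4) *\<^sub>R E 0 5 + 5 *\<^sub>R E 2 3 - (5 * (4 * real N - 2)) *\<^sub>R E 0 3
     - 6 *\<^sub>R E 1 2 - E 4 1 + (8 * real N - 4) *\<^sub>R E 2 1 + (- 16 * (real N)\<^sup>2 + 16 * real N + 2) *\<^sub>R E 0 1
     + E 3 0 - (4 * real N - 2) *\<^sub>R E 1 0"
    unfolding E_def \<Lambda>_def
    by (rule goe_operator_linear[where \<Lambda> = "\<lambda>f. stieltjes f z"]) (simp_all add: R stieltjes_add z stieltjes_cmult)
  ultimately have lin: "- 4 * E 0 5 + 5 * E 2 3 - 5 * (4 * n - 2) * E 0 3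
     - 6 * E 1 2 - E 4 1 + (8 * n - 4) * E 2 1 + (- 16 * n\<^sup>2 + 16 * n + 2) * E 0 1
     + E 3 0 - (4 * n - 2) * E 1 0 = 0"
    by (simp add: scaleR_conv_of_real n_def)
  have moments: "goe_moment N 0 = real N" "goe_moment N 1 = 0" "goe_moment N 2 = real N ^ 2 + real N"
    using goe_moment_0[OF assms(1)] goe_moment_odd[of 1 N] goe_moment_2[OF assms(1)] by simp_all
  \<comment> \<open>A derivative integrated against a power below its order gives 0. The other
    integrals are multiples of \<open>m_0\<close>, \<open>m_1\<close> and \<open>m_2\<close>, and
    \<open>m_1\<close> vanishes by symmetry.\<close>
  have vals: "I 0 3 = 0" "I 1 3 = 0" "I 0 2 = 0" "I 0 1 = 0" "I 1 1 = - real N" "I 2 1 = 0"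
    "I 3 1 = - 3 * (real N ^ 2 + real N)" "I 0 0 = real N" "I 1 0 = 0" "I 2 0 = real N ^ 2 + real N"
    using moments by (simp_all add: I3 I2 I1[unfolded One_nat_def] I0)
  have z23: "z\<^sup>2 * S 3 = E 2 3"
  proof -
    have "z * E 0 3 = E 1 3" "z * E 1 3 = E 2 3"
      using E[of 3 0] E[of 3 1] vals by (simp_all add: eval_nat_numeral)
    then show ?thesis by (simp add: S power2_eq_square mult.assoc)
  qed
  have z12: "z * S 2 = E 1 2"
    using E[of 2 0] vals by (simp add: S)
  have z21: "z\<^sup>2 * S 1 = E 2 1 - n" and z41: "z ^ 4 * S 1 = E 4 1 - 3 * (n\<^sup>2 + n) - n * z\<^sup>2"
  proof -
    have "z * E 0 1 = E 1 1" "z * E 1 1 = E 2 1 - n" "z * E 2 1 = E 3 1" "z * E 3 1 = E 4 1 - 3 * (n\<^sup>2 + n)"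
      using E[of 1 0] E[of 1 1] E[of 1 2] E[of 1 3] vals by (simp_all add: eval_nat_numeral n_def)
    note e = this
    have "z\<^sup>2 * E 0 1 = z * (z * E 0 1)" "z ^ 4 * E 0 1 = z * (z * (z * (z * E 0 1)))"
      by (simp_all add: power2_eq_square power4_eq_xxxx mult.assoc)
    then have "z\<^sup>2 * E 0 1 = E 2 1 - n" "z ^ 4 * E 0 1 = E 4 1 - 3 * (n\<^sup>2 + n) - n * z\<^sup>2"
      unfolding e right_diff_distrib by (simp_all add: power2_eq_square mult_ac)
    then show "z\<^sup>2 * S 1 = E 2 1 - n" "z ^ 4 * S 1 = E 4 1 - 3 * (n\<^sup>2 + n) - n * z\<^sup>2"
      by (simp_all add: S)
  qed
  have z30: "z ^ 3 * S 0 = E 3 0 + n * z\<^sup>2 + (n\<^sup>2 + n)" and z10: "z * S 0 = E 1 0 + n"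
  proof -
    have "z * E 0 0 = E 1 0 + n" "z * E 1 0 = E 2 0" "z * E 2 0 = E 3 0 + (n\<^sup>2 + n)"
      using E[of 0 0] E[of 0 1] E[of 0 2] vals by (simp_all add: eval_nat_numeral n_def)
    note e = this
    have "z ^ 3 * E 0 0 = z * (z * (z * E 0 0))"
      by (simp add: power3_eq_cube mult.assoc)
    then have "z ^ 3 * E 0 0 = E 3 0 + n * z\<^sup>2 + (n\<^sup>2 + n)" "z * E 0 0 = E 1 0 + n"
      unfolding e distrib_left by (simp_all add: power2_eq_square mult_ac)
    then show "z ^ 3 * S 0 = E 3 0 + n * z\<^sup>2 + (n\<^sup>2 + n)" "z * S 0 = E 1 0 + n"
      by (simp_all add: S)
  qed
  have "- 4 * S 5 + 5 * (z\<^sup>2 - (4 * n - 2)) * S 3 - 6 * z * S 2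
     + (- (z ^ 4) + (8 * n - 4) * z\<^sup>2 + (- 16 * n\<^sup>2 + 16 * n + 2)) * S 1
     + z * (z\<^sup>2 - (4 * n - 2)) * S 0
    = - 4 * S 5 + 5 * (z\<^sup>2 * S 3) - 5 * (4 * n - 2) * S 3 - 6 * (z * S 2)
     - z ^ 4 * S 1 + (8 * n - 4) * (z\<^sup>2 * S 1) + (- 16 * n\<^sup>2 + 16 * n + 2) * S 1
     + z ^ 3 * S 0 - (4 * n - 2) * (z * S 0)"
    by (simp add: algebra_simps power2_eq_square power3_eq_cube)
  also have "\<dots> = (- 4 * E 0 5 + 5 * E 2 3 - 5 * (4 * n - 2) * E 0 3
     - 6 * E 1 2 - E 4 1 + (8 * n - 4) * E 2 1 + (- 16 * n\<^sup>2 + 16 * n + 2) * E 0 1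
     + E 3 0 - (4 * n - 2) * E 1 0) + (2 * n * z\<^sup>2 - 8 * n\<^sup>2 + 10 * n)"
    unfolding z23 z12 z21 z41 z30 z10
    unfolding S[of 5] S[of 3] S[of 1]
    by (simp add: algebra_simps power2_eq_square)
  finally show ?thesis
    unfolding lin by simp
qed

section \<open>The resolvent\<close>

lemma goe_resolvent_eq_stieltjes:
  assumes g: "g > 0" and N: "N \<ge> 1" and x: "x \<notin> \<real>"
  defines "s \<equiv> sqrt (real N / g)"
  shows "goe_resolvent g N x = of_real s * stieltjes (goe_density N) (of_real s * x)"
proof -
  have s: "s > 0" "s\<^sup>2 = real N / g" using g N by (simp_all add: s_def)
  define F :: "real \<Rightarrow> complex" where "F t = 1 / (x - of_real (1 / s * t))" for t
  have nz: "x - of_real t \<noteq> 0" for t using x by auto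
  have meas: "(\<lambda>y. \<Sum>j\<in>{1..N}. 1 / (x - of_real (y j)) :: complex) \<in> borel_measurable (lebN {1..N})"
    by (rule linear_statistic_measurable[where h = "\<lambda>t. 1 / (x - of_real t)"]) measurable
  \<comment> \<open>The dilation by \<open>1 / s\<close> is chosen to turn the parameter
    \<open>N / (4 * g)\<close> into \<open>1 / 4\<close>.\<close>
  have "goe_resolvent g N x = (\<integral>y. (\<Sum>j\<in>{1..N}. 1 / (x - of_real ((\<lambda>i\<in>{1..N}. 1 / s * y i) j)))
      \<partial>goe_law (real N / (4 * g) * (1 / s)\<^sup>2) N)"
    unfolding goe_resolvent_def
    by (rule integral_goe_law_scale[OF _ meas]) (use s in simp)
  also have "real N / (4 * g) * (1 / s)\<^sup>2 = 1 / 4"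
    using s g N by (simp add: power_divide)
  also have "(\<integral>y. (\<Sum>j\<in>{1..N}. 1 / (x - of_real ((\<lambda>i\<in>{1..N}. 1 / s * y i) j))) \<partial>goe_law (1 / 4) N)
      = (\<integral>y. (\<Sum>j\<in>{1..N}. F (y j)) \<partial>goe_law (1 / 4) N)"
    by (simp add: F_def)
  also have "\<dots> = (LBINT t. F t * of_real (goe_density N t))"
  proof (rule goe_law_linear_statistic_complex[OF N])
    show "F \<in> borel_measurable borel"
      unfolding F_def by measurable
    show "norm (F t) \<le> 1 / \<bar>Im x\<bar>" for t
      unfolding F_def norm_divide norm_one
      using x nz[of "1 / s * t"] Im_le_norm_diff_of_real[of x "1 / s * t"]
      by (intro divide_left_mono mult_pos_pos) (auto simp: nonreal_Im)
  qed
  also have "\<dots> = (LBINT t. of_real s * (of_real (goe_density N t) / (of_real s * x - of_real t)))"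
  proof (rule Bochner_Integration.integral_cong[OF refl])
    fix t
    have "x - of_real (1 / s * t) = (of_real s * x - of_real t) / of_real s"
      using s by (simp add: field_simps)
    then show "F t * of_real (goe_density N t) = of_real s * (of_real (goe_density N t) / (of_real s * x - of_real t))"
      using s by (simp add: F_def)
  qed
  also have "\<dots> = of_real s * stieltjes (goe_density N) (of_real s * x)"
    unfolding stieltjes_def by (rule integral_mult_right_zero)
  finally show ?thesis .
qed

lemma mult_of_real_nonreal: "s \<noteq> 0 \<Longrightarrow> x \<notin> \<real> \<Longrightarrow> complex_of_real s * x \<notin> \<real>"
  by (simp add: nonreal_Im)

text \<open>\<open>W\<close> is prescribed only off the real axis, an open set. The lemma therefore
  applies again to every iterated derivative, about whose values on the axis nothing is
  known.\<close>

lemma scaled_stieltjes_has_derivative: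
  assumes W: "\<And>x. x \<notin> \<real> \<Longrightarrow> W x = c * stieltjes f (of_real s * x)"
    and f: "\<And>t. (f has_real_derivative f' t) (at t)" and rapid: "rapid f" "rapid f'"
    and s: "s \<noteq> 0" and x: "x \<notin> \<real>"
  shows "(W has_field_derivative c * of_real s * stieltjes f' (of_real s * x)) (at x)"
proof -
  have "((\<lambda>w. of_real s * w) has_field_derivative of_real s) (at x)"
    by (auto intro!: derivative_eq_intros)
  then have "((\<lambda>w. c * stieltjes f (of_real s * w)) has_field_derivative
      c * (stieltjes f' (of_real s * x) * of_real s)) (at x)"
    by (intro DERIV_cmult DERIV_chain2[where f = "stieltjes f" and g = "\<lambda>w. of_real s * w"]
          stieltjes_has_derivative f rapid mult_of_real_nonreal s x)
  then have "((\<lambda>w. c * stieltjes f (of_real s * w)) has_field_derivative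
      c * of_real s * stieltjes f' (of_real s * x)) (at x)"
    by (simp add: mult_ac)
  then show ?thesis
    by (rule has_field_derivative_transform_within_open[where S = "- \<real>"])
       (use x W closed_complex_Reals in auto)
qed

lemma deriv_scaled_stieltjes:
  assumes W: "\<And>x. x \<notin> \<real> \<Longrightarrow> W x = of_real s * stieltjes (R 0) (of_real s * x)"
    and D: "\<And>k t. k < m \<Longrightarrow> (R k has_real_derivative R (Suc k) t) (at t)"
    and R: "\<And>k. k \<le> m \<Longrightarrow> rapid (R k)"
    and s: "s \<noteq> 0" and k: "k \<le> m" and x: "x \<notin> \<real>"
  shows "(deriv ^^ k) W x = of_real s ^ (k + 1) * stieltjes (R k) (of_real s * x)"
  using k x
proof (induction k arbitrary: x)
  case 0
  then show ?case using W by simp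
next
  case (Suc k)
  have "((deriv ^^ k) W has_field_derivative of_real s ^ (k + 1) * of_real s * stieltjes (R (Suc k)) (of_real s * x)) (at x)"
    by (rule scaled_stieltjes_has_derivative[OF Suc.IH]) (use Suc.prems D R s in auto)
  then have "deriv ((deriv ^^ k) W) x = of_real s ^ (k + 1) * of_real s * stieltjes (R (Suc k)) (of_real s * x)"
    by (rule DERIV_imp_deriv)
  then show ?case by simp
qed

section \<open>Asymptotic expansion in sectors\<close>

lemma sin_le_abs_sin:
  assumes "0 < \<delta>" "\<delta> \<le> \<bar>\<theta>\<bar>" "\<bar>\<theta>\<bar> \<le> pi - \<delta>"
  shows "0 < sin \<delta>" "sin \<delta> \<le> \<bar>sin \<theta>\<bar>"
proof -
  show "0 < sin \<delta>" using assms by (intro sin_gt_zero) auto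
  have "sin \<delta> \<le> sin \<bar>\<theta>\<bar>"
  proof (cases "\<bar>\<theta>\<bar> \<le> pi / 2")
    case True
    then show ?thesis using assms by (intro sin_monotone_2pi_le) auto
  next
    case False
    then have "sin \<delta> \<le> sin (pi - \<bar>\<theta>\<bar>)" using assms by (intro sin_monotone_2pi_le) auto
    then show ?thesis by simp
  qed
  also have "\<dots> \<le> \<bar>sin \<theta>\<bar>"
    by (cases "\<theta> \<ge> 0") auto
  finally show "sin \<delta> \<le> \<bar>sin \<theta>\<bar>" .
qed

text \<open>In the sector \<open>\<bar>Im x\<bar>\<close> and \<open>norm x\<close> are comparable,
  which converts the bound of \<open>norm_stieltjes_le\<close> into decay in
  \<open>norm x\<close>.\<close>

lemma sector_off_reals_Im:
  assumes "\<delta> > 0" "x \<in> sector_off_reals \<delta>"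
  shows "sin \<delta> > 0" "\<bar>Im x\<bar> \<ge> sin \<delta> * norm x" "x \<notin> \<real>" "x \<noteq> 0"
proof -
  have A: "\<delta> \<le> \<bar>Arg x\<bar>" "\<bar>Arg x\<bar> \<le> pi - \<delta>" and nz: "x \<noteq> 0"
    using assms(2) by (auto simp: sector_off_reals_def)
  note sn = sin_le_abs_sin[OF assms(1) A]
  show "sin \<delta> > 0" by (rule sn(1))
  have "x = rcis (norm x) (Arg x)" by (simp add: rcis_cmod_Arg)
  then have "Im x = norm x * sin (Arg x)" by (metis Im_rcis)
  then have "\<bar>Im x\<bar> = norm x * \<bar>sin (Arg x)\<bar>" by (simp add: abs_mult)
  then show le: "\<bar>Im x\<bar> \<ge> sin \<delta> * norm x"
    using sn(2) by (simp add: mult.commute mult_left_mono)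
  show "x \<noteq> 0" by (rule nz)
  have "sin \<delta> * norm x > 0" using sn(1) nz by simp
  then show "x \<notin> \<real>" using le by (auto simp: nonreal_Im)
qed

text \<open>The exponent \<open>m + 2\<close> is the next odd power after \<open>m\<close> in an
  expansion in odd powers.\<close>

lemma smallo_at_infinity_principal:
  fixes f :: "complex \<Rightarrow> complex"
  assumes "\<And>x. x \<in> S \<Longrightarrow> x \<noteq> 0 \<Longrightarrow> norm (f x) \<le> C / norm x ^ (m + 2)"
  shows "f \<in> o[inf at_infinity (principal S)](\<lambda>x. 1 / x ^ m)"
proof (rule landau_o.smallI)
  fix c :: real assume c: "c > 0"
  have "\<forall>\<^sub>F x in at_infinity. max 1 (\<bar>C\<bar> / c) \<le> norm (x :: complex)"
    unfolding eventually_at_infinity by blast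
  then show "\<forall>\<^sub>F x in inf at_infinity (principal S). norm (f x) \<le> c * norm (1 / x ^ m)"
    unfolding eventually_inf_principal
  proof eventually_elim
    case (elim x)
    show ?case
    proof
      assume "x \<in> S"
      from elim have x: "norm x \<ge> 1" "\<bar>C\<bar> \<le> c * norm x" using c by (simp_all add: field_simps)
      then have nx: "norm x > 0" by linarith
      then have "x \<noteq> 0" by auto
      have "norm (f x) \<le> C / norm x ^ (m + 2)"
        using assms[OF \<open>x \<in> S\<close> \<open>x \<noteq> 0\<close>] .
      also have "\<dots> \<le> (c * norm x) / norm x ^ (m + 2)"
        using x nx by (intro divide_right_mono) auto
      also have "\<dots> = c / norm x ^ (m + 1)"
        using nx by simp
      also have "\<dots> \<le> c / norm x ^ m"
        using c x nx by (intro divide_left_mono power_increasing mult_pos_pos zero_less_power) auto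
      also have "\<dots> = c * norm (1 / x ^ m)"
        by (simp add: norm_divide norm_power)
      finally show "norm (f x) \<le> c * norm (1 / x ^ m)" .
    qed
  qed
qed

lemma sum_lessThan_double:
  fixes f :: "nat \<Rightarrow> 'a :: comm_monoid_add"
  assumes "\<And>k. odd k \<Longrightarrow> f k = 0"
  shows "(\<Sum>k<2 * n + 2. f k) = (\<Sum>p\<le>n. f (2 * p))"
proof (induction n)
  case 0
  then show ?case using assms[of 1] by (simp add: numeral_2_eq_2)
next
  case (Suc n)
  have "{..<2 * Suc n + 2} = {..<Suc (Suc (2 * n + 2))}" by simp
  moreover have "f (Suc (2 * n + 2)) = 0" by (rule assms) simp
  ultimately have "(\<Sum>k<2 * Suc n + 2. f k) = (\<Sum>k<2 * n + 2. f k) + f (2 * n + 2)"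
    by (simp only: sum.lessThan_Suc add_0_right)
  then show ?case using Suc by simp
qed

lemma goe_resolvent_expansion:
  assumes g: "g > 0" and N: "N \<ge> 1" and \<delta>: "\<delta> > 0"
  shows "has_odd_expansion_at_infinity (goe_resolvent g N)
        (\<lambda>p. complex_of_real (g ^ p * goe_moment N (2 * p) / real N ^ p)) (sector_off_reals \<delta>)"
  unfolding has_odd_expansion_at_infinity_def
proof
  fix n :: nat
  define s where "s = sqrt (real N / g)"
  have s: "s > 0" "s\<^sup>2 = real N / g" using g N by (simp_all add: s_def)
  define \<rho> where "\<rho> = goe_density N"
  obtain R :: "nat \<Rightarrow> real \<Rightarrow> real" where "R 0 = goe_density N" "\<And>k. k \<le> 5 \<Longrightarrow> rapid (R k)"
    by (rule goe_density_derivatives[OF N]) (rule that)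
  then have \<rho>: "rapid \<rho>" by (metis zero_le \<rho>_def)
  \<comment> \<open>The last retained term has index \<open>2 * n\<close>. Expanding up to index
    \<open>2 * n + 1\<close>, whose moment is 0, gains one power, and
    \<open>1 / \<bar>Im\<bar>\<close> supplies another: the remainder is of order
    \<open>2 * n + 3\<close>.\<close>
  define m where "m = 2 * n + 2"
  define K where "K = (LBINT t. \<bar>t ^ m * \<rho> t\<bar>)"
  have K: "K \<ge> 0" by (simp add: K_def)
  define T where "T x = (\<Sum>p\<le>n. complex_of_real (g ^ p * goe_moment N (2 * p) / real N ^ p) / x ^ (2 * p + 1))" for x
  define C where "C = K / (s ^ m * sin \<delta>)"
  have diff: "goe_resolvent g N x - T x
      = of_real s * stieltjes (\<lambda>t. t ^ m * \<rho> t) (of_real s * x) / (of_real s * x) ^ m"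
    if x: "x \<notin> \<real>" "x \<noteq> 0" for x
  proof -
    define z where "z = of_real s * x"
    have z: "z \<notin> \<real>" unfolding z_def using mult_of_real_nonreal[of s x] s x by simp
    have "stieltjes \<rho> z = (\<Sum>k<m. of_real (goe_moment N k) / z ^ (k + 1)) + stieltjes (\<lambda>t. t ^ m * \<rho> t) z / z ^ m"
      using stieltjes_expansion[OF \<rho> z, of m] by (simp only: goe_moment_eq_integral[OF N] \<rho>_def)
    also have "(\<Sum>k<m. of_real (goe_moment N k) / z ^ (k + 1)) = (\<Sum>p\<le>n. of_real (goe_moment N (2 * p)) / z ^ (2 * p + 1))"
      unfolding m_def by (rule sum_lessThan_double) (simp add: goe_moment_odd)
    finally have "goe_resolvent g N x = of_real s * (\<Sum>p\<le>n. of_real (goe_moment N (2 * p)) / z ^ (2 * p + 1))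
        + of_real s * stieltjes (\<lambda>t. t ^ m * \<rho> t) z / z ^ m"
      using goe_resolvent_eq_stieltjes[OF g N x(1)] by (simp add: s_def z_def \<rho>_def distrib_left)
    also have "of_real s * (\<Sum>p\<le>n. of_real (goe_moment N (2 * p)) / z ^ (2 * p + 1))
        = T x"
      unfolding T_def sum_distrib_left
    proof (rule sum.cong[OF refl])
      fix p
      have "s ^ (2 * p) = (real N / g) ^ p" by (simp add: power_mult s)
      then have "g ^ p * goe_moment N (2 * p) / real N ^ p = goe_moment N (2 * p) / s ^ (2 * p)"
        by (simp add: power_divide)
      moreover have "of_real s * (of_real (goe_moment N (2 * p)) / z ^ (2 * p + 1))
          = complex_of_real (goe_moment N (2 * p) / s ^ (2 * p)) / x ^ (2 * p + 1)"
        using s x by (simp add: z_def power_mult_distrib)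
      ultimately show "of_real s * (of_real (goe_moment N (2 * p)) / z ^ (2 * p + 1))
          = complex_of_real (g ^ p * goe_moment N (2 * p) / real N ^ p) / x ^ (2 * p + 1)"
        by simp
    qed
    finally show ?thesis by (simp add: z_def)
  qed
  have "(\<lambda>x. goe_resolvent g N x - T x) \<in> o[inf at_infinity (principal (sector_off_reals \<delta>))](\<lambda>x. 1 / x ^ (2 * n + 1))"
  proof (rule smallo_at_infinity_principal[where C = C])
    fix x assume "x \<in> sector_off_reals \<delta>"
    note x = sector_off_reals_Im[OF \<delta> this]
    define z where "z = of_real s * x"
    have z: "z \<notin> \<real>" unfolding z_def using mult_of_real_nonreal[of s x] s x by simp
    have nx: "norm x > 0" using x by simp
    have Im: "\<bar>Im z\<bar> = s * \<bar>Im x\<bar>" using s by (simp add: z_def abs_mult)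
    have "norm (goe_resolvent g N x - T x)
        = s * norm (stieltjes (\<lambda>t. t ^ m * \<rho> t) z) / (s * norm x) ^ m"
      unfolding diff[OF x(3,4)] using s by (simp add: norm_divide norm_mult norm_power z_def)
    also have "\<dots> \<le> s * (K / \<bar>Im z\<bar>) / (s * norm x) ^ m"
      using norm_stieltjes_le[OF rapid_power_mult[OF \<rho>] z, of m] s
      by (intro divide_right_mono mult_left_mono) (auto simp: K_def)
    also have "\<dots> = K / (s ^ m * norm x ^ m) / \<bar>Im x\<bar>"
      unfolding Im using s by (simp add: power_mult_distrib)
    also have "\<dots> \<le> K / (s ^ m * norm x ^ m) / (sin \<delta> * norm x)"
      using x nx s K by (intro divide_left_mono divide_nonneg_nonneg mult_nonneg_nonneg mult_pos_pos)
        (auto simp: nonreal_Im)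
    also have "\<dots> = C / norm x ^ (m + 1)"
      by (simp add: C_def)
    finally show "norm (goe_resolvent g N x - T x)
        \<le> C / norm x ^ (2 * n + 1 + 2)"
      by (simp add: m_def)
  qed
  then show "(\<lambda>x. goe_resolvent g N x - (\<Sum>p\<le>n. complex_of_real (g ^ p * goe_moment N (2 * p) / real N ^ p) / x ^ (2 * p + 1)))
      \<in> o[inf at_infinity (principal (sector_off_reals \<delta>))](\<lambda>x. 1 / x ^ (2 * n + 1))"
    by (simp add: T_def)
qed

lemma
  fixes g :: real and N :: nat
  assumes g: "g > 0" and N: "N \<ge> 1"
  defines "W \<equiv> goe_resolvent g N" and "G \<equiv> complex_of_real g" and "n \<equiv> of_nat N :: complex"
  shows goe_resolvent_holomorphic: "W holomorphic_on (- \<real>)"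
    and goe_resolvent_ode: "x \<notin> \<real> \<Longrightarrow> - 4 * (G ^ 4 / n ^ 4) * (deriv ^^ 5) W x
          + 5 * (x ^ 2 - (4 * n - 2) * (G / n)) * (G ^ 2 / n ^ 2) * (deriv ^^ 3) W x
          - 6 * (G ^ 2 / n ^ 2) * x * (deriv ^^ 2) W x
          + (- (x ^ 4) + (8 * n - 4) * (G / n) * x ^ 2
              + (- 16 * n ^ 2 + 16 * n + 2) * (G ^ 2 / n ^ 2)) * deriv W x
          + x * (x ^ 2 - (4 * n - 2) * (G / n)) * W x
          = 2 * n * (x ^ 2 - 4 * G) + 10 * G" (is "_ \<Longrightarrow> ?L = ?R")
proof -
  define s where "s = sqrt (real N / g)"
  have s: "s > 0" "s\<^sup>2 = real N / g" using g N by (simp_all add: s_def)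
  obtain R :: "nat \<Rightarrow> real \<Rightarrow> real" where R: "R 0 = goe_density N"
    "\<And>k t. k < 5 \<Longrightarrow> (R k has_real_derivative R (Suc k) t) (at t)"
    "\<And>k. k \<le> 5 \<Longrightarrow> rapid (R k)" "\<And>t. goe_operator N R t = 0"
    by (rule goe_density_derivatives[OF N]) (rule that)
  have W: "W x = of_real s * stieltjes (R 0) (of_real s * x)" if "x \<notin> \<real>" for x
    unfolding W_def R(1) s_def by (rule goe_resolvent_eq_stieltjes[OF g N that])
  have s0: "s \<noteq> 0" using s by simp
  have "W field_differentiable at x" if "x \<notin> \<real>" for x
    using scaled_stieltjes_has_derivative[OF W R(2)[of 0] R(3) R(3) s0 that] by (auto simp: field_differentiable_def)
  then show "W holomorphic_on (- \<real>)"
    by (auto simp: holomorphic_on_def intro: field_differentiable_at_within)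
  assume x: "x \<notin> \<real>"
  define \<sigma> where "\<sigma> = complex_of_real s"
  define z where "z = \<sigma> * x"
  define S where "S k = stieltjes (R k) z" for k
  have \<sigma>: "\<sigma> \<noteq> 0" using s by (simp add: \<sigma>_def)
  have d: "(deriv ^^ k) W x = \<sigma> ^ (k + 1) * S k" if "k \<le> 5" for k
    unfolding \<sigma>_def S_def z_def
    by (rule deriv_scaled_stieltjes[where m = 5]) (use W R s0 that x in auto)
  have d1: "deriv W x = \<sigma> ^ 2 * S 1" and d0: "W x = \<sigma> * S 0"
    using d[of 1] d[of 0] by (simp_all add: power2_eq_square)
  have z: "z \<notin> \<real>" unfolding z_def \<sigma>_def by (rule mult_of_real_nonreal[OF s0 x])
  have ode: "- 4 * S 5 + 5 * (z\<^sup>2 - (4 * n - 2)) * S 3 - 6 * z * S 2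
     + (- (z ^ 4) + (8 * n - 4) * z\<^sup>2 + (- 16 * n\<^sup>2 + 16 * n + 2)) * S 1
     + z * (z\<^sup>2 - (4 * n - 2)) * S 0 = 2 * n * z\<^sup>2 - 8 * n\<^sup>2 + 10 * n"
    unfolding S_def n_def by (rule stieltjes_ode[OF N z R(1,2,3,4)])
  have \<sigma>2: "\<sigma>\<^sup>2 = n / G"
    unfolding \<sigma>_def n_def G_def using s(2) by (metis of_real_divide of_real_of_nat_eq of_real_power)
  have "n \<noteq> 0" "G \<noteq> 0" using g N by (auto simp: n_def G_def)
  then have Gn: "G / n = 1 / \<sigma>\<^sup>2" and nG: "n = G * \<sigma>\<^sup>2"
    using \<sigma>2 by simp_all
  have Gn': "G\<^sup>2 / n\<^sup>2 = 1 / \<sigma> ^ 4" "G ^ 4 / n ^ 4 = 1 / \<sigma> ^ 8"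
    unfolding power_divide[symmetric] Gn by (simp_all add: power_divide flip: power_mult)
  \<comment> \<open>The derivative of order \<open>k\<close> carries
    \<open>\<sigma> ^ (k + 1)\<close> and \<open>G / n\<close> is the inverse of
    \<open>\<sigma>\<^sup>2\<close>. Multiplied by \<open>\<sigma>\<^sup>2\<close>, each term of the
    scaled equation at \<open>x\<close> is thus the corresponding term of the unscaled one at
    \<open>z = \<sigma> * x\<close>.\<close>
  have terms: "\<sigma>\<^sup>2 * (- 4 * (1 / \<sigma> ^ 8) * (\<sigma> ^ 6 * S 5)) = - 4 * S 5"
    "\<sigma>\<^sup>2 * (5 * (x\<^sup>2 - (4 * n - 2) * (1 / \<sigma>\<^sup>2)) * (1 / \<sigma> ^ 4) * (\<sigma> ^ 4 * S 3)) = 5 * (z\<^sup>2 - (4 * n - 2)) * S 3"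
    "\<sigma>\<^sup>2 * (6 * (1 / \<sigma> ^ 4) * x * (\<sigma> ^ 3 * S 2)) = 6 * z * S 2"
    "\<sigma>\<^sup>2 * ((- (x ^ 4) + (8 * n - 4) * (1 / \<sigma>\<^sup>2) * x\<^sup>2 + (- 16 * n\<^sup>2 + 16 * n + 2) * (1 / \<sigma> ^ 4)) * (\<sigma>\<^sup>2 * S 1))
      = (- (z ^ 4) + (8 * n - 4) * z\<^sup>2 + (- 16 * n\<^sup>2 + 16 * n + 2)) * S 1"
    "\<sigma>\<^sup>2 * (x * (x\<^sup>2 - (4 * n - 2) * (1 / \<sigma>\<^sup>2)) * (\<sigma> * S 0)) = z * (z\<^sup>2 - (4 * n - 2)) * S 0"
  proof -
    \<comment> \<open>The polynomials in \<open>n\<close> are hidden so that clearing the powers of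
      \<sigma> does not expand them.\<close>
    define A B C where "A = 4 * n - 2" and "B = 8 * n - 4" and "C = - 16 * n\<^sup>2 + 16 * n + 2"
    show "\<sigma>\<^sup>2 * (- 4 * (1 / \<sigma> ^ 8) * (\<sigma> ^ 6 * S 5)) = - 4 * S 5"
      using \<sigma> by (simp add: field_simps flip: power_add)
    show "\<sigma>\<^sup>2 * (6 * (1 / \<sigma> ^ 4) * x * (\<sigma> ^ 3 * S 2)) = 6 * z * S 2"
      using \<sigma> by (simp add: z_def field_simps eval_nat_numeral)
    have "\<sigma>\<^sup>2 * (5 * (x\<^sup>2 - A * (1 / \<sigma>\<^sup>2)) * (1 / \<sigma> ^ 4) * (\<sigma> ^ 4 * S 3)) = 5 * (z\<^sup>2 - A) * S 3"
      using \<sigma> by (simp add: z_def field_simps)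
    then show "\<sigma>\<^sup>2 * (5 * (x\<^sup>2 - (4 * n - 2) * (1 / \<sigma>\<^sup>2)) * (1 / \<sigma> ^ 4) * (\<sigma> ^ 4 * S 3)) = 5 * (z\<^sup>2 - (4 * n - 2)) * S 3"
      by (simp only: A_def)
    have "\<sigma>\<^sup>2 * ((- (x ^ 4) + B * (1 / \<sigma>\<^sup>2) * x\<^sup>2 + C * (1 / \<sigma> ^ 4)) * (\<sigma>\<^sup>2 * S 1)) = (- (z ^ 4) + B * z\<^sup>2 + C) * S 1"
      using \<sigma> by (simp add: z_def field_simps eval_nat_numeral)
    then show "\<sigma>\<^sup>2 * ((- (x ^ 4) + (8 * n - 4) * (1 / \<sigma>\<^sup>2) * x\<^sup>2 + (- 16 * n\<^sup>2 + 16 * n + 2) * (1 / \<sigma> ^ 4)) * (\<sigma>\<^sup>2 * S 1))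
      = (- (z ^ 4) + (8 * n - 4) * z\<^sup>2 + (- 16 * n\<^sup>2 + 16 * n + 2)) * S 1"
      by (simp only: B_def C_def)
    have "\<sigma>\<^sup>2 * (x * (x\<^sup>2 - A * (1 / \<sigma>\<^sup>2)) * (\<sigma> * S 0)) = z * (z\<^sup>2 - A) * S 0"
      using \<sigma> by (simp add: z_def field_simps eval_nat_numeral)
    then show "\<sigma>\<^sup>2 * (x * (x\<^sup>2 - (4 * n - 2) * (1 / \<sigma>\<^sup>2)) * (\<sigma> * S 0)) = z * (z\<^sup>2 - (4 * n - 2)) * S 0"
      by (simp only: A_def)
  qed
  have dk: "(deriv ^^ 5) W x = \<sigma> ^ 6 * S 5" "(deriv ^^ 3) W x = \<sigma> ^ 4 * S 3" "(deriv ^^ 2) W x = \<sigma> ^ 3 * S 2"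
    using d[of 5] d[of 3] d[of 2] by simp_all
  have "\<sigma>\<^sup>2 * ?L
      = - 4 * S 5 + 5 * (z\<^sup>2 - (4 * n - 2)) * S 3 - 6 * z * S 2
     + (- (z ^ 4) + (8 * n - 4) * z\<^sup>2 + (- 16 * n\<^sup>2 + 16 * n + 2)) * S 1
     + z * (z\<^sup>2 - (4 * n - 2)) * S 0"
    unfolding dk d1 d0 Gn Gn'
    by (simp only: distrib_left[of "\<sigma>\<^sup>2"] right_diff_distrib[of "\<sigma>\<^sup>2"] terms)
  also have "\<dots> = 2 * n * z\<^sup>2 - 8 * n\<^sup>2 + 10 * n" by (rule ode)
  also have "\<dots> = \<sigma>\<^sup>2 * ?R"
    unfolding z_def using nG by algebra
  finally show "?L = ?R"
    using \<sigma> by simp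
qed

theorem theorem9:
  fixes g :: real and N :: nat
  assumes "g > 0" and "N \<ge> 1"
  shows
    "goe_resolvent g N holomorphic_on (- \<real>) \<and>
     (\<forall>x::complex. x \<notin> \<real> \<longrightarrow>
        (let W = goe_resolvent g N; G = complex_of_real g; n = (of_nat N :: complex) in
          - 4 * (G ^ 4 / n ^ 4) * (deriv ^^ 5) W x
          + 5 * (x ^ 2 - (4 * n - 2) * (G / n)) * (G ^ 2 / n ^ 2) * (deriv ^^ 3) W x
          - 6 * (G ^ 2 / n ^ 2) * x * (deriv ^^ 2) W x
          + (- (x ^ 4) + (8 * n - 4) * (G / n) * x ^ 2
              + (- 16 * n ^ 2 + 16 * n + 2) * (G ^ 2 / n ^ 2)) * deriv W x
          + x * (x ^ 2 - (4 * n - 2) * (G / n)) * W x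
          = 2 * n * (x ^ 2 - 4 * G) + 10 * G)) \<and>
     (\<forall>\<delta>>0. has_odd_expansion_at_infinity (goe_resolvent g N)
        (\<lambda>p. complex_of_real (g ^ p * goe_moment N (2 * p) / real N ^ p))
        (sector_off_reals \<delta>)) \<and>
     goe_moment N 0 = real N \<and>
     goe_moment N 2 = real N ^ 2 + real N \<and>
     goe_moment N 4 = 2 * real N ^ 3 + 5 * real N ^ 2 + 5 * real N \<and>
     goe_moment N 6 = 5 * real N ^ 4 + 22 * real N ^ 3 + 52 * real N ^ 2 + 41 * real N \<and>
     goe_moment N 8 = 14 * real N ^ 5 + 93 * real N ^ 4 + 374 * real N ^ 3
       + 690 * real N ^ 2 + 509 * real N \<and>
     goe_moment N 10 = 42 * real N ^ 6 + 386 * real N ^ 5 + 2290 * real N ^ 4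
       + 7150 * real N ^ 3 + 12143 * real N ^ 2 + 8229 * real N \<and>
     goe_moment N 12 = 132 * real N ^ 7 + 1586 * real N ^ 6 + 12798 * real N ^ 5
       + 58760 * real N ^ 4 + 167148 * real N ^ 3 + 258479 * real N ^ 2 + 166377 * real N"
  unfolding Let_def
  by (intro conjI allI impI goe_resolvent_holomorphic goe_resolvent_ode goe_resolvent_expansion
        goe_moment_0 goe_moment_2 goe_moments_4_to_12 assms; assumption)

end
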